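(* The class of graph $C^*$-algebras is closed under stabilization; that is, for every directed graph $G$ (with countably many vertices and edges) there exists a directed graph $F$ (with countably many vertices and edges) such that $C^*(G)\otimes\mathcal{K}\cong C^*(F)$.
   Context: Graphs: a graph $G=(G^0,G^1,r,s)$ consists of countable sets $G^0$ (vertices) and $G^1$ (edges) and maps $r,s:G^1\to G^0$ (range and source). A vertex $v$ is singular if $s^{-1}(v)$ is empty or infinite. Graph algebra: a Cuntz-Krieger $G$-family consists of mutually orthogonal projections $\{p_v: v\in G^0\}$ and partial isometries $\{s_e: e\in G^1\}$ with mutually orthogonal ranges such that (1) $s_e^*s_e=p_{r(e)}$ for every $e\in G^1$; (2) $s_es_e^*\le p_{s(e)}$ for every $e\in G^1$; (3) $p_v=\sum_{s(e)=v}s_es_e^*$ for every $v\in G^0$ that is not singular. $C^*(G)$, the graph $C^*$-algebra of $G$, is the $C^*$-algebra generated by a universal Cuntz-Krieger $G$-family. $\mathcal{K}$ denotes the compact operators on a separable infinite-dimensional Hilbert space; the stabilization of a $C^*$-algebra $A$ is $A\otimes\mathcal{K}$. *)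

theory Defs
  imports
    "HOL-Analysis.Analysis"
    "HOL-Algebra.Module"
    "Graph_Theory.Digraph"
begin

section \<open>C*-algebras\<close>

text \<open>
  C*-algebras need not be unital: the field \<open>one\<close> inherited from the record of rings is
  constrained nowhere and plays no role.
\<close>

record 'a cstar = "(complex, 'a) module" +
  star :: "'a \<Rightarrow> 'a" (\<open>_\<^sup>\<star>\<index>\<close> [1000] 999)
  cnorm :: "'a \<Rightarrow> real" (\<open>\<parallel>_\<parallel>\<index>\<close> [0] 1000)

definition cstar_tendsto :: "('a, 'm) cstar_scheme \<Rightarrow> (nat \<Rightarrow> 'a) \<Rightarrow> 'a \<Rightarrow> bool" where
  "cstar_tendsto A x l \<longleftrightarrow> (\<lambda>n. \<parallel>x n \<ominus>\<^bsub>A\<^esub> l\<parallel>\<^bsub>A\<^esub>) \<longlonglongrightarrow> 0"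

definition complex_ring :: "complex ring" where
  "complex_ring = \<lparr>carrier = UNIV, monoid.mult = (*), one = 1, ring.zero = 0, add = (+)\<rparr>"

locale cstar_algebra = Module.module complex_ring A
  for A :: "('a, 'm) cstar_scheme" (structure) +
  assumes mult_closed: "\<lbrakk>x \<in> carrier A; y \<in> carrier A\<rbrakk> \<Longrightarrow> x \<otimes> y \<in> carrier A"
    and mult_assoc: "\<lbrakk>x \<in> carrier A; y \<in> carrier A; z \<in> carrier A\<rbrakk>
      \<Longrightarrow> (x \<otimes> y) \<otimes> z = x \<otimes> (y \<otimes> z)"
    and mult_add_left: "\<lbrakk>x \<in> carrier A; y \<in> carrier A; z \<in> carrier A\<rbrakk>
      \<Longrightarrow> (x \<oplus> y) \<otimes> z = x \<otimes> z \<oplus> y \<otimes> z"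
    and mult_add_right: "\<lbrakk>x \<in> carrier A; y \<in> carrier A; z \<in> carrier A\<rbrakk>
      \<Longrightarrow> z \<otimes> (x \<oplus> y) = z \<otimes> x \<oplus> z \<otimes> y"
    and mult_smult_left: "\<lbrakk>x \<in> carrier A; y \<in> carrier A\<rbrakk>
      \<Longrightarrow> (c \<odot> x) \<otimes> y = c \<odot> (x \<otimes> y)"
    and mult_smult_right: "\<lbrakk>x \<in> carrier A; y \<in> carrier A\<rbrakk>
      \<Longrightarrow> x \<otimes> (c \<odot> y) = c \<odot> (x \<otimes> y)"
    and star_closed: "x \<in> carrier A \<Longrightarrow> x\<^sup>\<star> \<in> carrier A"
    and star_star: "x \<in> carrier A \<Longrightarrow> (x\<^sup>\<star>)\<^sup>\<star> = x"
    and star_add: "\<lbrakk>x \<in> carrier A; y \<in> carrier A\<rbrakk> \<Longrightarrow> (x \<oplus> y)\<^sup>\<star> = x\<^sup>\<star> \<oplus> y\<^sup>\<star>"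
    and star_smult: "x \<in> carrier A \<Longrightarrow> (c \<odot> x)\<^sup>\<star> = cnj c \<odot> x\<^sup>\<star>"
    and star_mult: "\<lbrakk>x \<in> carrier A; y \<in> carrier A\<rbrakk> \<Longrightarrow> (x \<otimes> y)\<^sup>\<star> = y\<^sup>\<star> \<otimes> x\<^sup>\<star>"
    and norm_eq_0_iff: "x \<in> carrier A \<Longrightarrow> \<parallel>x\<parallel> = 0 \<longleftrightarrow> x = \<zero>"
    and norm_add: "\<lbrakk>x \<in> carrier A; y \<in> carrier A\<rbrakk> \<Longrightarrow> \<parallel>x \<oplus> y\<parallel> \<le> \<parallel>x\<parallel> + \<parallel>y\<parallel>"
    and norm_smult: "x \<in> carrier A \<Longrightarrow> \<parallel>c \<odot> x\<parallel> = cmod c * \<parallel>x\<parallel>"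
    and norm_mult: "\<lbrakk>x \<in> carrier A; y \<in> carrier A\<rbrakk> \<Longrightarrow> \<parallel>x \<otimes> y\<parallel> \<le> \<parallel>x\<parallel> * \<parallel>y\<parallel>"
    and norm_star_mult: "x \<in> carrier A \<Longrightarrow> \<parallel>x\<^sup>\<star> \<otimes> x\<parallel> = \<parallel>x\<parallel>\<^sup>2"
    and complete: "\<lbrakk>\<And>n. f n \<in> carrier A;
        \<And>\<epsilon>. \<epsilon> > 0 \<Longrightarrow> \<exists>N. \<forall>m\<ge>N. \<forall>n\<ge>N. \<parallel>f m \<ominus> f n\<parallel> < \<epsilon>\<rbrakk>
      \<Longrightarrow> \<exists>l\<in>carrier A. cstar_tendsto A f l"

definition closed_star_subalgebra :: "('a, 'm) cstar_scheme \<Rightarrow> 'a set \<Rightarrow> bool" where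
  "closed_star_subalgebra A S \<longleftrightarrow>
     S \<subseteq> carrier A \<and> \<zero>\<^bsub>A\<^esub> \<in> S \<and>
     (\<forall>x\<in>S. \<forall>y\<in>S. x \<oplus>\<^bsub>A\<^esub> y \<in> S \<and> x \<otimes>\<^bsub>A\<^esub> y \<in> S) \<and>
     (\<forall>c. \<forall>x\<in>S. c \<odot>\<^bsub>A\<^esub> x \<in> S) \<and>
     (\<forall>x\<in>S. x\<^sup>\<star>\<^bsub>A\<^esub> \<in> S) \<and>
     (\<forall>f l. (\<forall>n. f n \<in> S) \<and> l \<in> carrier A \<and> cstar_tendsto A f l \<longrightarrow> l \<in> S)"

definition cstar_generates :: "('a, 'm) cstar_scheme \<Rightarrow> 'a set \<Rightarrow> bool" where
  "cstar_generates A X \<longleftrightarrow>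
     X \<subseteq> carrier A \<and> (\<forall>S. closed_star_subalgebra A S \<and> X \<subseteq> S \<longrightarrow> S = carrier A)"

definition cstar_hom :: "('a, 'm) cstar_scheme \<Rightarrow> ('b, 'n) cstar_scheme \<Rightarrow> ('a \<Rightarrow> 'b) set" where
  "cstar_hom A B = {h \<in> carrier A \<rightarrow> carrier B.
     (\<forall>x\<in>carrier A. \<forall>y\<in>carrier A.
        h (x \<oplus>\<^bsub>A\<^esub> y) = h x \<oplus>\<^bsub>B\<^esub> h y \<and> h (x \<otimes>\<^bsub>A\<^esub> y) = h x \<otimes>\<^bsub>B\<^esub> h y) \<and>
     (\<forall>c. \<forall>x\<in>carrier A. h (c \<odot>\<^bsub>A\<^esub> x) = c \<odot>\<^bsub>B\<^esub> h x) \<and>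
     (\<forall>x\<in>carrier A. h (x\<^sup>\<star>\<^bsub>A\<^esub>) = (h x)\<^sup>\<star>\<^bsub>B\<^esub>)}"

definition cstar_isomorphic ::
    "('a, 'm) cstar_scheme \<Rightarrow> ('b, 'n) cstar_scheme \<Rightarrow> bool" (infix \<open>\<cong>\<^sub>C\<close> 50) where
  "A \<cong>\<^sub>C B \<longleftrightarrow> (\<exists>h\<in>cstar_hom A B. bij_betw h (carrier A) (carrier B))"

definition projection :: "('a, 'm) cstar_scheme \<Rightarrow> 'a \<Rightarrow> bool" where
  "projection A p \<longleftrightarrow> p \<in> carrier A \<and> p\<^sup>\<star>\<^bsub>A\<^esub> = p \<and> p \<otimes>\<^bsub>A\<^esub> p = p"

definition partial_isometry :: "('a, 'm) cstar_scheme \<Rightarrow> 'a \<Rightarrow> bool" where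
  "partial_isometry A s \<longleftrightarrow> s \<in> carrier A \<and> s \<otimes>\<^bsub>A\<^esub> s\<^sup>\<star>\<^bsub>A\<^esub> \<otimes>\<^bsub>A\<^esub> s = s"

definition projection_le :: "('a, 'm) cstar_scheme \<Rightarrow> 'a \<Rightarrow> 'a \<Rightarrow> bool" where
  "projection_le A p q \<longleftrightarrow> q \<otimes>\<^bsub>A\<^esub> p = p \<and> p \<otimes>\<^bsub>A\<^esub> q = p"

definition projection_orth :: "('a, 'm) cstar_scheme \<Rightarrow> 'a \<Rightarrow> 'a \<Rightarrow> bool" where
  "projection_orth A p q \<longleftrightarrow> p \<otimes>\<^bsub>A\<^esub> q = \<zero>\<^bsub>A\<^esub>"


section \<open>Graph C*-algebras\<close>

text \<open>
  Directed graphs are those of \<^theory>\<open>Graph_Theory.Digraph\<close>, with multiple edges and loops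
  allowed. The source of an edge is its tail, the range its head.
\<close>

definition countable_digraph :: "('v, 'e) pre_digraph \<Rightarrow> bool" where
  "countable_digraph G \<longleftrightarrow> wf_digraph G \<and> countable (verts G) \<and> countable (arcs G)"

definition singular_vertex :: "('v, 'e) pre_digraph \<Rightarrow> 'v \<Rightarrow> bool" where
  "singular_vertex G v \<longleftrightarrow> out_arcs G v = {} \<or> infinite (out_arcs G v)"

definition ck_family ::
    "('v, 'e) pre_digraph \<Rightarrow> ('a, 'm) cstar_scheme \<Rightarrow> ('v \<Rightarrow> 'a) \<Rightarrow> ('e \<Rightarrow> 'a) \<Rightarrow> bool" where
  "ck_family G A p s \<longleftrightarrow>
     (\<forall>v\<in>verts G. projection A (p v)) \<and>
     (\<forall>v\<in>verts G. \<forall>w\<in>verts G. v \<noteq> w \<longrightarrow> projection_orth A (p v) (p w)) \<and>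
     (\<forall>e\<in>arcs G. partial_isometry A (s e)) \<and>
     (\<forall>e\<in>arcs G. \<forall>f\<in>arcs G. e \<noteq> f \<longrightarrow>
        projection_orth A (s e \<otimes>\<^bsub>A\<^esub> (s e)\<^sup>\<star>\<^bsub>A\<^esub>) (s f \<otimes>\<^bsub>A\<^esub> (s f)\<^sup>\<star>\<^bsub>A\<^esub>)) \<and>
     (\<forall>e\<in>arcs G. (s e)\<^sup>\<star>\<^bsub>A\<^esub> \<otimes>\<^bsub>A\<^esub> s e = p (head G e)) \<and>
     (\<forall>e\<in>arcs G. projection_le A (s e \<otimes>\<^bsub>A\<^esub> (s e)\<^sup>\<star>\<^bsub>A\<^esub>) (p (tail G e))) \<and>
     (\<forall>v\<in>verts G. \<not> singular_vertex G v \<longrightarrow>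
        p v = (\<Oplus>\<^bsub>A\<^esub>e\<in>out_arcs G v. s e \<otimes>\<^bsub>A\<^esub> (s e)\<^sup>\<star>\<^bsub>A\<^esub>))"

text \<open>
  Universality has to be tested on C*-algebras carried by subsets of one fixed type. Sets of
  real numbers suffice: for a countable graph, a Cuntz-Krieger family lies in a separable
  C*-subalgebra, which has at most continuum many elements. The theorem
  \<open>universal_ck_family_any_type\<close> below extends the universal property to every type.
\<close>

definition universal_ck_family ::
    "('v, 'e) pre_digraph \<Rightarrow> ('a, 'm) cstar_scheme \<Rightarrow> ('v \<Rightarrow> 'a) \<Rightarrow> ('e \<Rightarrow> 'a) \<Rightarrow> bool" where
  "universal_ck_family G A p s \<longleftrightarrow>
     ck_family G A p s \<and>
     (\<forall>(B :: real cstar) q t. cstar_algebra B \<and> ck_family G B q t \<longrightarrow>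
        (\<exists>h\<in>cstar_hom A B. (\<forall>v\<in>verts G. h (p v) = q v) \<and> (\<forall>e\<in>arcs G. h (s e) = t e)))"

definition is_graph_cstar_algebra :: "('v, 'e) pre_digraph \<Rightarrow> ('a, 'm) cstar_scheme \<Rightarrow> bool" where
  "is_graph_cstar_algebra G A \<longleftrightarrow> cstar_algebra A \<and>
     (\<exists>p s. universal_ck_family G A p s \<and> cstar_generates A (p ` verts G \<union> s ` arcs G))"


section \<open>The compact operators\<close>

definition l2 :: "(nat \<Rightarrow> complex) set" where
  "l2 = {x. summable (\<lambda>i. (cmod (x i))\<^sup>2)}"

definition l2_inner :: "(nat \<Rightarrow> complex) \<Rightarrow> (nat \<Rightarrow> complex) \<Rightarrow> complex" where
  "l2_inner x y = (\<Sum>i. cnj (x i) * y i)"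

definition l2_norm :: "(nat \<Rightarrow> complex) \<Rightarrow> real" where
  "l2_norm x = sqrt (\<Sum>i. (cmod (x i))\<^sup>2)"

type_synonym l2_op = "(nat \<Rightarrow> complex) \<Rightarrow> (nat \<Rightarrow> complex)"

text \<open>
  Operators are taken extensional (\<^const>\<open>undefined\<close> outside \<^const>\<open>l2\<close>), so that equality of
  functions is equality of operators. Boundedness follows from compactness.
\<close>

definition compact_operator :: "l2_op \<Rightarrow> bool" where
  "compact_operator T \<longleftrightarrow>
     T \<in> l2 \<rightarrow>\<^sub>E l2 \<and>
     (\<forall>x\<in>l2. \<forall>y\<in>l2. T (\<lambda>i. x i + y i) = (\<lambda>i. T x i + T y i)) \<and>
     (\<forall>c. \<forall>x\<in>l2. T (\<lambda>i. c * x i) = (\<lambda>i. c * T x i)) \<and>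
     (\<forall>X :: nat \<Rightarrow> nat \<Rightarrow> complex. (\<forall>n. X n \<in> l2 \<and> l2_norm (X n) \<le> 1) \<longrightarrow>
        (\<exists>(r :: nat \<Rightarrow> nat) y. strict_mono r \<and> y \<in> l2 \<and>
          (\<lambda>n. l2_norm (\<lambda>i. T (X (r n)) i - y i)) \<longlonglongrightarrow> 0))"

definition l2_adjoint :: "l2_op \<Rightarrow> l2_op" where
  "l2_adjoint T = (THE S. S \<in> l2 \<rightarrow>\<^sub>E l2 \<and>
     (\<forall>x\<in>l2. \<forall>y\<in>l2. l2_inner (T x) y = l2_inner x (S y)))"

definition l2_op_norm :: "l2_op \<Rightarrow> real" where
  "l2_op_norm T = (SUP x\<in>{x\<in>l2. l2_norm x \<le> 1}. l2_norm (T x))"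

definition compact_operators :: "l2_op cstar" (\<open>\<K>\<close>) where
  "\<K> = \<lparr>carrier = {T. compact_operator T},
     monoid.mult = compose l2,
     one = undefined,
     ring.zero = (\<lambda>x\<in>l2. \<lambda>i. 0),
     add = (\<lambda>S T. \<lambda>x\<in>l2. \<lambda>i. S x i + T x i),
     smult = (\<lambda>c T. \<lambda>x\<in>l2. \<lambda>i. c * T x i),
     star = l2_adjoint,
     cnorm = l2_op_norm\<rparr>"


section \<open>Tensor products and stabilization\<close>

text \<open>
  \<open>B\<close>, with elementary tensors \<open>\<tau> a c\<close>, is the completion of the algebraic tensor product
  \<open>A \<odot> C\<close> in some C*-cross norm. \<open>tensor_inj\<close> says that \<open>\<tau>\<close> induces an injective map on
  the algebraic tensor product: every element of \<open>A \<odot> C\<close> is a sum of elementary tensors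
  whose second components are linearly independent, and it vanishes only if all first
  components do. For \<open>C = \<K>\<close>, which is nuclear, there is exactly one C*-norm on the algebraic
  tensor product, so that \<open>B\<close> is determined up to isomorphism.
\<close>

locale cstar_tensor_product = B: cstar_algebra B
  for A :: "('a, 'm) cstar_scheme" and C :: "('c, 'n) cstar_scheme"
    and B :: "('b, 'k) cstar_scheme" and \<tau> :: "'a \<Rightarrow> 'c \<Rightarrow> 'b" +
  assumes tensor_closed: "\<lbrakk>a \<in> carrier A; c \<in> carrier C\<rbrakk> \<Longrightarrow> \<tau> a c \<in> carrier B"
    and tensor_add_left: "\<lbrakk>a \<in> carrier A; a' \<in> carrier A; c \<in> carrier C\<rbrakk>
      \<Longrightarrow> \<tau> (a \<oplus>\<^bsub>A\<^esub> a') c = \<tau> a c \<oplus>\<^bsub>B\<^esub> \<tau> a' c"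
    and tensor_add_right: "\<lbrakk>a \<in> carrier A; c \<in> carrier C; c' \<in> carrier C\<rbrakk>
      \<Longrightarrow> \<tau> a (c \<oplus>\<^bsub>C\<^esub> c') = \<tau> a c \<oplus>\<^bsub>B\<^esub> \<tau> a c'"
    and tensor_smult_left: "\<lbrakk>a \<in> carrier A; c \<in> carrier C\<rbrakk>
      \<Longrightarrow> \<tau> (z \<odot>\<^bsub>A\<^esub> a) c = z \<odot>\<^bsub>B\<^esub> \<tau> a c"
    and tensor_smult_right: "\<lbrakk>a \<in> carrier A; c \<in> carrier C\<rbrakk>
      \<Longrightarrow> \<tau> a (z \<odot>\<^bsub>C\<^esub> c) = z \<odot>\<^bsub>B\<^esub> \<tau> a c"
    and tensor_mult: "\<lbrakk>a \<in> carrier A; a' \<in> carrier A; c \<in> carrier C; c' \<in> carrier C\<rbrakk>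
      \<Longrightarrow> \<tau> a c \<otimes>\<^bsub>B\<^esub> \<tau> a' c' = \<tau> (a \<otimes>\<^bsub>A\<^esub> a') (c \<otimes>\<^bsub>C\<^esub> c')"
    and tensor_star: "\<lbrakk>a \<in> carrier A; c \<in> carrier C\<rbrakk>
      \<Longrightarrow> (\<tau> a c)\<^sup>\<star>\<^bsub>B\<^esub> = \<tau> (a\<^sup>\<star>\<^bsub>A\<^esub>) (c\<^sup>\<star>\<^bsub>C\<^esub>)"
    and tensor_norm: "\<lbrakk>a \<in> carrier A; c \<in> carrier C\<rbrakk>
      \<Longrightarrow> \<parallel>\<tau> a c\<parallel>\<^bsub>B\<^esub> = \<parallel>a\<parallel>\<^bsub>A\<^esub> * \<parallel>c\<parallel>\<^bsub>C\<^esub>"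
    and tensor_inj: "\<lbrakk>f \<in> {..<n} \<rightarrow> carrier A; g \<in> {..<n} \<rightarrow> carrier C;
        \<And>\<alpha> :: nat \<Rightarrow> complex. (\<Oplus>\<^bsub>C\<^esub>i\<in>{..<n}. \<alpha> i \<odot>\<^bsub>C\<^esub> g i) = \<zero>\<^bsub>C\<^esub> \<Longrightarrow> \<forall>i<n. \<alpha> i = 0;
        (\<Oplus>\<^bsub>B\<^esub>i\<in>{..<n}. \<tau> (f i) (g i)) = \<zero>\<^bsub>B\<^esub>; i < n\<rbrakk>
      \<Longrightarrow> f i = \<zero>\<^bsub>A\<^esub>"
    and tensor_dense: "\<lbrakk>b \<in> carrier B; \<epsilon> > 0\<rbrakk>
      \<Longrightarrow> \<exists>n. \<exists>f\<in>{..<n::nat} \<rightarrow> carrier A. \<exists>g\<in>{..<n} \<rightarrow> carrier C.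
            \<parallel>b \<ominus>\<^bsub>B\<^esub> (\<Oplus>\<^bsub>B\<^esub>i\<in>{..<n}. \<tau> (f i) (g i))\<parallel>\<^bsub>B\<^esub> < \<epsilon>"

definition is_stabilization :: "('a, 'm) cstar_scheme \<Rightarrow> ('b, 'n) cstar_scheme \<Rightarrow> bool" where
  "is_stabilization A B \<longleftrightarrow> (\<exists>\<tau>. cstar_tensor_product A \<K> B \<tau>)"


section \<open>The universal property for C*-algebras on arbitrary types\<close>

text \<open>
  The generated *-algebra over a countable dense set of scalars is countable, so its closure
  embeds as a set into the reals; the C*-structure is transported along the embedding.
\<close>


context cstar_algebra
begin

lemma smult_closed': "x \<in> carrier A \<Longrightarrow> c \<odot> x \<in> carrier A"
  by (simp add: complex_ring_def)

lemma smult_minus_one: "x \<in> carrier A \<Longrightarrow> (-1) \<odot> x = \<ominus> x"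
proof -
  assume x: "x \<in> carrier A"
  have "(-1 + 1) \<odot> x = (-1) \<odot> x \<oplus> 1 \<odot> x"
    using smult_l_distr[of "-1" 1 x] x by (simp add: complex_ring_def)
  moreover have "0 \<odot> x = \<zero>" using smult_l_null[of x] x by (simp add: complex_ring_def)
  moreover have "1 \<odot> x = x" using smult_one[of x] x by (simp add: complex_ring_def)
  ultimately have "(-1) \<odot> x \<oplus> x = \<zero>" by simp
  then show ?thesis using x smult_closed' M.minus_equality by metis
qed

lemma norm_zero: "\<parallel>\<zero>\<parallel> = 0"
  by (simp add: norm_eq_0_iff)

lemma norm_minus: "x \<in> carrier A \<Longrightarrow> \<parallel>\<ominus> x\<parallel> = \<parallel>x\<parallel>"
  using norm_smult[of x "-1"] by (simp add: smult_minus_one)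

lemma norm_nonneg: "x \<in> carrier A \<Longrightarrow> 0 \<le> \<parallel>x\<parallel>"
  using norm_add[of x "\<ominus> x"] by (simp add: norm_minus M.r_neg norm_zero)

lemma norm_star: "x \<in> carrier A \<Longrightarrow> \<parallel>x\<^sup>\<star>\<parallel> = \<parallel>x\<parallel>"
proof -
  have *: "\<parallel>y\<parallel> \<le> \<parallel>y\<^sup>\<star>\<parallel>" if "y \<in> carrier A" for y
  proof (cases "\<parallel>y\<parallel> = 0")
    case False
    then have "\<parallel>y\<parallel> > 0" using norm_nonneg[OF that] by simp
    moreover have "\<parallel>y\<parallel> * \<parallel>y\<parallel> \<le> \<parallel>y\<^sup>\<star>\<parallel> * \<parallel>y\<parallel>"
      using norm_mult[of "y\<^sup>\<star>" y] norm_star_mult[of y] star_closed that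
      by (simp add: power2_eq_square)
    ultimately show ?thesis by simp
  qed (use norm_nonneg star_closed that in simp)
  assume "x \<in> carrier A"
  then show ?thesis using *[of x] *[of "x\<^sup>\<star>"] star_closed star_star by fastforce
qed

lemma star_minus: "x \<in> carrier A \<Longrightarrow> (\<ominus> x)\<^sup>\<star> = \<ominus> x\<^sup>\<star>"
  using star_smult[of x "-1"] by (simp add: smult_minus_one star_closed)

lemma mult_minus_left:
  "\<lbrakk>x \<in> carrier A; y \<in> carrier A\<rbrakk> \<Longrightarrow> \<ominus> x \<otimes> y = \<ominus> (x \<otimes> y)"
  using mult_smult_left[of x y "-1"] by (simp add: smult_minus_one mult_closed)

lemma mult_minus_right:
  "\<lbrakk>x \<in> carrier A; y \<in> carrier A\<rbrakk> \<Longrightarrow> x \<otimes> (\<ominus> y) = \<ominus> (x \<otimes> y)"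
  using mult_smult_right[of x y "-1"] by (simp add: smult_minus_one mult_closed)

lemma norm_diff_commute:
  "\<lbrakk>x \<in> carrier A; y \<in> carrier A\<rbrakk> \<Longrightarrow> \<parallel>x \<ominus> y\<parallel> = \<parallel>y \<ominus> x\<parallel>"
  using norm_minus[of "y \<ominus> x"] by (simp add: M.minus_eq M.minus_add M.a_comm)

lemma norm_diff_triangle:
  assumes "x \<in> carrier A" "y \<in> carrier A" "z \<in> carrier A"
  shows "\<parallel>x \<ominus> z\<parallel> \<le> \<parallel>x \<ominus> y\<parallel> + \<parallel>y \<ominus> z\<parallel>"
proof -
  have "(x \<ominus> y) \<oplus> (y \<ominus> z) = x \<ominus> z"
    using assms M.r_neg1[of y "\<ominus> z"] by (simp add: M.minus_eq M.a_assoc)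
  then show ?thesis using norm_add[of "x \<ominus> y" "y \<ominus> z"] assms by simp
qed

lemma norm_triangle:
  assumes "x \<in> carrier A" "y \<in> carrier A"
  shows "\<parallel>x\<parallel> \<le> \<parallel>y\<parallel> + \<parallel>y \<ominus> x\<parallel>"
proof -
  have "y \<oplus> (\<ominus> (y \<ominus> x)) = x"
    using assms by (simp add: M.minus_eq M.minus_add M.a_assoc[symmetric] M.r_neg)
  then show ?thesis
    using norm_add[of y "\<ominus> (y \<ominus> x)"] assms by (simp add: norm_minus)
qed

lemma add_diff_cancel':
  assumes "x \<oplus> y = z" "x \<in> carrier A" "y \<in> carrier A"
  shows "x = z \<ominus> y"
  using assms(2,3) unfolding assms(1)[symmetric] by (simp add: M.minus_eq M.a_assoc M.r_neg)

lemma norm_diff_eq_0: "\<lbrakk>x \<in> carrier A; y \<in> carrier A\<rbrakk> \<Longrightarrow> \<parallel>x \<ominus> y\<parallel> = 0 \<longleftrightarrow> x = y"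
  using M.minus_equality[of x "\<ominus> y"] by (auto simp: norm_eq_0_iff M.minus_eq M.r_neg)

lemma norm_add_diff:
  assumes "x \<in> carrier A" "y \<in> carrier A" "a \<in> carrier A" "b \<in> carrier A"
  shows "\<parallel>(x \<oplus> y) \<ominus> (a \<oplus> b)\<parallel> \<le> \<parallel>x \<ominus> a\<parallel> + \<parallel>y \<ominus> b\<parallel>"
proof -
  have "(x \<oplus> y) \<ominus> (a \<oplus> b) = (x \<ominus> a) \<oplus> (y \<ominus> b)"
    using assms by (simp add: M.minus_eq M.minus_add M.a_ac)
  then show ?thesis using norm_add[of "x \<ominus> a" "y \<ominus> b"] assms by simp
qed

lemma norm_mult_diff:
  assumes "x \<in> carrier A" "y \<in> carrier A" "a \<in> carrier A" "b \<in> carrier A"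
  shows "\<parallel>x \<otimes> y \<ominus> a \<otimes> b\<parallel> \<le> \<parallel>x \<ominus> a\<parallel> * \<parallel>y\<parallel> + \<parallel>a\<parallel> * \<parallel>y \<ominus> b\<parallel>"
proof -
  have 1: "(x \<ominus> a) \<otimes> y = x \<otimes> y \<ominus> a \<otimes> y" "a \<otimes> (y \<ominus> b) = a \<otimes> y \<ominus> a \<otimes> b"
    using assms by (simp_all add: M.minus_eq mult_add_left mult_add_right mult_minus_left mult_minus_right)
  have "\<parallel>x \<otimes> y \<ominus> a \<otimes> b\<parallel> \<le> \<parallel>(x \<ominus> a) \<otimes> y\<parallel> + \<parallel>a \<otimes> (y \<ominus> b)\<parallel>"
    unfolding 1 using assms by (intro norm_diff_triangle) (auto simp: mult_closed)
  also have "\<dots> \<le> \<parallel>x \<ominus> a\<parallel> * \<parallel>y\<parallel> + \<parallel>a\<parallel> * \<parallel>y \<ominus> b\<parallel>"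
    using assms by (intro add_mono norm_mult) auto
  finally show ?thesis .
qed

lemma norm_smult_diff:
  assumes "x \<in> carrier A" "a \<in> carrier A"
  shows "\<parallel>c \<odot> x \<ominus> d \<odot> a\<parallel> \<le> cmod (c - d) * \<parallel>x\<parallel> + cmod d * \<parallel>x \<ominus> a\<parallel>"
proof -
  have 1: "(c - d) \<odot> x = c \<odot> x \<ominus> d \<odot> x"
  proof -
    have "(c - d) \<odot> x \<oplus> d \<odot> x = c \<odot> x"
      using smult_l_distr[of "c - d" d x] assms by (simp add: complex_ring_def)
    then show ?thesis using assms by (intro add_diff_cancel') (auto simp: smult_closed')
  qed
  have 2: "d \<odot> (x \<ominus> a) = d \<odot> x \<ominus> d \<odot> a"
  proof -
    have "d \<odot> (x \<ominus> a) \<oplus> d \<odot> a = d \<odot> ((x \<ominus> a) \<oplus> a)"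
      using smult_r_distr[of d "x \<ominus> a" a] assms by (simp add: complex_ring_def)
    also have "(x \<ominus> a) \<oplus> a = x" using assms by (simp add: M.minus_eq M.a_assoc M.l_neg)
    finally show ?thesis using assms by (intro add_diff_cancel') (auto simp: smult_closed')
  qed
  have "\<parallel>c \<odot> x \<ominus> d \<odot> a\<parallel> \<le> \<parallel>(c - d) \<odot> x\<parallel> + \<parallel>d \<odot> (x \<ominus> a)\<parallel>"
    unfolding 1 2 using assms by (intro norm_diff_triangle) (auto simp: smult_closed')
  then show ?thesis using assms by (simp add: norm_smult)
qed

lemma norm_star_diff:
  "\<lbrakk>x \<in> carrier A; a \<in> carrier A\<rbrakk> \<Longrightarrow> \<parallel>x\<^sup>\<star> \<ominus> a\<^sup>\<star>\<parallel> = \<parallel>x \<ominus> a\<parallel>"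
  using norm_star[of "x \<ominus> a"] by (simp add: M.minus_eq star_add star_minus)

end


datatype star_term = Term_Zero | Term_Gen nat | Term_Add star_term star_term | Term_Mul star_term star_term
  | Term_Smult nat star_term | Term_Star star_term

instance star_term :: countable
  by countable_datatype

primrec eval_term ::
    "('a, 'm) cstar_scheme \<Rightarrow> (nat \<Rightarrow> 'a) \<Rightarrow> (nat \<Rightarrow> complex) \<Rightarrow> star_term \<Rightarrow> 'a" where
  "eval_term A x d Term_Zero = \<zero>\<^bsub>A\<^esub>"
| "eval_term A x d (Term_Gen n) = x n"
| "eval_term A x d (Term_Add a b) = eval_term A x d a \<oplus>\<^bsub>A\<^esub> eval_term A x d b"
| "eval_term A x d (Term_Mul a b) = eval_term A x d a \<otimes>\<^bsub>A\<^esub> eval_term A x d b"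
| "eval_term A x d (Term_Smult n a) = d n \<odot>\<^bsub>A\<^esub> eval_term A x d a"
| "eval_term A x d (Term_Star a) = (eval_term A x d a)\<^sup>\<star>\<^bsub>A\<^esub>"

lemma dense_complex_sequence:
  obtains d :: "nat \<Rightarrow> complex" where "\<And>c \<epsilon>. \<epsilon> > 0 \<Longrightarrow> \<exists>n. cmod (c - d n) < \<epsilon>"
proof -
  obtain D :: "complex set" where D: "countable D" "\<And>U. open U \<Longrightarrow> U \<noteq> {} \<Longrightarrow> \<exists>d\<in>D. d \<in> U"
    using countable_dense_setE by metis
  have "\<exists>n. cmod (c - from_nat_into D n) < \<epsilon>" if "\<epsilon> > 0" for c \<epsilon>
  proof -
    have "\<exists>e\<in>D. e \<in> ball c \<epsilon>" using \<open>\<epsilon> > 0\<close> by (intro D(2)) auto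
    then obtain e where e: "e \<in> D" "cmod (c - e) < \<epsilon>" unfolding mem_ball dist_norm by blast
    obtain n where "from_nat_into D n = e" using from_nat_into_surj[OF D(1) e(1)] by blast
    then show ?thesis using e(2) by blast
  qed
  then show ?thesis using that by blast
qed

lemma mult_less_half:
  fixes a b e :: real
  assumes "0 \<le> a" "0 \<le> b" "a < e / 2 / (b + 1)"
  shows "b * a < e / 2"
proof -
  have "b * a \<le> (b + 1) * a" using assms by (intro mult_right_mono) auto
  also have "(b + 1) * a < e / 2"
    using assms by (subst (asm) pos_less_divide_eq) (auto simp: mult.commute)
  finally show ?thesis .
qed

context cstar_algebra
begin

lemma continuum_subalgebra:
  assumes "countable X" "X \<subseteq> carrier A"
  obtains S and f :: "'a \<Rightarrow> real" where "closed_star_subalgebra A S" "X \<subseteq> S" "inj_on f S"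
proof -
  define x where "x = from_nat_into (insert \<zero> X)"
  have range_x: "range x = insert \<zero> X"
    unfolding x_def using assms by (intro range_from_nat_into) auto
  then have x: "x n \<in> carrier A" for n using assms(2) by (metis insertE M.zero_closed rangeI subsetD)
  obtain d :: "nat \<Rightarrow> complex" where d: "\<And>c \<epsilon>. \<epsilon> > 0 \<Longrightarrow> \<exists>n. cmod (c - d n) < \<epsilon>"
    using dense_complex_sequence by metis
  define E where "E = eval_term A x d"
  have E: "E t \<in> carrier A" for t
    unfolding E_def by (induction t) (auto simp: x mult_closed smult_closed' star_closed)
  define S where "S = {l \<in> carrier A. \<forall>\<epsilon>>0. \<exists>t. \<parallel>l \<ominus> E t\<parallel> < \<epsilon>}"
  have SA: "l \<in> carrier A" if "l \<in> S" for l using that by (simp add: S_def)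
  have SE: "\<exists>t. \<parallel>l \<ominus> E t\<parallel> < \<epsilon>" if "l \<in> S" "\<epsilon> > 0" for l \<epsilon> using that by (simp add: S_def)
  have ES: "E t \<in> S" for t
    unfolding S_def using E norm_diff_eq_0[of "E t" "E t"] by (auto intro!: exI[of _ t])
  have "\<zero> \<in> S" using ES[of Term_Zero] by (simp add: E_def)
  moreover have "l \<oplus> m \<in> S" if "l \<in> S" "m \<in> S" for l m
  proof -
    have "\<exists>t. \<parallel>(l \<oplus> m) \<ominus> E t\<parallel> < \<epsilon>" if e: "\<epsilon> > 0" for \<epsilon>
    proof -
      obtain s t where "\<parallel>l \<ominus> E s\<parallel> < \<epsilon> / 2" "\<parallel>m \<ominus> E t\<parallel> < \<epsilon> / 2"
        using SE[OF \<open>l \<in> S\<close> half_gt_zero[OF e]] SE[OF \<open>m \<in> S\<close> half_gt_zero[OF e]] by blast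
      then have "\<parallel>(l \<oplus> m) \<ominus> E (Term_Add s t)\<parallel> < \<epsilon>"
        using norm_add_diff[of l m "E s" "E t"] SA \<open>l \<in> S\<close> \<open>m \<in> S\<close> E by (simp add: E_def)
      then show ?thesis ..
    qed
    then show ?thesis using SA that by (simp add: S_def)
  qed
  moreover have "l \<otimes> m \<in> S" if "l \<in> S" "m \<in> S" for l m
  proof -
    have "\<exists>t. \<parallel>(l \<otimes> m) \<ominus> E t\<parallel> < \<epsilon>" if e: "\<epsilon> > 0" for \<epsilon>
    proof -
      have lm: "l \<in> carrier A" "m \<in> carrier A" using SA \<open>l \<in> S\<close> \<open>m \<in> S\<close> by auto
      have pos: "0 \<le> \<parallel>l\<parallel>" "0 \<le> \<parallel>m\<parallel>" using lm norm_nonneg by auto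
      obtain s where s: "\<parallel>l \<ominus> E s\<parallel> < min 1 (\<epsilon> / 2 / (\<parallel>m\<parallel> + 1))"
        using SE[OF \<open>l \<in> S\<close>, of "min 1 (\<epsilon> / 2 / (\<parallel>m\<parallel> + 1))"] e pos
        by (metis add_nonneg_pos divide_pos_pos half_gt_zero min_less_iff_conj zero_less_one)
      obtain t where t: "\<parallel>m \<ominus> E t\<parallel> < \<epsilon> / 2 / (\<parallel>l\<parallel> + 1)"
        using SE[OF \<open>m \<in> S\<close>, of "\<epsilon> / 2 / (\<parallel>l\<parallel> + 1)"] e pos
        by (metis add_nonneg_pos divide_pos_pos half_gt_zero zero_less_one)
      have 2: "\<parallel>l \<ominus> E s\<parallel> * \<parallel>m\<parallel> < \<epsilon> / 2"
        using mult_less_half[of "\<parallel>l \<ominus> E s\<parallel>" "\<parallel>m\<parallel>" \<epsilon>] s pos norm_nonneg[of "l \<ominus> E s"] lm E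
        by (simp add: mult.commute)
      have 3: "\<parallel>m \<ominus> E t\<parallel> \<ge> 0" using norm_nonneg lm E by simp
      have "\<parallel>E s\<parallel> \<le> \<parallel>l\<parallel> + 1" using norm_triangle[of "E s" l] E lm s by simp
      then have "\<parallel>E s\<parallel> * \<parallel>m \<ominus> E t\<parallel> \<le> (\<parallel>l\<parallel> + 1) * \<parallel>m \<ominus> E t\<parallel>"
        using 3 by (rule mult_right_mono)
      also have "\<dots> < \<epsilon> / 2"
        using t pos by (subst (asm) pos_less_divide_eq) (auto simp: mult.commute)
      finally have 1: "\<parallel>E s\<parallel> * \<parallel>m \<ominus> E t\<parallel> < \<epsilon> / 2" .
      have "\<parallel>(l \<otimes> m) \<ominus> E (Term_Mul s t)\<parallel> < \<epsilon>"
        using norm_mult_diff[of l m "E s" "E t"] lm E 1 2 by (simp add: E_def)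
      then show ?thesis ..
    qed
    then show ?thesis using SA that mult_closed by (simp add: S_def)
  qed
  moreover have "c \<odot> l \<in> S" if "l \<in> S" for c l
  proof -
    have "\<exists>t. \<parallel>(c \<odot> l) \<ominus> E t\<parallel> < \<epsilon>" if e: "\<epsilon> > 0" for \<epsilon>
    proof -
      have l: "l \<in> carrier A" using SA \<open>l \<in> S\<close> by auto
      have pos: "0 \<le> \<parallel>l\<parallel>" using l norm_nonneg by auto
      obtain n where n: "cmod (c - d n) < \<epsilon> / 2 / (\<parallel>l\<parallel> + 1)"
        using d[of "\<epsilon> / 2 / (\<parallel>l\<parallel> + 1)" c] e pos
        by (metis add_nonneg_pos divide_pos_pos half_gt_zero zero_less_one)
      have "0 < cmod (d n) + 1" by (simp add: add_nonneg_pos)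
      then have "0 < \<epsilon> / 2 / (cmod (d n) + 1)" using half_gt_zero[OF e] by (rule divide_pos_pos[rotated])
      then obtain t where t: "\<parallel>l \<ominus> E t\<parallel> < \<epsilon> / 2 / (cmod (d n) + 1)"
        using SE[OF \<open>l \<in> S\<close>] by blast
      have 1: "cmod (d n) * \<parallel>l \<ominus> E t\<parallel> < \<epsilon> / 2"
        using t norm_nonneg[of "l \<ominus> E t"] l E by (intro mult_less_half) auto
      have 2: "cmod (c - d n) * \<parallel>l\<parallel> < \<epsilon> / 2"
        using mult_less_half[of "cmod (c - d n)" "\<parallel>l\<parallel>" \<epsilon>] n pos by (simp add: mult.commute)
      have "\<parallel>(c \<odot> l) \<ominus> E (Term_Smult n t)\<parallel> < \<epsilon>"
        using norm_smult_diff[of l "E t" c "d n"] l E 1 2 by (simp add: E_def)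
      then show ?thesis ..
    qed
    then show ?thesis using SA that smult_closed' by (simp add: S_def)
  qed
  moreover have "l\<^sup>\<star> \<in> S" if "l \<in> S" for l
  proof -
    have "\<exists>t. \<parallel>l\<^sup>\<star> \<ominus> E t\<parallel> < \<epsilon>" if e: "\<epsilon> > 0" for \<epsilon>
    proof -
      obtain t where "\<parallel>l \<ominus> E t\<parallel> < \<epsilon>" using SE \<open>l \<in> S\<close> e by blast
      then have "\<parallel>l\<^sup>\<star> \<ominus> E (Term_Star t)\<parallel> < \<epsilon>"
        using norm_star_diff[of l "E t"] SA \<open>l \<in> S\<close> E by (simp add: E_def)
      then show ?thesis ..
    qed
    then show ?thesis using SA that star_closed by (simp add: S_def)
  qed
  ultimately have ops: "S \<subseteq> carrier A \<and> \<zero> \<in> S \<and> (\<forall>x\<in>S. \<forall>y\<in>S. x \<oplus> y \<in> S \<and> x \<otimes> y \<in> S) \<and>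
      (\<forall>c. \<forall>x\<in>S. c \<odot> x \<in> S) \<and> (\<forall>x\<in>S. x\<^sup>\<star> \<in> S)"
    by (intro conjI ballI allI subsetI SA)
  have lim: "l \<in> S" if f: "\<And>n. f n \<in> S" and l: "l \<in> carrier A" and lim: "cstar_tendsto A f l" for f l
  proof -
    have "\<exists>t. \<parallel>l \<ominus> E t\<parallel> < \<epsilon>" if e: "\<epsilon> > 0" for \<epsilon>
    proof -
      have "\<forall>\<^sub>F n in sequentially. \<parallel>f n \<ominus> l\<parallel> < \<epsilon> / 2"
        using order_tendstoD(2)[OF lim[unfolded cstar_tendsto_def], of "\<epsilon> / 2"] e by simp
      then obtain n where n: "\<parallel>f n \<ominus> l\<parallel> < \<epsilon> / 2"
        unfolding eventually_sequentially by blast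
      obtain t where "\<parallel>f n \<ominus> E t\<parallel> < \<epsilon> / 2" using SE[OF f half_gt_zero[OF e]] by blast
      then have "\<parallel>l \<ominus> E t\<parallel> < \<epsilon>"
        using norm_diff_triangle[of l "f n" "E t"] norm_diff_commute[of l "f n"] n SA[OF f] l E
        by simp
      then show ?thesis ..
    qed
    then show ?thesis using l by (simp add: S_def)
  qed
  have "\<forall>f l. (\<forall>n. f n \<in> S) \<and> l \<in> carrier A \<and> cstar_tendsto A f l \<longrightarrow> l \<in> S"
  proof (intro allI impI, elim conjE)
    fix f l assume "\<forall>n. f n \<in> S" "l \<in> carrier A" "cstar_tendsto A f l"
    then show "l \<in> S" using lim[of f l] by simp
  qed
  with ops have closed: "closed_star_subalgebra A S"
    unfolding closed_star_subalgebra_def by simp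
  have XS: "X \<subseteq> S"
  proof
    fix y assume "y \<in> X"
    then obtain n where "y = x n" using range_x by blast
    then show "y \<in> S" using ES[of "Term_Gen n"] by (simp add: E_def)
  qed
  define F where "F l = to_nat ` {(t, k). \<parallel>l \<ominus> E t\<parallel> < inverse (real (Suc k))}" for l
  have "inj_on F S"
  proof (rule inj_onI, rule ccontr)
    fix l m assume lm: "l \<in> S" "m \<in> S" "F l = F m" "l \<noteq> m"
    have c: "l \<in> carrier A" "m \<in> carrier A" using SA lm by auto
    have "\<parallel>l \<ominus> m\<parallel> / 2 > 0"
      using norm_nonneg[of "l \<ominus> m"] norm_diff_eq_0[of l m] c lm by simp
    then obtain k where k: "inverse (real (Suc k)) < \<parallel>l \<ominus> m\<parallel> / 2"
      using reals_Archimedean by blast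
    obtain t where t: "\<parallel>l \<ominus> E t\<parallel> < inverse (real (Suc k))"
      using SE[OF lm(1), of "inverse (real (Suc k))"] by auto
    have "{(t, k). \<parallel>l \<ominus> E t\<parallel> < inverse (real (Suc k))}
        = {(t, k). \<parallel>m \<ominus> E t\<parallel> < inverse (real (Suc k))}"
      using lm(3) unfolding F_def by (simp only: inj_image_eq_iff[OF inj_to_nat])
    then have "\<parallel>m \<ominus> E t\<parallel> < inverse (real (Suc k))" using t by auto
    then show False
      using norm_diff_triangle[of l "E t" m] norm_diff_commute[of m "E t"] t k c E by simp
  qed
  moreover obtain \<phi> :: "nat set \<Rightarrow> real" where "inj \<phi>"
    using eqpoll_imp_lepoll[OF nat_sets_eqpoll_reals] unfolding lepoll_def by auto
  ultimately have "inj_on (\<phi> \<circ> F) S" by (auto intro: comp_inj_on inj_on_subset)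
  then show ?thesis using that closed XS by blast
qed

end

definition transport_cstar :: "('a, 'm) cstar_scheme \<Rightarrow> 'a set \<Rightarrow> ('a \<Rightarrow> 'b) \<Rightarrow> 'b cstar" where
  "transport_cstar A S f = (let g = inv_into S f in
    \<lparr>carrier = f ` S,
     monoid.mult = (\<lambda>x y. f (g x \<otimes>\<^bsub>A\<^esub> g y)),
     one = undefined,
     ring.zero = f \<zero>\<^bsub>A\<^esub>,
     add = (\<lambda>x y. f (g x \<oplus>\<^bsub>A\<^esub> g y)),
     smult = (\<lambda>c x. f (c \<odot>\<^bsub>A\<^esub> g x)),
     star = (\<lambda>x. f ((g x)\<^sup>\<star>\<^bsub>A\<^esub>)),
     cnorm = (\<lambda>x. \<parallel>g x\<parallel>\<^bsub>A\<^esub>)\<rparr>)"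

lemma cring_complex_ring: "cring complex_ring"
proof -
  have "\<exists>y. x + y = 0" for x :: complex by (rule exI[of _ "- x"]) simp
  moreover have "\<exists>y. y + x = 0 \<and> x + y = 0" for x :: complex by (rule exI[of _ "- x"]) simp
  ultimately show ?thesis
    unfolding complex_ring_def
    by unfold_locales (auto simp: algebra_simps Units_def)
qed

context
  fixes A :: "('a, 'm) cstar_scheme" and S and f :: "'a \<Rightarrow> 'b" and D :: "'b cstar"
  assumes A: "cstar_algebra A" and S: "closed_star_subalgebra A S" and f: "inj_on f S"
  defines "D \<equiv> transport_cstar A S f"
begin

interpretation A: cstar_algebra A by (rule A)

lemma subalgebra_closed:
  "\<And>x. x \<in> S \<Longrightarrow> x \<in> carrier A" "\<zero>\<^bsub>A\<^esub> \<in> S"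
  "\<And>x y. x \<in> S \<Longrightarrow> y \<in> S \<Longrightarrow> x \<oplus>\<^bsub>A\<^esub> y \<in> S"
  "\<And>x y. x \<in> S \<Longrightarrow> y \<in> S \<Longrightarrow> x \<otimes>\<^bsub>A\<^esub> y \<in> S"
  "\<And>c x. x \<in> S \<Longrightarrow> c \<odot>\<^bsub>A\<^esub> x \<in> S"
  "\<And>x. x \<in> S \<Longrightarrow> x\<^sup>\<star>\<^bsub>A\<^esub> \<in> S"
  using S unfolding closed_star_subalgebra_def by blast+

lemma subalgebra_minus: "x \<in> S \<Longrightarrow> \<ominus>\<^bsub>A\<^esub> x \<in> S"
  using subalgebra_closed(5)[of x "-1"] subalgebra_closed(1) by (simp add: A.smult_minus_one)

lemma transport_simps:
  "carrier D = f ` S"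
  "\<zero>\<^bsub>D\<^esub> = f \<zero>\<^bsub>A\<^esub>"
  "\<And>x y. x \<in> S \<Longrightarrow> y \<in> S \<Longrightarrow> f x \<oplus>\<^bsub>D\<^esub> f y = f (x \<oplus>\<^bsub>A\<^esub> y)"
  "\<And>x y. x \<in> S \<Longrightarrow> y \<in> S \<Longrightarrow> f x \<otimes>\<^bsub>D\<^esub> f y = f (x \<otimes>\<^bsub>A\<^esub> y)"
  "\<And>c x. x \<in> S \<Longrightarrow> c \<odot>\<^bsub>D\<^esub> f x = f (c \<odot>\<^bsub>A\<^esub> x)"
  "\<And>x. x \<in> S \<Longrightarrow> (f x)\<^sup>\<star>\<^bsub>D\<^esub> = f (x\<^sup>\<star>\<^bsub>A\<^esub>)"
  "\<And>x. x \<in> S \<Longrightarrow> \<parallel>f x\<parallel>\<^bsub>D\<^esub> = \<parallel>x\<parallel>\<^bsub>A\<^esub>"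
  by (simp_all add: D_def transport_cstar_def Let_def inv_into_f_f[OF f])

lemma abelian_group_transport: "abelian_group D"
proof (rule abelian_groupI)
  fix x assume "x \<in> carrier D"
  then obtain a where "x = f a" "a \<in> S" by (auto simp: transport_simps)
  then show "\<exists>y\<in>carrier D. y \<oplus>\<^bsub>D\<^esub> x = \<zero>\<^bsub>D\<^esub>"
    using subalgebra_minus[of a] subalgebra_closed(1)[of a]
    by (intro bexI[of _ "f (\<ominus>\<^bsub>A\<^esub> a)"]) (auto simp: transport_simps A.M.l_neg)
qed (auto simp: transport_simps subalgebra_closed A.M.a_ac)

lemma transport_minus:
  assumes "x \<in> S" "y \<in> S"
  shows "f x \<ominus>\<^bsub>D\<^esub> f y = f (x \<ominus>\<^bsub>A\<^esub> y)"
proof -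
  interpret D: abelian_group D by (rule abelian_group_transport)
  have "f (\<ominus>\<^bsub>A\<^esub> y) \<oplus>\<^bsub>D\<^esub> f y = \<zero>\<^bsub>D\<^esub>"
    using assms by (simp add: transport_simps subalgebra_minus subalgebra_closed A.M.l_neg)
  then have "\<ominus>\<^bsub>D\<^esub> f y = f (\<ominus>\<^bsub>A\<^esub> y)"
    using assms by (intro D.minus_equality) (auto simp: transport_simps subalgebra_minus)
  then show ?thesis
    using assms by (simp add: D.minus_eq A.M.minus_eq transport_simps subalgebra_minus)
qed

lemma transport_finsum:
  assumes "finite I" "\<And>i. i \<in> I \<Longrightarrow> u i \<in> S"
  shows "(\<Oplus>\<^bsub>D\<^esub>i\<in>I. f (u i)) = f (\<Oplus>\<^bsub>A\<^esub>i\<in>I. u i) \<and> (\<Oplus>\<^bsub>A\<^esub>i\<in>I. u i) \<in> S"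
proof -
  interpret D: abelian_group D by (rule abelian_group_transport)
  show ?thesis using assms
  proof (induction I rule: finite_induct)
    case (insert i I)
    then show ?case
      using subalgebra_closed
      by (subst D.finsum_insert A.M.finsum_insert; (subst A.M.finsum_insert)?)
        (auto simp: transport_simps)
  qed (auto simp: transport_simps subalgebra_closed)
qed

lemma cstar_algebra_transport: "cstar_algebra D"
proof -
  interpret D: abelian_group D by (rule abelian_group_transport)
  note c = transport_simps subalgebra_closed
  have "Module.module complex_ring D"
    using abelian_group_transport cring_complex_ring A.smult_l_distr A.smult_r_distr
      A.smult_assoc1 A.smult_one
    by (intro moduleI) (auto simp: c complex_ring_def)
  moreover have "\<exists>l\<in>carrier D. cstar_tendsto D u l"
    if u: "\<And>n. u n \<in> carrier D"
      and cau: "\<And>\<epsilon>. \<epsilon> > 0 \<Longrightarrow> \<exists>N. \<forall>m\<ge>N. \<forall>n\<ge>N. \<parallel>u m \<ominus>\<^bsub>D\<^esub> u n\<parallel>\<^bsub>D\<^esub> < \<epsilon>" for u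
  proof -
    have "\<forall>n. \<exists>a. a \<in> S \<and> u n = f a" using u by (auto simp: c)
    then obtain a where a: "\<And>n. a n \<in> S" "\<And>n. u n = f (a n)" by metis
    have am: "a m \<ominus>\<^bsub>A\<^esub> y \<in> S" if "y \<in> S" for m y
      using a that by (simp add: A.M.minus_eq c subalgebra_minus)
    have "\<exists>l\<in>carrier A. cstar_tendsto A a l"
      using cau a am by (intro A.complete) (auto simp: c transport_minus)
    then obtain l where l: "l \<in> carrier A" "cstar_tendsto A a l" by blast
    then have "l \<in> S" using S a unfolding closed_star_subalgebra_def by blast
    then have "cstar_tendsto D u (f l)"
      using l a am by (simp add: cstar_tendsto_def transport_minus c)
    then show ?thesis using \<open>l \<in> S\<close> by (auto simp: c)
  qed
  moreover have "f x = f y \<longleftrightarrow> x = y" if "x \<in> S" "y \<in> S" for x y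
    using f that by (auto dest: inj_onD)
  ultimately show ?thesis
    unfolding cstar_algebra_def cstar_algebra_axioms_def
    by (auto simp: c A.mult_assoc A.mult_add_left A.mult_add_right A.mult_smult_left
        A.mult_smult_right A.star_star A.star_add A.star_smult A.star_mult A.norm_eq_0_iff
        A.norm_add A.norm_smult A.norm_mult A.norm_star_mult)
qed

lemma cstar_hom_transport: "inv_into S f \<in> cstar_hom D A"
  using f by (auto simp: cstar_hom_def transport_simps subalgebra_closed)

lemma ck_family_transport:
  assumes "wf_digraph G" and ck: "ck_family G A q t"
    and "q ` verts G \<subseteq> S" "t ` arcs G \<subseteq> S"
  shows "ck_family G D (f \<circ> q) (f \<circ> t)"
proof -
  interpret wf_digraph G by fact
  have q: "q v \<in> S" if "v \<in> verts G" for v using assms that by auto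
  have t: "t e \<in> S" if "e \<in> arcs G" for e using assms that by auto
  note c = transport_simps subalgebra_closed q t
  have "(\<Oplus>\<^bsub>D\<^esub>e\<in>out_arcs G v. f (t e \<otimes>\<^bsub>A\<^esub> (t e)\<^sup>\<star>\<^bsub>A\<^esub>)) = f (q v)"
    if "v \<in> verts G" "\<not> singular_vertex G v" for v
  proof -
    have "finite (out_arcs G v)" using that by (simp add: singular_vertex_def)
    then show ?thesis
      using transport_finsum[of "out_arcs G v" "\<lambda>e. t e \<otimes>\<^bsub>A\<^esub> (t e)\<^sup>\<star>\<^bsub>A\<^esub>"] ck that
      by (auto simp: ck_family_def c)
  qed
  moreover have "(\<Oplus>\<^bsub>D\<^esub>e\<in>out_arcs G v. f (t e) \<otimes>\<^bsub>D\<^esub> (f (t e))\<^sup>\<star>\<^bsub>D\<^esub>)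
      = (\<Oplus>\<^bsub>D\<^esub>e\<in>out_arcs G v. f (t e \<otimes>\<^bsub>A\<^esub> (t e)\<^sup>\<star>\<^bsub>A\<^esub>))" for v
  proof -
    interpret D: abelian_group D by (rule abelian_group_transport)
    show ?thesis by (rule D.finsum_cong') (auto simp: c)
  qed
  ultimately show ?thesis
    using ck unfolding ck_family_def projection_def partial_isometry_def projection_le_def
      projection_orth_def
    by (auto simp: c)
qed

end

theorem universal_ck_family_any_type:
  fixes B :: "('b, 'n) cstar_scheme"
  assumes G: "countable_digraph G" and A: "universal_ck_family G A p s"
    and B: "cstar_algebra B" and ck: "ck_family G B q t"
  shows "\<exists>h\<in>cstar_hom A B. (\<forall>v\<in>verts G. h (p v) = q v) \<and> (\<forall>e\<in>arcs G. h (s e) = t e)"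
proof -
  define X where "X = q ` verts G \<union> t ` arcs G"
  have "countable X" "X \<subseteq> carrier B"
    using G ck by (auto simp: X_def countable_digraph_def ck_family_def projection_def partial_isometry_def)
  then obtain S and f :: "'b \<Rightarrow> real"
    where S: "closed_star_subalgebra B S" "X \<subseteq> S" "inj_on f S"
    using cstar_algebra.continuum_subalgebra[OF B] by metis
  define D where "D = transport_cstar B S f"
  have "cstar_algebra D" "ck_family G D (f \<circ> q) (f \<circ> t)"
    using cstar_algebra_transport[OF B S(1,3)] ck_family_transport[OF B S(1,3) _ ck] S(2) G
    by (auto simp: D_def X_def countable_digraph_def)
  then obtain h where h: "h \<in> cstar_hom A D" "\<And>v. v \<in> verts G \<Longrightarrow> h (p v) = f (q v)"
      "\<And>e. e \<in> arcs G \<Longrightarrow> h (s e) = f (t e)"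
    using A unfolding universal_ck_family_def by fastforce
  let ?g = "inv_into S f"
  have "?g \<circ> h \<in> cstar_hom A B"
    using h(1) cstar_hom_transport[OF B S(1,3)] unfolding cstar_hom_def D_def
    by (auto simp: Pi_iff)
  moreover have "(?g \<circ> h) (p v) = q v" if "v \<in> verts G" for v
    using h(2)[OF that] S that by (auto simp: X_def)
  moreover have "(?g \<circ> h) (s e) = t e" if "e \<in> arcs G" for e
    using h(3)[OF that] S that by (auto simp: X_def)
  ultimately show ?thesis by blast
qed

end

theory Submission
  imports Defs
begin

text \<open>
  Let \<open>F\<close> arise from \<open>G\<close> by attaching to every vertex \<open>v\<close> an infinite path ending in \<open>v\<close>. With matrix
  units \<open>e\<^sub>i\<^sub>j\<close>, the elements \<open>p\<^sub>v \<otimes> e\<^sub>i\<^sub>i\<close>, \<open>s\<^sub>e \<otimes> e\<^sub>0\<^sub>0\<close> and \<open>p\<^sub>v \<otimes> e\<^sub>i\<^sub>+\<^sub>1\<^sub>,\<^sub>i\<close> form a Cuntz-Krieger \<open>F\<close>-family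
  generating the stabilization of the algebra of \<open>G\<close>, because finite matrices are dense in the
  compact operators. Hence it suffices to show that this family is universal.

  Given an \<open>F\<close>-family in \<open>D\<close>, universality for \<open>G\<close> yields a homomorphism \<open>\<pi>\<close>, and multiplying along
  the attached paths yields partial isometries \<open>W\<^sub>v\<^sub>,\<^sub>i\<close> from \<open>v\<close> to \<open>(v, i)\<close>. On \<open>a\<close> in the corner
  \<open>p\<^sub>v A p\<^sub>w\<close> the homomorphism has to send \<open>a \<otimes> e\<^sub>i\<^sub>j\<close> to \<open>W\<^sub>v\<^sub>,\<^sub>i \<pi>(a) W\<^sub>w\<^sub>,\<^sub>j\<^sup>*\<close>. The linear span of these pairs is a
  *-relation which is bounded on every finite set of indices, since \<open>\<pi>\<close> is contractive. The
  C*-identity improves the bound to 1, so that the relation is a contraction with dense domain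
  and extends to the stabilization by continuity.
\<close>

section \<open>C*-algebras\<close>

text \<open>Contractivity of \<pi> has to come without spectral theory and without a unit. For
  self-adjoint \<open>a\<close> of norm below 1, the element \<open>b = 1 - sqrt (1 - a^2)\<close>
  lies in the algebra even if 1 does not. It satisfies the identity \<open>a^2 + b^2 = 2 b\<close>,
  which every homomorphism preserves and which in turn forces the image of \<open>a\<close> to have
  norm at most 1. The second obstacle is that a general \<open>a\<close> has no single start and end
  vertex, so no choice of \<open>W\<close> belongs to it, and with infinitely many vertices it need
  not be a finite sum of corner elements. Therefore only corner elements are paired. Density still
  holds since the generators of the stabilization come from corner elements, and independence of the
  representation as a sum is not checked by hand but falls out of the norm estimate. The direction
  of the attached paths matters: they end in \<open>v\<close>, so an old vertex emits exactly the
  edges it emitted before. Singular vertices and the summation relations are thereby preserved,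
  whereas a path leaving \<open>v\<close> would change both. Each new vertex emits exactly one edge,
  so its summation relation makes the products \<open>W\<close> along the path have full
  range.\<close>

context cstar_algebra
begin

lemmas closed [simp] = mult_closed star_closed smult_closed'

lemma smult_add_left: "x \<in> carrier A \<Longrightarrow> (c + d) \<odot> x = c \<odot> x \<oplus> d \<odot> x"
  using smult_l_distr[of c d x] by (simp add: complex_ring_def)

lemma smult_add_right:
  "\<lbrakk>x \<in> carrier A; y \<in> carrier A\<rbrakk> \<Longrightarrow> c \<odot> (x \<oplus> y) = c \<odot> x \<oplus> c \<odot> y"
  using smult_r_distr[of c x y] by (simp add: complex_ring_def)

lemma smult_smult: "x \<in> carrier A \<Longrightarrow> c \<odot> (d \<odot> x) = (c * d) \<odot> x"
  using smult_assoc1[of c d x] by (simp add: complex_ring_def)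

lemma smult_unit: "x \<in> carrier A \<Longrightarrow> 1 \<odot> x = x"
  using smult_one[of x] by (simp add: complex_ring_def)

lemma smult_zero_left: "x \<in> carrier A \<Longrightarrow> 0 \<odot> x = \<zero>"
  using smult_l_null[of x] by (simp add: complex_ring_def)

lemma smult_zero_right: "c \<odot> \<zero> = \<zero>"
  using smult_r_null[of c] by (simp add: complex_ring_def)

lemma smult_minus_right: "x \<in> carrier A \<Longrightarrow> c \<odot> (\<ominus> x) = \<ominus> (c \<odot> x)"
  by (simp flip: smult_minus_one add: smult_smult)

lemma mult_zero_left: "x \<in> carrier A \<Longrightarrow> \<zero> \<otimes> x = \<zero>"
  using mult_smult_left[of \<zero> x 0] by (simp add: smult_zero_left)

lemma mult_zero_right: "x \<in> carrier A \<Longrightarrow> x \<otimes> \<zero> = \<zero>"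
  using mult_smult_right[of x \<zero> 0] by (simp add: smult_zero_left)

lemma star_zero: "\<zero>\<^sup>\<star> = \<zero>"
  using star_smult[of \<zero> 0] by (simp add: smult_zero_left)

lemmas zero_simps = smult_zero_left smult_zero_right mult_zero_left mult_zero_right star_zero
lemmas minus_simps = M.minus_eq M.minus_add star_minus mult_minus_left mult_minus_right
  smult_minus_right

lemma minus_mult_left: "\<lbrakk>x \<in> carrier A; y \<in> carrier A; z \<in> carrier A\<rbrakk>
    \<Longrightarrow> (x \<ominus> y) \<otimes> z = x \<otimes> z \<ominus> y \<otimes> z"
  by (simp add: minus_simps mult_add_left)

lemma minus_mult_right: "\<lbrakk>x \<in> carrier A; y \<in> carrier A; z \<in> carrier A\<rbrakk>
    \<Longrightarrow> z \<otimes> (x \<ominus> y) = z \<otimes> x \<ominus> z \<otimes> y"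
  by (simp add: minus_simps mult_add_right)

lemma star_diff: "\<lbrakk>x \<in> carrier A; y \<in> carrier A\<rbrakk> \<Longrightarrow> (x \<ominus> y)\<^sup>\<star> = x\<^sup>\<star> \<ominus> y\<^sup>\<star>"
  by (simp add: minus_simps star_add)

lemma minus_self: "x \<in> carrier A \<Longrightarrow> x \<ominus> x = \<zero>"
  by (simp add: M.minus_eq M.r_neg)

text \<open>The conditions leave only \<open>\<i>\<close> and \<open>- \<i>\<close> for
  \<open>k\<close>. The two mixed terms are then opposite multiples of the same element and cancel,
  so both signs give the same right-hand side.\<close>

lemma star_mult_rotate:
  assumes c: "x \<in> carrier A" "y \<in> carrier A" and xy: "x\<^sup>\<star> \<otimes> y = y\<^sup>\<star> \<otimes> x" and k: "cmod k = 1" "cnj k = - k"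
  shows "(x \<oplus> k \<odot> y)\<^sup>\<star> \<otimes> (x \<oplus> k \<odot> y) = x\<^sup>\<star> \<otimes> x \<oplus> y\<^sup>\<star> \<otimes> y"
proof -
  have "- (k * k) = 1"
    using complex_norm_square[of k] k by simp
  then have "k * k = -1" using equation_minus_iff by metis
  then have *: "(- k) \<odot> (k \<odot> (y\<^sup>\<star> \<otimes> y)) = y\<^sup>\<star> \<otimes> y"
    using c by (simp add: smult_smult smult_unit)
  have **: "k \<odot> (y\<^sup>\<star> \<otimes> x) \<oplus> (- k) \<odot> (y\<^sup>\<star> \<otimes> x) = \<zero>"
    using smult_add_left[of "y\<^sup>\<star> \<otimes> x" k "- k"] c by (simp add: smult_zero_left)
  have "(x \<oplus> k \<odot> y)\<^sup>\<star> \<otimes> (x \<oplus> k \<odot> y) =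
      (x\<^sup>\<star> \<otimes> x \<oplus> k \<odot> (x\<^sup>\<star> \<otimes> y)) \<oplus> ((- k) \<odot> (y\<^sup>\<star> \<otimes> x) \<oplus> (- k) \<odot> (k \<odot> (y\<^sup>\<star> \<otimes> y)))"
    using c by (simp add: star_add star_smult k mult_add_left mult_add_right mult_smult_left
        mult_smult_right smult_add_right smult_smult M.a_ac)
  also have "\<dots> = x\<^sup>\<star> \<otimes> x \<oplus> ((k \<odot> (y\<^sup>\<star> \<otimes> x) \<oplus> (- k) \<odot> (y\<^sup>\<star> \<otimes> x)) \<oplus> y\<^sup>\<star> \<otimes> y)"
    unfolding * xy using c by (simp add: M.a_assoc)
  finally show ?thesis using c by (simp add: **)
qed

text \<open>
  The hypothesis says \<open>c\<^sup>2 + (1 - d)\<^sup>2 = 1\<close>, so that \<open>u = c + \<i> (1 - d)\<close> is unitary and \<open>c\<close> is the mean of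
  \<open>u\<close> and its adjoint. There need not be a unit: only the left multiplication by \<open>u\<close> is used,
  which maps \<open>x\<close> to \<open>y + \<i> z\<close> below.
\<close>

lemma sq_add_sq_norm_le:
  assumes c: "c \<in> carrier A" "c\<^sup>\<star> = c" and d: "d \<in> carrier A" "d\<^sup>\<star> = d"
    and comm: "c \<otimes> d = d \<otimes> c" and sq: "c \<otimes> c \<oplus> d \<otimes> d = d \<oplus> d"
  shows "\<parallel>c\<parallel> \<le> 1"
proof -
  have *: "\<parallel>c \<otimes> x\<parallel> \<le> \<parallel>x\<parallel>" if x: "x \<in> carrier A" for x
  proof -
    define y z where "y = c \<otimes> x" and "z = x \<ominus> d \<otimes> x"
    have yz: "y \<in> carrier A" "z \<in> carrier A" using x c d by (auto simp: y_def z_def)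
    have ys: "y\<^sup>\<star> = x\<^sup>\<star> \<otimes> c" and zs: "z\<^sup>\<star> = x\<^sup>\<star> \<ominus> x\<^sup>\<star> \<otimes> d"
      using x c d by (simp_all add: y_def z_def star_mult star_diff)
    have "y\<^sup>\<star> \<otimes> z = x\<^sup>\<star> \<otimes> c \<otimes> x \<ominus> x\<^sup>\<star> \<otimes> (c \<otimes> d) \<otimes> x"
      unfolding ys unfolding z_def using x c d by (simp add: minus_mult_right mult_assoc)
    moreover have "z\<^sup>\<star> \<otimes> y = x\<^sup>\<star> \<otimes> c \<otimes> x \<ominus> x\<^sup>\<star> \<otimes> (d \<otimes> c) \<otimes> x"
      unfolding zs unfolding y_def using x c d by (simp add: minus_mult_left mult_assoc)
    ultimately have 1: "y\<^sup>\<star> \<otimes> z = z\<^sup>\<star> \<otimes> y" by (simp add: comm)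
    have dd: "d \<otimes> d = (d \<oplus> d) \<ominus> c \<otimes> c"
      using sq c d by (intro add_diff_cancel') (auto simp: M.a_comm)
    have "z\<^sup>\<star> \<otimes> z = (x\<^sup>\<star> \<ominus> x\<^sup>\<star> \<otimes> d) \<otimes> x \<ominus> (x\<^sup>\<star> \<ominus> x\<^sup>\<star> \<otimes> d) \<otimes> (d \<otimes> x)"
      unfolding zs unfolding z_def using x c d by (simp add: minus_mult_right)
    also have "\<dots> = (x\<^sup>\<star> \<otimes> x \<ominus> x\<^sup>\<star> \<otimes> d \<otimes> x) \<ominus> (x\<^sup>\<star> \<otimes> d \<otimes> x \<ominus> x\<^sup>\<star> \<otimes> (d \<otimes> d) \<otimes> x)"
      using x c d by (simp add: minus_mult_left mult_assoc)
    also have "x\<^sup>\<star> \<otimes> (d \<otimes> d) \<otimes> x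
        = (x\<^sup>\<star> \<otimes> d \<otimes> x \<oplus> x\<^sup>\<star> \<otimes> d \<otimes> x) \<ominus> y\<^sup>\<star> \<otimes> y"
      unfolding dd ys unfolding y_def using x c d
      by (simp add: minus_mult_left minus_mult_right mult_add_left mult_add_right mult_assoc)
    finally have zz: "z\<^sup>\<star> \<otimes> z = (x\<^sup>\<star> \<otimes> x \<ominus> x\<^sup>\<star> \<otimes> d \<otimes> x)
        \<ominus> (x\<^sup>\<star> \<otimes> d \<otimes> x \<ominus> ((x\<^sup>\<star> \<otimes> d \<otimes> x \<oplus> x\<^sup>\<star> \<otimes> d \<otimes> x) \<ominus> y\<^sup>\<star> \<otimes> y))" .
    \<comment> \<open>A pure identity of abelian groups, split off to keep products out of the
      rearrangement. It is applied with \<open>u = x\<^sup>\<star> x\<close>,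
      \<open>v = x\<^sup>\<star> d x\<close> and \<open>w = y\<^sup>\<star> y\<close>.\<close>
    have "w \<oplus> ((u \<ominus> v) \<ominus> (v \<ominus> ((v \<oplus> v) \<ominus> w))) = u"
      if uvw: "u \<in> carrier A" "v \<in> carrier A" "w \<in> carrier A" for u v w
    proof -
      have "v \<ominus> ((v \<oplus> v) \<ominus> w) = \<ominus> v \<oplus> w"
        using uvw by (simp add: M.minus_eq M.minus_add M.a_assoc M.r_neg1 M.r_neg2)
      then have "(u \<ominus> v) \<ominus> (v \<ominus> ((v \<oplus> v) \<ominus> w)) = u \<oplus> (\<ominus> v \<oplus> (v \<oplus> \<ominus> w))"
        using uvw by (simp add: M.minus_eq M.minus_add M.a_assoc)
      also have "\<dots> = \<ominus> w \<oplus> u" using uvw by (simp add: M.r_neg1 M.r_neg2 M.a_comm)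
      finally show ?thesis using uvw by (simp add: M.r_neg1 M.r_neg2)
    qed
    note * = this
    have 2: "y\<^sup>\<star> \<otimes> y \<oplus> z\<^sup>\<star> \<otimes> z = x\<^sup>\<star> \<otimes> x"
      unfolding zz by (rule *) (use yz x d in auto)
    have 3: "\<parallel>y \<oplus> k \<odot> z\<parallel> = \<parallel>x\<parallel>" if "cmod k = 1" "cnj k = - k" for k
    proof -
      have "(y \<oplus> k \<odot> z)\<^sup>\<star> \<otimes> (y \<oplus> k \<odot> z) = x\<^sup>\<star> \<otimes> x"
        using star_mult_rotate[OF yz 1 that] 2 by simp
      then have "\<parallel>y \<oplus> k \<odot> z\<parallel>\<^sup>2 = \<parallel>x\<parallel>\<^sup>2"
        using norm_star_mult[of "y \<oplus> k \<odot> z"] norm_star_mult[OF x] yz by simp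
      then show ?thesis using norm_nonneg x yz by (simp add: power2_eq_iff_nonneg)
    qed
    have "\<i> \<odot> z \<oplus> (- \<i>) \<odot> z = \<zero>"
      using smult_add_left[of z \<i> "- \<i>"] yz by (simp add: smult_zero_left)
    moreover have "(y \<oplus> \<i> \<odot> z) \<oplus> (y \<oplus> (- \<i>) \<odot> z) = (y \<oplus> y) \<oplus> (\<i> \<odot> z \<oplus> (- \<i>) \<odot> z)"
      using yz by (simp add: M.a_ac)
    moreover have "y \<oplus> y = 2 \<odot> y"
      using smult_add_left[of y 1 1] yz by (simp add: smult_unit)
    ultimately have "(y \<oplus> \<i> \<odot> z) \<oplus> (y \<oplus> (- \<i>) \<odot> z) = 2 \<odot> y"
      using yz by simp
    then have "\<parallel>2 \<odot> y\<parallel> \<le> 2 * \<parallel>x\<parallel>"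
      using norm_add[of "y \<oplus> \<i> \<odot> z" "y \<oplus> (- \<i>) \<odot> z"] 3[of \<i>] 3[of "- \<i>"] yz by simp
    then show ?thesis using norm_smult[of y 2] yz by (simp add: y_def)
  qed
  \<comment> \<open>The bound for left multiplication is evaluated at \<open>x = c\<close>, where
    the C*-identity turns the product into the square of the norm.\<close>
  have "\<parallel>c\<parallel> * \<parallel>c\<parallel> \<le> \<parallel>c\<parallel> * 1"
    using *[OF c(1)] norm_star_mult[OF c(1)] c(2) by (simp add: power2_eq_square)
  then show ?thesis
    using norm_nonneg[OF c(1)] by (cases "\<parallel>c\<parallel> = 0") (auto simp: mult_le_cancel_left)
qed

lemma cstar_tendsto_const: "l \<in> carrier A \<Longrightarrow> cstar_tendsto A (\<lambda>n. l) l"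
  by (simp add: cstar_tendsto_def minus_self norm_zero)

lemma cstar_tendsto_le:
  assumes "\<And>n. f n \<in> carrier A" "l \<in> carrier A" "\<And>n. \<parallel>f n \<ominus> l\<parallel> \<le> g n" "g \<longlonglongrightarrow> 0"
  shows "cstar_tendsto A f l"
  unfolding cstar_tendsto_def
  by (rule tendsto_sandwich[OF _ _ tendsto_const assms(4)]) (use assms(1-3) norm_nonneg in auto)

lemma cstar_tendsto_add:
  assumes "\<And>n. f n \<in> carrier A" "\<And>n. g n \<in> carrier A" "l \<in> carrier A" "m \<in> carrier A"
    and "cstar_tendsto A f l" "cstar_tendsto A g m"
  shows "cstar_tendsto A (\<lambda>n. f n \<oplus> g n) (l \<oplus> m)"
proof (rule cstar_tendsto_le)
  show "(\<lambda>n. \<parallel>f n \<ominus> l\<parallel> + \<parallel>g n \<ominus> m\<parallel>) \<longlonglongrightarrow> 0"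
    using Limits.tendsto_add[OF assms(5,6)[unfolded cstar_tendsto_def]] by simp
qed (use assms norm_add_diff in auto)

lemma cstar_tendsto_norm:
  assumes "\<And>n. f n \<in> carrier A" "l \<in> carrier A" "cstar_tendsto A f l"
  shows "(\<lambda>n. \<parallel>f n\<parallel>) \<longlonglongrightarrow> \<parallel>l\<parallel>"
proof (rule LIM_zero_cancel, rule Lim_null_comparison)
  have "norm (\<parallel>f n\<parallel> - \<parallel>l\<parallel>) \<le> \<parallel>f n \<ominus> l\<parallel>" for n
    using norm_triangle[of "f n" l] norm_triangle[of l "f n"] norm_diff_commute[of "f n" l] assms
    by (simp add: abs_le_iff)
  then show "\<forall>\<^sub>F n in sequentially. norm (\<parallel>f n\<parallel> - \<parallel>l\<parallel>) \<le> \<parallel>f n \<ominus> l\<parallel>" by simp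
qed (use assms in \<open>simp add: cstar_tendsto_def\<close>)

lemma cstar_tendsto_mult:
  assumes "\<And>n. f n \<in> carrier A" "\<And>n. g n \<in> carrier A" "l \<in> carrier A" "m \<in> carrier A"
    and "cstar_tendsto A f l" "cstar_tendsto A g m"
  shows "cstar_tendsto A (\<lambda>n. f n \<otimes> g n) (l \<otimes> m)"
proof (rule cstar_tendsto_le)
  show "(\<lambda>n. \<parallel>f n \<ominus> l\<parallel> * \<parallel>g n\<parallel> + \<parallel>l\<parallel> * \<parallel>g n \<ominus> m\<parallel>) \<longlonglongrightarrow> 0"
    by (rule tendsto_eq_intros assms(5,6)[unfolded cstar_tendsto_def] cstar_tendsto_norm[OF assms(2,4,6)] refl)+ simp
qed (use assms norm_mult_diff in auto)

lemma cstar_tendsto_star: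
  assumes "\<And>n. f n \<in> carrier A" "l \<in> carrier A" "cstar_tendsto A f l"
  shows "cstar_tendsto A (\<lambda>n. (f n)\<^sup>\<star>) (l\<^sup>\<star>)"
  using assms by (simp add: cstar_tendsto_def norm_star_diff)

lemma cstar_tendsto_smult:
  assumes "\<And>n. f n \<in> carrier A" "l \<in> carrier A" "cstar_tendsto A f l"
  shows "cstar_tendsto A (\<lambda>n. c \<odot> f n) (c \<odot> l)"
proof (rule cstar_tendsto_le)
  show "(\<lambda>n. cmod c * \<parallel>f n \<ominus> l\<parallel>) \<longlonglongrightarrow> 0"
    using tendsto_mult_right_zero[OF assms(3)[unfolded cstar_tendsto_def]] .
  show "\<parallel>c \<odot> f n \<ominus> c \<odot> l\<parallel> \<le> cmod c * \<parallel>f n \<ominus> l\<parallel>" for n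
    using norm_smult_diff[of "f n" l c c] assms by simp
qed (use assms in auto)

lemma cstar_tendsto_unique:
  assumes "\<And>n. f n \<in> carrier A" "l \<in> carrier A" "m \<in> carrier A"
    and "cstar_tendsto A f l" "cstar_tendsto A f m"
  shows "l = m"
proof -
  have "(\<lambda>n. \<parallel>f n \<ominus> l\<parallel> + \<parallel>f n \<ominus> m\<parallel>) \<longlonglongrightarrow> 0"
    using Limits.tendsto_add[OF assms(4,5)[unfolded cstar_tendsto_def]] by simp
  moreover have "\<parallel>l \<ominus> m\<parallel> \<le> \<parallel>f n \<ominus> l\<parallel> + \<parallel>f n \<ominus> m\<parallel>" for n
    using norm_diff_triangle[of l "f n" m] norm_diff_commute[of l "f n"] assms by simp
  ultimately have "\<parallel>l \<ominus> m\<parallel> \<le> 0"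
    by (intro LIMSEQ_le_const) auto
  then show ?thesis using norm_nonneg[of "l \<ominus> m"] norm_diff_eq_0[of l m] assms by simp
qed

end

section \<open>Homomorphisms between C*-algebras\<close>

context cstar_algebra
begin

text \<open>The solution \<open>b = 1 - sqrt (1 - a^2)\<close> is the fixed point of
  \<open>x \<mapsto> (a^2 + x^2) / 2\<close>. The iterates from zero are real polynomials in
  \<open>a\<close> without constant term, so they exist in a non-unital algebra, are self-adjoint
  and commute with \<open>a\<close>. Norm below 1 makes the map a contraction.\<close>

lemma quadratic_root:
  assumes a: "a \<in> carrier A" "a\<^sup>\<star> = a" "\<parallel>a\<parallel> < 1"
  obtains b where "b \<in> carrier A" "b\<^sup>\<star> = b" "a \<otimes> b = b \<otimes> a" "a \<otimes> a \<oplus> b \<otimes> b = b \<oplus> b"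
proof -
  define f where "f x = (1/2) \<odot> (a \<otimes> a \<oplus> x \<otimes> x)" for x
  define b where "b n = (f ^^ n) \<zero>" for n
  define r where "r = \<parallel>a\<parallel>"
  have r: "0 \<le> r" "r < 1" using a norm_nonneg by (auto simp: r_def)
  have b_Suc: "b (Suc n) = f (b n)" for n by (simp add: b_def)
  have fc: "f x \<in> carrier A" if "x \<in> carrier A" for x using that a by (simp add: f_def)
  have bc: "b n \<in> carrier A" for n by (induction n) (simp add: b_def, simp add: b_Suc fc)
  have aa: "\<parallel>a \<otimes> a\<parallel> \<le> r * r" using norm_mult[of a a] a by (simp add: r_def)
  have br: "\<parallel>b n\<parallel> \<le> r" for n
  proof (induction n)
    case (Suc n)
    have "\<parallel>b n \<otimes> b n\<parallel> \<le> r * r"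
      using norm_mult[OF bc bc] mult_mono[OF Suc Suc] norm_nonneg[OF bc] r by (meson order_trans)
    then have "\<parallel>b (Suc n)\<parallel> \<le> r * r"
      using norm_add[of "a \<otimes> a" "b n \<otimes> b n"] aa a bc by (simp add: b_Suc f_def norm_smult)
    also have "\<dots> \<le> r" using r by (simp add: mult_left_le_one_le)
    finally show ?case .
  qed (use r in \<open>simp add: b_def norm_zero\<close>)
  have comm: "a \<otimes> b n = b n \<otimes> a" for n
  proof (induction n)
    case (Suc n)
    have "a \<otimes> (b n \<otimes> b n) = (b n \<otimes> b n) \<otimes> a"
      using Suc a bc by (metis mult_assoc)
    then show ?case
      using a bc by (simp add: b_Suc f_def mult_smult_left mult_smult_right mult_add_left
          mult_add_right mult_assoc)
  qed (use a in \<open>simp add: b_def zero_simps\<close>)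
  have sa: "(b n)\<^sup>\<star> = b n" for n
    by (induction n) (simp add: b_def star_zero, use a bc in \<open>simp add: b_Suc f_def star_smult star_add star_mult\<close>)
  \<comment> \<open>On the ball of radius \<open>r\<close> the map has Lipschitz constant
    \<open>(r + r) / 2 = r\<close>. At \<open>n = 0\<close> the distance is the norm of
    \<open>b k\<close>, at most \<open>r\<close> and hence at most \<open>r ^ 0\<close>.\<close>
  have le: "\<parallel>b (n + k) \<ominus> b n\<parallel> \<le> r ^ n" for n k
  proof (induction n)
    case 0
    have "b k \<ominus> b 0 = b k" using bc by (simp add: b_def[of 0] M.minus_eq)
    then show ?case using br[of k] r by simp
  next
    case (Suc n)
    let ?x = "b (n + k)" and ?y = "b n"
    have "f ?x \<ominus> f ?y = (1/2) \<odot> (?x \<otimes> ?x \<ominus> ?y \<otimes> ?y)"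
    proof -
      have "f ?x \<ominus> f ?y = (1/2) \<odot> ((a \<otimes> a \<oplus> ?x \<otimes> ?x) \<ominus> (a \<otimes> a \<oplus> ?y \<otimes> ?y))"
        using a bc by (simp add: f_def M.minus_eq smult_add_right smult_minus_right)
      also have "(a \<otimes> a \<oplus> ?x \<otimes> ?x) \<ominus> (a \<otimes> a \<oplus> ?y \<otimes> ?y)
          = (a \<otimes> a \<oplus> ?x \<otimes> ?x) \<oplus> (\<ominus> (a \<otimes> a) \<oplus> \<ominus> (?y \<otimes> ?y))"
        using a bc by (simp add: M.minus_eq M.minus_add)
      also have "\<dots> = (a \<otimes> a \<oplus> \<ominus> (a \<otimes> a)) \<oplus> (?x \<otimes> ?x \<oplus> \<ominus> (?y \<otimes> ?y))"
        using a bc by (simp add: M.a_ac)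
      finally show ?thesis using a bc by (simp add: M.r_neg M.minus_eq)
    qed
    then have "\<parallel>f ?x \<ominus> f ?y\<parallel> = \<parallel>?x \<otimes> ?x \<ominus> ?y \<otimes> ?y\<parallel> / 2"
      using bc by (simp add: norm_smult)
    also have "\<dots> \<le> (\<parallel>?x \<ominus> ?y\<parallel> * \<parallel>?x\<parallel> + \<parallel>?y\<parallel> * \<parallel>?x \<ominus> ?y\<parallel>) / 2"
      using norm_mult_diff[OF bc bc bc bc] by simp
    also have "\<dots> \<le> (\<parallel>?x \<ominus> ?y\<parallel> * r + r * \<parallel>?x \<ominus> ?y\<parallel>) / 2"
      using br norm_nonneg bc r by (intro divide_right_mono add_mono mult_mono) auto
    also have "\<dots> \<le> r * r ^ n" using Suc r by (simp add: mult_left_mono)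
    finally show ?case by (simp add: b_Suc)
  qed
  have "\<exists>N. \<forall>m\<ge>N. \<forall>n\<ge>N. \<parallel>b m \<ominus> b n\<parallel> < \<epsilon>" if \<epsilon>: "\<epsilon> > 0" for \<epsilon>
  proof -
    obtain N where N: "r ^ N < \<epsilon>" using real_arch_pow_inv[OF \<epsilon> r(2)] by auto
    have *: "\<parallel>b m \<ominus> b n\<parallel> < \<epsilon>" if "m \<ge> n" "n \<ge> N" for m n
      using le[of n "m - n"] that N power_decreasing[of N n r] r by fastforce
    show ?thesis
      using * norm_diff_commute[OF bc bc] by (metis nle_le)
  qed
  then obtain l where l: "l \<in> carrier A" "cstar_tendsto A b l" using complete[of b] bc by blast
  have bb: "cstar_tendsto A (\<lambda>n. b n \<otimes> b n) (l \<otimes> l)"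
    using l bc by (intro cstar_tendsto_mult) auto
  have "cstar_tendsto A (\<lambda>n. b (Suc n)) (f l)"
    unfolding b_Suc f_def using a bc l bb
    by (intro cstar_tendsto_smult cstar_tendsto_add cstar_tendsto_const) auto
  moreover have "cstar_tendsto A (\<lambda>n. b (Suc n)) l"
    using l(2) unfolding cstar_tendsto_def by (rule LIMSEQ_Suc)
  ultimately have "f l = l" using cstar_tendsto_unique[of "\<lambda>n. b (Suc n)" "f l" l] bc fc l by blast
  then have "l \<oplus> l = 2 \<odot> ((1/2) \<odot> (a \<otimes> a \<oplus> l \<otimes> l))"
    using smult_add_left[of l 1 1] l by (simp add: smult_unit f_def)
  then have 1: "a \<otimes> a \<oplus> l \<otimes> l = l \<oplus> l" using a l by (simp add: smult_smult smult_unit)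
  have "cstar_tendsto A (\<lambda>n. (b n)\<^sup>\<star>) (l\<^sup>\<star>)" using cstar_tendsto_star[OF bc l] .
  then have 2: "l\<^sup>\<star> = l" using cstar_tendsto_unique[OF bc, of "l\<^sup>\<star>" l] l sa by simp
  have "cstar_tendsto A (\<lambda>n. a \<otimes> b n) (a \<otimes> l)" "cstar_tendsto A (\<lambda>n. b n \<otimes> a) (l \<otimes> a)"
    using a l bc by (auto intro!: cstar_tendsto_mult cstar_tendsto_const)
  then have "a \<otimes> l = l \<otimes> a"
    using cstar_tendsto_unique[of "\<lambda>n. a \<otimes> b n" "a \<otimes> l" "l \<otimes> a"] a l bc comm by simp
  then show ?thesis using 1 2 l that by blast
qed

end

context
  fixes A :: "('a, 'm) cstar_scheme" and B :: "('b, 'n) cstar_scheme" and h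
  assumes A: "cstar_algebra A" and B: "cstar_algebra B" and h: "h \<in> cstar_hom A B"
begin

interpretation A: cstar_algebra A by (rule A)
interpretation B: cstar_algebra B by (rule B)

lemma cstar_hom_simps:
  "x \<in> carrier A \<Longrightarrow> h x \<in> carrier B"
  "\<lbrakk>x \<in> carrier A; y \<in> carrier A\<rbrakk> \<Longrightarrow> h (x \<oplus>\<^bsub>A\<^esub> y) = h x \<oplus>\<^bsub>B\<^esub> h y"
  "\<lbrakk>x \<in> carrier A; y \<in> carrier A\<rbrakk> \<Longrightarrow> h (x \<otimes>\<^bsub>A\<^esub> y) = h x \<otimes>\<^bsub>B\<^esub> h y"
  "x \<in> carrier A \<Longrightarrow> h (c \<odot>\<^bsub>A\<^esub> x) = c \<odot>\<^bsub>B\<^esub> h x"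
  "x \<in> carrier A \<Longrightarrow> h (x\<^sup>\<star>\<^bsub>A\<^esub>) = (h x)\<^sup>\<star>\<^bsub>B\<^esub>"
  using h unfolding cstar_hom_def by blast+

lemma cstar_hom_zero: "h \<zero>\<^bsub>A\<^esub> = \<zero>\<^bsub>B\<^esub>"
  using cstar_hom_simps(4)[of "\<zero>\<^bsub>A\<^esub>" 0] cstar_hom_simps(1)[of "\<zero>\<^bsub>A\<^esub>"] by (simp add: A.zero_simps B.zero_simps)

text \<open>The homomorphism carries the quadratic identity for \<open>a\<close> and its companion
  \<open>b\<close> to the target algebra, where the identity alone bounds the norm.\<close>

lemma cstar_hom_norm_le_1:
  assumes a: "a \<in> carrier A" "a\<^sup>\<star>\<^bsub>A\<^esub> = a" "\<parallel>a\<parallel>\<^bsub>A\<^esub> < 1"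
  shows "\<parallel>h a\<parallel>\<^bsub>B\<^esub> \<le> 1"
proof -
  obtain b where b: "b \<in> carrier A" "b\<^sup>\<star>\<^bsub>A\<^esub> = b" "a \<otimes>\<^bsub>A\<^esub> b = b \<otimes>\<^bsub>A\<^esub> a"
      "a \<otimes>\<^bsub>A\<^esub> a \<oplus>\<^bsub>A\<^esub> b \<otimes>\<^bsub>A\<^esub> b = b \<oplus>\<^bsub>A\<^esub> b"
    using A.quadratic_root[OF a] by metis
  show ?thesis
  proof (rule B.sq_add_sq_norm_le[of "h a" "h b"])
    show "(h a)\<^sup>\<star>\<^bsub>B\<^esub> = h a" "(h b)\<^sup>\<star>\<^bsub>B\<^esub> = h b"
      using a b cstar_hom_simps(5) by metis+
    show "h a \<otimes>\<^bsub>B\<^esub> h b = h b \<otimes>\<^bsub>B\<^esub> h a"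
      using a b cstar_hom_simps(3) by metis
    show "h a \<otimes>\<^bsub>B\<^esub> h a \<oplus>\<^bsub>B\<^esub> h b \<otimes>\<^bsub>B\<^esub> h b = h b \<oplus>\<^bsub>B\<^esub> h b"
      using a b cstar_hom_simps(2,3) A.mult_closed by metis
  qed (use a b cstar_hom_simps(1) in auto)
qed

text \<open>Scaling settles self-adjoint elements; the C*-identity reduces the general case to
  \<open>x\<^sup>\<star> x\<close>.\<close>

lemma cstar_hom_norm_le:
  assumes "x \<in> carrier A"
  shows "\<parallel>h x\<parallel>\<^bsub>B\<^esub> \<le> \<parallel>x\<parallel>\<^bsub>A\<^esub>"
proof -
  have *: "\<parallel>h a\<parallel>\<^bsub>B\<^esub> \<le> \<parallel>a\<parallel>\<^bsub>A\<^esub>" if a: "a \<in> carrier A" "a\<^sup>\<star>\<^bsub>A\<^esub> = a" for a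
  proof (rule field_le_epsilon)
    fix e :: real assume e: "e > 0"
    \<comment> \<open>The extra \<open>e\<close> makes the norm of \<open>a / t\<close> strictly
      less than 1, as the quadratic root requires, and also covers \<open>a = 0\<close>.\<close>
    define t where "t = \<parallel>a\<parallel>\<^bsub>A\<^esub> + e"
    have t: "t > 0" "\<parallel>a\<parallel>\<^bsub>A\<^esub> < t" using e A.norm_nonneg[OF a(1)] by (auto simp: t_def)
    have "\<parallel>h (complex_of_real (1 / t) \<odot>\<^bsub>A\<^esub> a)\<parallel>\<^bsub>B\<^esub> \<le> 1"
      using a t by (intro cstar_hom_norm_le_1) (simp_all add: A.star_smult A.norm_smult norm_divide)
    then show "\<parallel>h a\<parallel>\<^bsub>B\<^esub> \<le> \<parallel>a\<parallel>\<^bsub>A\<^esub> + e"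
      using a t cstar_hom_simps(1)[OF a(1)]
      by (simp add: cstar_hom_simps(4) B.norm_smult norm_divide divide_le_eq flip: t_def)
  qed
  have "\<parallel>h x\<parallel>\<^bsub>B\<^esub>\<^sup>2 \<le> \<parallel>x\<parallel>\<^bsub>A\<^esub>\<^sup>2"
    using *[of "x\<^sup>\<star>\<^bsub>A\<^esub> \<otimes>\<^bsub>A\<^esub> x"] assms cstar_hom_simps(1)[OF assms]
    by (simp add: A.star_mult A.star_star A.norm_star_mult cstar_hom_simps B.norm_star_mult)
  then show ?thesis using A.norm_nonneg[OF assms] power2_le_imp_le by blast
qed

end

text \<open>A map prescribed on sums of generators would first have to be shown independent of the
  chosen sum. With a relation this comes later: differences of pairs stay in \<open>R\<close>, so a
  norm bound applied to \<open>(0, y - y')\<close> yields \<open>y = y'\<close>.\<close>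

locale star_relation = A: cstar_algebra A + B: cstar_algebra B
  for A :: "('a, 'm) cstar_scheme" and B :: "('b, 'n) cstar_scheme" +
  fixes R :: "('a \<times> 'b) set"
  assumes R_carrier: "(x, y) \<in> R \<Longrightarrow> x \<in> carrier A \<and> y \<in> carrier B"
    and R_add: "\<lbrakk>(x, y) \<in> R; (x', y') \<in> R\<rbrakk> \<Longrightarrow> (x \<oplus>\<^bsub>A\<^esub> x', y \<oplus>\<^bsub>B\<^esub> y') \<in> R"
    and R_mult: "\<lbrakk>(x, y) \<in> R; (x', y') \<in> R\<rbrakk> \<Longrightarrow> (x \<otimes>\<^bsub>A\<^esub> x', y \<otimes>\<^bsub>B\<^esub> y') \<in> R"
    and R_smult: "(x, y) \<in> R \<Longrightarrow> (c \<odot>\<^bsub>A\<^esub> x, c \<odot>\<^bsub>B\<^esub> y) \<in> R"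
    and R_star: "(x, y) \<in> R \<Longrightarrow> (x\<^sup>\<star>\<^bsub>A\<^esub>, y\<^sup>\<star>\<^bsub>B\<^esub>) \<in> R"
begin

lemma R_closed: "(x, y) \<in> R \<Longrightarrow> x \<in> carrier A" "(x, y) \<in> R \<Longrightarrow> y \<in> carrier B"
  using R_carrier by auto

lemma R_minus: "\<lbrakk>(x, y) \<in> R; (x', y') \<in> R\<rbrakk> \<Longrightarrow> (x \<ominus>\<^bsub>A\<^esub> x', y \<ominus>\<^bsub>B\<^esub> y') \<in> R"
  using R_add[of x y "(-1) \<odot>\<^bsub>A\<^esub> x'" "(-1) \<odot>\<^bsub>B\<^esub> y'"] R_smult[of x' y' "-1"] R_closed[of x' y']
  by (simp add: A.smult_minus_one B.smult_minus_one A.M.minus_eq B.M.minus_eq)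

text \<open>
  For self-adjoint \<open>a\<close>, the norm of the \<open>2 ^ n\<close>-th power of \<open>a\<close> is the \<open>2 ^ n\<close>-th power of its norm,
  so that any bound improves to the bound 1 after taking roots.
\<close>

lemma bounded_imp_contractive:
  assumes C: "\<And>x y. (x, y) \<in> R \<Longrightarrow> \<parallel>y\<parallel>\<^bsub>B\<^esub> \<le> C * \<parallel>x\<parallel>\<^bsub>A\<^esub>" and xy: "(x, y) \<in> R"
  shows "\<parallel>y\<parallel>\<^bsub>B\<^esub> \<le> \<parallel>x\<parallel>\<^bsub>A\<^esub>"
proof -
  \<comment> \<open>The leading 2 in the exponent comes from replacing the pair by
    \<open>x\<^sup>\<star> x\<close> and \<open>y\<^sup>\<star> y\<close>, which makes both
    components self-adjoint; every further step squares them.\<close>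
  have pow: "\<exists>x' y'. (x', y') \<in> R \<and> x'\<^sup>\<star>\<^bsub>A\<^esub> = x' \<and> y'\<^sup>\<star>\<^bsub>B\<^esub> = y'
      \<and> \<parallel>x'\<parallel>\<^bsub>A\<^esub> = \<parallel>x\<parallel>\<^bsub>A\<^esub> ^ (2 * 2 ^ n) \<and> \<parallel>y'\<parallel>\<^bsub>B\<^esub> = \<parallel>y\<parallel>\<^bsub>B\<^esub> ^ (2 * 2 ^ n)" for n
  proof (induction n)
    case 0
    show ?case
      using R_mult[OF R_star[OF xy] xy] R_closed[OF xy]
      by (intro exI[of _ "x\<^sup>\<star>\<^bsub>A\<^esub> \<otimes>\<^bsub>A\<^esub> x"] exI[of _ "y\<^sup>\<star>\<^bsub>B\<^esub> \<otimes>\<^bsub>B\<^esub> y"])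
        (simp add: A.star_mult A.star_star A.norm_star_mult B.star_mult B.star_star B.norm_star_mult)
  next
    case (Suc n)
    then obtain x' y' where 1: "(x', y') \<in> R" "x'\<^sup>\<star>\<^bsub>A\<^esub> = x'" "y'\<^sup>\<star>\<^bsub>B\<^esub> = y'"
      "\<parallel>x'\<parallel>\<^bsub>A\<^esub> = \<parallel>x\<parallel>\<^bsub>A\<^esub> ^ (2 * 2 ^ n)" "\<parallel>y'\<parallel>\<^bsub>B\<^esub> = \<parallel>y\<parallel>\<^bsub>B\<^esub> ^ (2 * 2 ^ n)" by blast
    have 2: "t ^ (2 * 2 ^ Suc n) = (t ^ (2 * 2 ^ n))\<^sup>2" for t :: real
    proof -
      have "2 * 2 ^ Suc n = 2 * 2 ^ n * (2 :: nat)" by simp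
      then show ?thesis by (simp only: power_mult)
    qed
    show ?case
      unfolding 2 using R_mult[OF 1(1,1)] R_closed[OF 1(1)] A.norm_star_mult[of x'] B.norm_star_mult[of y'] 1
      by (intro exI[of _ "x' \<otimes>\<^bsub>A\<^esub> x'"] exI[of _ "y' \<otimes>\<^bsub>B\<^esub> y'"])
        (simp add: A.star_mult B.star_mult)
  qed
  have le: "\<parallel>y\<parallel>\<^bsub>B\<^esub> ^ (2 * 2 ^ n) \<le> C * \<parallel>x\<parallel>\<^bsub>A\<^esub> ^ (2 * 2 ^ n)" for n
    using pow[of n] C by metis
  have nn: "0 \<le> \<parallel>x\<parallel>\<^bsub>A\<^esub>" "0 \<le> \<parallel>y\<parallel>\<^bsub>B\<^esub>" using A.norm_nonneg B.norm_nonneg R_closed[OF xy] by auto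
  show ?thesis
  proof (rule ccontr)
    assume "\<not> ?thesis"
    then have less: "\<parallel>x\<parallel>\<^bsub>A\<^esub> < \<parallel>y\<parallel>\<^bsub>B\<^esub>" by simp
    then have y0: "0 < \<parallel>y\<parallel>\<^bsub>B\<^esub>" using nn by simp
    \<comment> \<open>Since \<open>q < 1\<close>, its powers tend to 0, while the assumed bound
      keeps every \<open>q ^ (2 * 2 ^ n)\<close> above a fixed positive number.\<close>
    define q where "q = \<parallel>x\<parallel>\<^bsub>A\<^esub> / \<parallel>y\<parallel>\<^bsub>B\<^esub>"
    have q: "0 \<le> q" "q < 1" using nn less y0 by (auto simp: q_def)
    have qC: "1 \<le> \<bar>C\<bar> * q ^ (2 * 2 ^ n)" for n
    proof -
      have "1 \<le> C * q ^ (2 * 2 ^ n)"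
        using le[of n] y0 by (simp add: q_def power_divide pos_le_divide_eq)
      also have "\<dots> \<le> \<bar>C\<bar> * q ^ (2 * 2 ^ n)" using q by (intro mult_right_mono) auto
      finally show ?thesis .
    qed
    have "0 < \<bar>C\<bar>" using qC[of 0] by auto
    then obtain n where n: "q ^ n < 1 / \<bar>C\<bar>" using real_arch_pow_inv[of "1 / \<bar>C\<bar>" q] q by auto
    have "n \<le> 2 * 2 ^ n" using less_exp[of n] by linarith
    then have "q ^ (2 * 2 ^ n) \<le> q ^ n" using q by (intro power_decreasing) auto
    with n have "q ^ (2 * 2 ^ n) < 1 / \<bar>C\<bar>" by linarith
    then show False using qC[of n] \<open>0 < \<bar>C\<bar>\<close> by (simp add: pos_less_divide_eq mult.commute)
  qed
qed

end

lemma (in cstar_algebra) norm_close_seq: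
  assumes "S \<subseteq> carrier A" "l \<in> carrier A" "\<And>\<epsilon>. \<epsilon> > 0 \<Longrightarrow> \<exists>x\<in>S. \<parallel>x \<ominus> l\<parallel> < \<epsilon>"
  obtains f where "\<And>n :: nat. f n \<in> S" "cstar_tendsto A f l"
proof -
  have "\<exists>x\<in>S. \<parallel>x \<ominus> l\<parallel> < inverse (real (Suc n))" for n using assms(3) by simp
  then obtain f where f: "\<And>n. f n \<in> S" "\<And>n. \<parallel>f n \<ominus> l\<parallel> < inverse (real (Suc n))" by metis
  have "cstar_tendsto A f l"
    by (rule cstar_tendsto_le[OF _ _ _ LIMSEQ_inverse_real_of_nat])
      (use f assms(1,2) in \<open>auto intro: less_imp_le\<close>)
  then show ?thesis using f that by blast
qed

lemma (in cstar_algebra) cstar_tendsto_close: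
  assumes "cstar_tendsto A f l" "\<epsilon> > 0"
  obtains n where "\<parallel>f n \<ominus> l\<parallel> < \<epsilon>"
proof -
  have "\<forall>\<^sub>F n in sequentially. \<parallel>f n \<ominus> l\<parallel> < \<epsilon>"
    using order_tendstoD(2)[OF assms(1)[unfolded cstar_tendsto_def] assms(2)] .
  then show ?thesis using that unfolding eventually_sequentially by blast
qed

lemma (in cstar_algebra) closed_star_subalgebra_closure:
  assumes S: "S \<subseteq> carrier A" "\<zero> \<in> S" "\<And>x y. x \<in> S \<Longrightarrow> y \<in> S \<Longrightarrow> x \<oplus> y \<in> S"
    "\<And>x y. x \<in> S \<Longrightarrow> y \<in> S \<Longrightarrow> x \<otimes> y \<in> S" "\<And>c x. x \<in> S \<Longrightarrow> c \<odot> x \<in> S"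
    "\<And>x. x \<in> S \<Longrightarrow> x\<^sup>\<star> \<in> S"
  shows "closed_star_subalgebra A {l \<in> carrier A. \<forall>\<epsilon>>0. \<exists>x\<in>S. \<parallel>x \<ominus> l\<parallel> < \<epsilon>}"
proof -
  define C where "C = {l \<in> carrier A. \<forall>\<epsilon>>0. \<exists>x\<in>S. \<parallel>x \<ominus> l\<parallel> < \<epsilon>}"
  have memI: "l \<in> C" if "\<And>n. f n \<in> S" "cstar_tendsto A f l" "l \<in> carrier A" for f l
    unfolding C_def using that(1,3) cstar_tendsto_close[OF that(2)] by simp metis
  have Cc: "l \<in> carrier A" if "l \<in> C" for l using that by (simp add: C_def)
  have memE: "\<exists>x\<in>S. \<parallel>x \<ominus> l\<parallel> < \<epsilon>" if "l \<in> C" "\<epsilon> > 0" for l \<epsilon> using that by (simp add: C_def)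
  have memD: "\<exists>f. (\<forall>n :: nat. f n \<in> S) \<and> cstar_tendsto A f l" if "l \<in> C" for l
    by (rule norm_close_seq[OF S(1) Cc[OF that] memE[OF that]]) auto
  have Sc: "x \<in> carrier A" if "x \<in> S" for x using that S(1) by auto
  have 0: "\<zero> \<in> C" using memI[of "\<lambda>_. \<zero>" \<zero>] S(2) cstar_tendsto_const[of \<zero>] by simp
  have 1: "x \<oplus> y \<in> C" "x \<otimes> y \<in> C" if xy: "x \<in> C" "y \<in> C" for x y
  proof -
    obtain f g where f: "\<forall>n :: nat. f n \<in> S" "cstar_tendsto A f x"
      and g: "\<forall>n :: nat. g n \<in> S" "cstar_tendsto A g y" using memD xy by meson
    then have c: "f n \<in> carrier A" "g n \<in> carrier A" for n using Sc by auto
    show "x \<oplus> y \<in> C"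
      by (rule memI[OF _ cstar_tendsto_add[OF c(1) c(2) Cc[OF xy(1)] Cc[OF xy(2)] f(2) g(2)]])
        (use f g xy Cc S(3) in auto)
    show "x \<otimes> y \<in> C"
      by (rule memI[OF _ cstar_tendsto_mult[OF c(1) c(2) Cc[OF xy(1)] Cc[OF xy(2)] f(2) g(2)]])
        (use f g xy Cc S(4) in auto)
  qed
  have 2: "c \<odot> x \<in> C" "x\<^sup>\<star> \<in> C" if x: "x \<in> C" for c x
  proof -
    obtain f where f: "\<forall>n :: nat. f n \<in> S" "cstar_tendsto A f x" using memD x by meson
    then have c: "f n \<in> carrier A" for n using Sc by auto
    show "c \<odot> x \<in> C"
      by (rule memI[OF _ cstar_tendsto_smult[OF c Cc[OF x] f(2)]]) (use f x Cc S(5) in auto)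
    show "x\<^sup>\<star> \<in> C"
      by (rule memI[OF _ cstar_tendsto_star[OF c Cc[OF x] f(2)]]) (use f x Cc S(6) in auto)
  qed
  have 3: "l \<in> C" if f: "\<forall>n. f n \<in> C" and l: "l \<in> carrier A" "cstar_tendsto A f l" for f l
  proof -
    have "\<exists>x\<in>S. \<parallel>x \<ominus> l\<parallel> < \<epsilon>" if e: "\<epsilon> > 0" for \<epsilon>
    proof -
      obtain n where n: "\<parallel>f n \<ominus> l\<parallel> < \<epsilon> / 2" using cstar_tendsto_close[OF l(2) half_gt_zero[OF e]] .
      obtain x where x: "x \<in> S" "\<parallel>x \<ominus> f n\<parallel> < \<epsilon> / 2"
        using memE[OF f[rule_format] half_gt_zero[OF e]] by blast
      show ?thesis
        using norm_diff_triangle[of x "f n" l] x n Cc[of "f n"] f l Sc by (intro bexI[of _ x]) auto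
    qed
    then show ?thesis using l by (simp add: C_def)
  qed
  have "closed_star_subalgebra A C"
    unfolding closed_star_subalgebra_def
  proof (intro conjI ballI allI impI)
    show "C \<subseteq> carrier A" using Cc by blast
    show "l \<in> C" if "(\<forall>n. f n \<in> C) \<and> l \<in> carrier A \<and> cstar_tendsto A f l" for f l
      using 3[of f l] that by simp
  qed (fact 0 1 2)+
  then show ?thesis unfolding C_def .
qed

context star_relation
begin

text \<open>The closure of the set of first components is a closed *-subalgebra containing the
  generating set, hence the whole algebra.\<close>

lemma dense_if_generates:
  assumes gen: "cstar_generates A X" and X: "X \<subseteq> fst ` R" and zero: "(\<zero>\<^bsub>A\<^esub>, \<zero>\<^bsub>B\<^esub>) \<in> R"
    and x: "x \<in> carrier A" and e: "\<epsilon> > 0"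
  shows "\<exists>(x', y') \<in> R. \<parallel>x' \<ominus>\<^bsub>A\<^esub> x\<parallel>\<^bsub>A\<^esub> < \<epsilon>"
proof -
  let ?S = "fst ` R"
  let ?C = "{l \<in> carrier A. \<forall>\<epsilon>>0. \<exists>x\<in>?S. \<parallel>x \<ominus>\<^bsub>A\<^esub> l\<parallel>\<^bsub>A\<^esub> < \<epsilon>}"
  have S: "?S \<subseteq> carrier A" using R_closed(1) by auto
  have "closed_star_subalgebra A ?C"
  proof (rule A.closed_star_subalgebra_closure[OF S])
    have iff: "x \<in> ?S \<longleftrightarrow> (\<exists>y. (x, y) \<in> R)" for x by (simp add: image_iff Bex_def)
    show "\<zero>\<^bsub>A\<^esub> \<in> ?S" using zero iff by blast
    show "x \<oplus>\<^bsub>A\<^esub> y \<in> ?S" "x \<otimes>\<^bsub>A\<^esub> y \<in> ?S" if "x \<in> ?S" "y \<in> ?S" for x y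
      using that R_add R_mult unfolding iff by blast+
    show "c \<odot>\<^bsub>A\<^esub> x \<in> ?S" "x\<^sup>\<star>\<^bsub>A\<^esub> \<in> ?S" if "x \<in> ?S" for c x
      using that R_smult R_star unfolding iff by blast+
  qed
  moreover have "?S \<subseteq> ?C"
  proof
    fix x assume x: "x \<in> ?S"
    then have "x \<in> carrier A" "\<parallel>x \<ominus>\<^bsub>A\<^esub> x\<parallel>\<^bsub>A\<^esub> = 0" using S A.minus_self A.norm_zero by auto
    with x show "x \<in> ?C" by (intro CollectI conjI allI impI bexI[of _ x]) auto
  qed
  ultimately have "?C = carrier A"
    using gen subset_trans[OF X] unfolding cstar_generates_def by presburger
  with x have "x \<in> ?C" by simp
  then have "\<exists>x'\<in>?S. \<parallel>x' \<ominus>\<^bsub>A\<^esub> x\<parallel>\<^bsub>A\<^esub> < \<epsilon>" using e by simp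
  then show ?thesis by (simp add: case_prod_beta image_iff)
qed

text \<open>The homomorphism is the norm closure of \<open>R\<close>. Contractivity applied to
  differences turns convergence of first components into the Cauchy property of second components
  and makes their limit unique. The algebraic laws pass to limits.\<close>

lemma extends_to_hom:
  assumes contr: "\<And>x y. (x, y) \<in> R \<Longrightarrow> \<parallel>y\<parallel>\<^bsub>B\<^esub> \<le> \<parallel>x\<parallel>\<^bsub>A\<^esub>"
    and dense: "\<And>x \<epsilon>. x \<in> carrier A \<Longrightarrow> \<epsilon> > 0 \<Longrightarrow> \<exists>(x', y') \<in> R. \<parallel>x' \<ominus>\<^bsub>A\<^esub> x\<parallel>\<^bsub>A\<^esub> < \<epsilon>"
  shows "\<exists>h\<in>cstar_hom A B. \<forall>(x, y) \<in> R. h x = y"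
proof -
  define lim where "lim x y \<longleftrightarrow> x \<in> carrier A \<and> y \<in> carrier B \<and> (\<exists>f g. (\<forall>n. (f n, g n) \<in> R) \<and>
    cstar_tendsto A f x \<and> cstar_tendsto B g y)" for x y
  have limD: "\<exists>f g. (\<forall>n. (f n, g n) \<in> R) \<and> (\<forall>n. f n \<in> carrier A) \<and> (\<forall>n. g n \<in> carrier B) \<and>
      cstar_tendsto A f x \<and> cstar_tendsto B g y \<and> x \<in> carrier A \<and> y \<in> carrier B" if "lim x y" for x y
    using that R_closed unfolding lim_def by blast
  have limI: "lim x y" if "\<And>n. (f n, g n) \<in> R" "cstar_tendsto A f x" "cstar_tendsto B g y"
      "x \<in> carrier A" "y \<in> carrier B" for f g x y
    using that unfolding lim_def by blast
  have lim_add: "lim (x \<oplus>\<^bsub>A\<^esub> x') (y \<oplus>\<^bsub>B\<^esub> y')" if xy: "lim x y" "lim x' y'" for x y x' y'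
  proof -
    obtain f g where 1: "\<forall>n. (f n, g n) \<in> R" "\<forall>n. f n \<in> carrier A" "\<forall>n. g n \<in> carrier B"
      "cstar_tendsto A f x" "cstar_tendsto B g y" "x \<in> carrier A" "y \<in> carrier B"
      using limD[OF xy(1)] by blast
    obtain f' g' where "\<forall>n. (f' n, g' n) \<in> R" "\<forall>n. f' n \<in> carrier A" "\<forall>n. g' n \<in> carrier B"
      "cstar_tendsto A f' x'" "cstar_tendsto B g' y'" "x' \<in> carrier A" "y' \<in> carrier B"
      using limD[OF xy(2)] by blast
    with 1 show ?thesis
      by (intro limI[of "\<lambda>n. f n \<oplus>\<^bsub>A\<^esub> f' n" "\<lambda>n. g n \<oplus>\<^bsub>B\<^esub> g' n"] A.cstar_tendsto_add B.cstar_tendsto_add R_add)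
        auto
  qed
  have lim_mult: "lim (x \<otimes>\<^bsub>A\<^esub> x') (y \<otimes>\<^bsub>B\<^esub> y')" if xy: "lim x y" "lim x' y'" for x y x' y'
  proof -
    obtain f g where 1: "\<forall>n. (f n, g n) \<in> R" "\<forall>n. f n \<in> carrier A" "\<forall>n. g n \<in> carrier B"
      "cstar_tendsto A f x" "cstar_tendsto B g y" "x \<in> carrier A" "y \<in> carrier B"
      using limD[OF xy(1)] by blast
    obtain f' g' where "\<forall>n. (f' n, g' n) \<in> R" "\<forall>n. f' n \<in> carrier A" "\<forall>n. g' n \<in> carrier B"
      "cstar_tendsto A f' x'" "cstar_tendsto B g' y'" "x' \<in> carrier A" "y' \<in> carrier B"
      using limD[OF xy(2)] by blast
    with 1 show ?thesis
      by (intro limI[of "\<lambda>n. f n \<otimes>\<^bsub>A\<^esub> f' n" "\<lambda>n. g n \<otimes>\<^bsub>B\<^esub> g' n"] A.cstar_tendsto_mult B.cstar_tendsto_mult R_mult)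
        auto
  qed
  have lim_smult_star: "lim (c \<odot>\<^bsub>A\<^esub> x) (c \<odot>\<^bsub>B\<^esub> y) \<and> lim (x\<^sup>\<star>\<^bsub>A\<^esub>) (y\<^sup>\<star>\<^bsub>B\<^esub>)" if xy: "lim x y" for c x y
  proof -
    obtain f g where *: "\<forall>n. (f n, g n) \<in> R" "\<forall>n. f n \<in> carrier A" "\<forall>n. g n \<in> carrier B"
      "cstar_tendsto A f x" "cstar_tendsto B g y" "x \<in> carrier A" "y \<in> carrier B"
      using limD[OF xy] by blast
    show ?thesis
    proof
      show "lim (c \<odot>\<^bsub>A\<^esub> x) (c \<odot>\<^bsub>B\<^esub> y)" using *
        by (intro limI[of "\<lambda>n. c \<odot>\<^bsub>A\<^esub> f n" "\<lambda>n. c \<odot>\<^bsub>B\<^esub> g n"] A.cstar_tendsto_smult B.cstar_tendsto_smult R_smult)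
          auto
      show "lim (x\<^sup>\<star>\<^bsub>A\<^esub>) (y\<^sup>\<star>\<^bsub>B\<^esub>)" using *
        by (intro limI[of "\<lambda>n. (f n)\<^sup>\<star>\<^bsub>A\<^esub>" "\<lambda>n. (g n)\<^sup>\<star>\<^bsub>B\<^esub>"] A.cstar_tendsto_star B.cstar_tendsto_star R_star)
          auto
    qed
  qed
  have lim_norm: "\<parallel>y\<parallel>\<^bsub>B\<^esub> \<le> \<parallel>x\<parallel>\<^bsub>A\<^esub>" if "lim x y" for x y
  proof -
    obtain f g where *: "\<forall>n. (f n, g n) \<in> R" "\<forall>n. f n \<in> carrier A" "\<forall>n. g n \<in> carrier B"
      "cstar_tendsto A f x" "cstar_tendsto B g y" "x \<in> carrier A" "y \<in> carrier B"
      using limD[OF \<open>lim x y\<close>] by blast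
    then have "(\<lambda>n. \<parallel>f n\<parallel>\<^bsub>A\<^esub>) \<longlonglongrightarrow> \<parallel>x\<parallel>\<^bsub>A\<^esub>" "(\<lambda>n. \<parallel>g n\<parallel>\<^bsub>B\<^esub>) \<longlonglongrightarrow> \<parallel>y\<parallel>\<^bsub>B\<^esub>"
      using A.cstar_tendsto_norm[of f x] B.cstar_tendsto_norm[of g y] by auto
    then show ?thesis using LIMSEQ_le[of "\<lambda>n. \<parallel>g n\<parallel>\<^bsub>B\<^esub>" _ "\<lambda>n. \<parallel>f n\<parallel>\<^bsub>A\<^esub>"] contr * by blast
  qed
  have lim_unique: "y = y'" if "lim x y" "lim x y'" for x y y'
  proof -
    have c: "x \<in> carrier A" "y \<in> carrier B" "y' \<in> carrier B" using that unfolding lim_def by auto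
    have "lim (x \<oplus>\<^bsub>A\<^esub> (-1) \<odot>\<^bsub>A\<^esub> x) (y \<oplus>\<^bsub>B\<^esub> (-1) \<odot>\<^bsub>B\<^esub> y')"
      using lim_add lim_smult_star that by blast
    then have "\<parallel>y \<ominus>\<^bsub>B\<^esub> y'\<parallel>\<^bsub>B\<^esub> \<le> \<parallel>x \<ominus>\<^bsub>A\<^esub> x\<parallel>\<^bsub>A\<^esub>"
      using lim_norm c by (force simp: A.smult_minus_one B.smult_minus_one A.M.minus_eq B.M.minus_eq)
    then have "\<parallel>y \<ominus>\<^bsub>B\<^esub> y'\<parallel>\<^bsub>B\<^esub> = 0"
      using B.norm_nonneg[of "y \<ominus>\<^bsub>B\<^esub> y'"] c by (simp add: A.minus_self A.norm_zero)
    then show ?thesis using B.norm_diff_eq_0 c by blast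
  qed
  have lim_ex: "\<exists>y. lim x y" if x: "x \<in> carrier A" for x
  proof -
    have "\<exists>p\<in>R. \<parallel>fst p \<ominus>\<^bsub>A\<^esub> x\<parallel>\<^bsub>A\<^esub> < inverse (real (Suc n))" for n
      using dense[OF x, of "inverse (real (Suc n))"] by force
    then obtain p where p: "\<And>n. p n \<in> R" "\<And>n. \<parallel>fst (p n) \<ominus>\<^bsub>A\<^esub> x\<parallel>\<^bsub>A\<^esub> < inverse (real (Suc n))" by metis
    define f g where "f n = fst (p n)" and "g n = snd (p n)" for n
    have fg: "(f n, g n) \<in> R" for n using p by (simp add: f_def g_def)
    have fc: "f n \<in> carrier A" and gc: "g n \<in> carrier B" for n using R_closed[OF fg] by auto
    have fx: "cstar_tendsto A f x"
      by (rule A.cstar_tendsto_le[OF _ _ _ LIMSEQ_inverse_real_of_nat])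
        (use fc x p(2) in \<open>auto intro: less_imp_le simp: f_def\<close>)
    have "\<exists>N. \<forall>m\<ge>N. \<forall>n\<ge>N. \<parallel>g m \<ominus>\<^bsub>B\<^esub> g n\<parallel>\<^bsub>B\<^esub> < \<epsilon>" if e: "\<epsilon> > 0" for \<epsilon>
    proof -
      obtain N where N: "\<And>n. n \<ge> N \<Longrightarrow> \<parallel>f n \<ominus>\<^bsub>A\<^esub> x\<parallel>\<^bsub>A\<^esub> < \<epsilon> / 2"
        using order_tendstoD(2)[OF fx[unfolded cstar_tendsto_def], of "\<epsilon> / 2"] e
        unfolding eventually_sequentially by auto
      have "\<parallel>g m \<ominus>\<^bsub>B\<^esub> g n\<parallel>\<^bsub>B\<^esub> < \<epsilon>" if mn: "m \<ge> N" "n \<ge> N" for m n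
      proof -
        have "\<parallel>g m \<ominus>\<^bsub>B\<^esub> g n\<parallel>\<^bsub>B\<^esub> \<le> \<parallel>f m \<ominus>\<^bsub>A\<^esub> f n\<parallel>\<^bsub>A\<^esub>" using contr R_minus fg by blast
        then show ?thesis
          using A.norm_diff_triangle[of "f m" x "f n"] A.norm_diff_commute[of x "f n"] N[OF mn(1)] N[OF mn(2)] fc x
          by simp
      qed
      then show ?thesis by blast
    qed
    then obtain y where "y \<in> carrier B" "cstar_tendsto B g y" using B.complete[of g] gc by blast
    then show ?thesis using limI[OF fg fx] x by blast
  qed
  define h where "h x = (SOME y. lim x y)" for x
  have h: "lim x (h x)" if "x \<in> carrier A" for x
    unfolding h_def using someI_ex[OF lim_ex[OF that]] .
  have h_eq: "h x = y" if "lim x y" for x y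
    using lim_unique[OF h that] that by (simp add: lim_def)
  have "h \<in> cstar_hom A B"
    unfolding cstar_hom_def using h lim_add lim_mult lim_smult_star
    by (auto simp: Pi_iff intro!: h_eq) (auto simp: lim_def)
  moreover have "h x = y" if "(x, y) \<in> R" for x y
    using that R_closed[OF that] A.cstar_tendsto_const B.cstar_tendsto_const
    by (intro h_eq limI[of "\<lambda>_. x" "\<lambda>_. y"]) auto
  ultimately show ?thesis by blast
qed

end

text \<open>Addition is the only operation under which the generating pairs are not closed, so plain
  finite sums suffice for the span; scalar coefficients are absorbed by
  \<open>X_smult\<close>.\<close>

locale star_relation_generators = A: cstar_algebra A + B: cstar_algebra B
  for A :: "('a, 'm) cstar_scheme" and B :: "('b, 'n) cstar_scheme" +
  fixes X :: "('a \<times> 'b) set"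
  assumes X_carrier: "(x, y) \<in> X \<Longrightarrow> x \<in> carrier A \<and> y \<in> carrier B"
    and X_mult: "\<lbrakk>(x, y) \<in> X; (x', y') \<in> X\<rbrakk> \<Longrightarrow> (x \<otimes>\<^bsub>A\<^esub> x', y \<otimes>\<^bsub>B\<^esub> y') \<in> X"
    and X_smult: "(x, y) \<in> X \<Longrightarrow> (c \<odot>\<^bsub>A\<^esub> x, c \<odot>\<^bsub>B\<^esub> y) \<in> X"
    and X_star: "(x, y) \<in> X \<Longrightarrow> (x\<^sup>\<star>\<^bsub>A\<^esub>, y\<^sup>\<star>\<^bsub>B\<^esub>) \<in> X"
begin

inductive_set span where
  span_zero: "(\<zero>\<^bsub>A\<^esub>, \<zero>\<^bsub>B\<^esub>) \<in> span"
| span_step: "\<lbrakk>(x, y) \<in> span; (x', y') \<in> X\<rbrakk> \<Longrightarrow> (x \<oplus>\<^bsub>A\<^esub> x', y \<oplus>\<^bsub>B\<^esub> y') \<in> span"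

lemma span_carrier: "(x, y) \<in> span \<Longrightarrow> x \<in> carrier A \<and> y \<in> carrier B"
  by (induction rule: span.induct) (auto dest: X_carrier)

lemma span_base: "(x, y) \<in> X \<Longrightarrow> (x, y) \<in> span"
  using span_step[OF span_zero] X_carrier by force

lemma span_add: "\<lbrakk>(x', y') \<in> span; (x, y) \<in> span\<rbrakk> \<Longrightarrow> (x \<oplus>\<^bsub>A\<^esub> x', y \<oplus>\<^bsub>B\<^esub> y') \<in> span"
proof (induction rule: span.induct)
  case (span_step u v u' v')
  then show ?case
    using span.span_step[of "x \<oplus>\<^bsub>A\<^esub> u" "y \<oplus>\<^bsub>B\<^esub> v" u' v'] span_carrier[of u v] span_carrier[of x y]
      X_carrier[of u' v']
    by (simp add: A.M.a_assoc B.M.a_assoc)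
qed (use span_carrier in force)

lemma span_mult_base: "\<lbrakk>(x, y) \<in> span; (x', y') \<in> X\<rbrakk> \<Longrightarrow> (x \<otimes>\<^bsub>A\<^esub> x', y \<otimes>\<^bsub>B\<^esub> y') \<in> span"
proof (induction rule: span.induct)
  case (span_step u v u' v')
  then show ?case
    using span.span_step[of "u \<otimes>\<^bsub>A\<^esub> x'" "v \<otimes>\<^bsub>B\<^esub> y'" "u' \<otimes>\<^bsub>A\<^esub> x'" "v' \<otimes>\<^bsub>B\<^esub> y'"]
      X_mult[of u' v' x' y'] span_carrier[of u v] X_carrier[of x' y'] X_carrier[of u' v']
    by (simp add: A.mult_add_left B.mult_add_left)
qed (use span_zero X_carrier in \<open>force simp: A.zero_simps B.zero_simps\<close>)

lemma star_relation_span: "star_relation A B span"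
proof
  show "(x \<otimes>\<^bsub>A\<^esub> x', y \<otimes>\<^bsub>B\<^esub> y') \<in> span" if "(x, y) \<in> span" "(x', y') \<in> span" for x y x' y'
    using that(2)
  proof (induction rule: span.induct)
    case (span_step u v u' v')
    then show ?case
      using span_add[OF span_mult_base[OF that(1), of u' v'], of "x \<otimes>\<^bsub>A\<^esub> u" "y \<otimes>\<^bsub>B\<^esub> v"]
        span_carrier[OF that(1)] X_carrier[of u' v'] span_carrier[of u v]
      by (simp add: A.mult_add_right B.mult_add_right)
  qed (use span_zero span_carrier[OF that(1)] in \<open>simp add: A.zero_simps B.zero_simps\<close>)
  show "(c \<odot>\<^bsub>A\<^esub> x, c \<odot>\<^bsub>B\<^esub> y) \<in> span" if "(x, y) \<in> span" for c x y
    using that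
  proof (induction rule: span.induct)
    case (span_step u v u' v')
    then show ?case
      using span.span_step[of "c \<odot>\<^bsub>A\<^esub> u" "c \<odot>\<^bsub>B\<^esub> v" "c \<odot>\<^bsub>A\<^esub> u'" "c \<odot>\<^bsub>B\<^esub> v'"] X_smult[of u' v' c]
        X_carrier[of u' v'] span_carrier[of u v]
      by (simp add: A.smult_add_right B.smult_add_right)
  qed (use span_zero in \<open>simp add: A.zero_simps B.zero_simps\<close>)
  show "(x\<^sup>\<star>\<^bsub>A\<^esub>, y\<^sup>\<star>\<^bsub>B\<^esub>) \<in> span" if "(x, y) \<in> span" for x y
    using that
  proof (induction rule: span.induct)
    case (span_step u v u' v')
    then show ?case
      using span.span_step[of "u\<^sup>\<star>\<^bsub>A\<^esub>" "v\<^sup>\<star>\<^bsub>B\<^esub>" "u'\<^sup>\<star>\<^bsub>A\<^esub>" "v'\<^sup>\<star>\<^bsub>B\<^esub>"] X_star[of u' v']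
        X_carrier[of u' v'] span_carrier[of u v]
      by (simp add: A.star_add B.star_add)
  qed (use span_zero in \<open>simp add: A.zero_simps B.zero_simps\<close>)
qed (use span_carrier span_add in auto)

end

section \<open>Compact operators\<close>

text \<open>Reduces estimates in \<open>l2\<close> to finite sections, where \<open>L2_set\<close>
  provides the Minkowski and Cauchy-Schwarz inequalities.\<close>

lemma l2I:
  assumes "\<And>n. L2_set (\<lambda>i. cmod (x i)) {..<n} \<le> c"
  shows "x \<in> l2" "l2_norm x \<le> c"
proof -
  have c: "0 \<le> c" using assms[of 0] by simp
  have le: "(\<Sum>i<n. (cmod (x i))\<^sup>2) \<le> c\<^sup>2" for n
  proof -
    have "(L2_set (\<lambda>i. cmod (x i)) {..<n})\<^sup>2 \<le> c\<^sup>2"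
      using assms[of n] by (intro power_mono) auto
    then show ?thesis by (simp add: L2_set_def sum_nonneg)
  qed
  then have s: "summable (\<lambda>i. (cmod (x i))\<^sup>2)" by (intro summableI_nonneg_bounded) auto
  then show "x \<in> l2" by (simp add: l2_def)
  have "(\<Sum>i. (cmod (x i))\<^sup>2) \<le> c\<^sup>2" using suminf_le_const[OF s le] .
  then show "l2_norm x \<le> c"
    using real_sqrt_le_mono[of "\<Sum>i. (cmod (x i))\<^sup>2" "c\<^sup>2"] c by (simp add: l2_norm_def)
qed

lemma L2_set_le_l2_norm: "x \<in> l2 \<Longrightarrow> L2_set (\<lambda>i. cmod (x i)) {..<n} \<le> l2_norm x"
  unfolding L2_set_def l2_norm_def l2_def by (intro real_sqrt_le_mono sum_le_suminf) auto

lemma l2_norm_nonneg: "x \<in> l2 \<Longrightarrow> 0 \<le> l2_norm x"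
  using L2_set_le_l2_norm[of x 0] by simp

lemma cmod_le_l2_norm: "x \<in> l2 \<Longrightarrow> cmod (x i) \<le> l2_norm x"
  using member_le_L2_set[of "{..<Suc i}" i "\<lambda>i. cmod (x i)"] L2_set_le_l2_norm[of x "Suc i"] by simp

lemma l2_mono:
  assumes "y \<in> l2" "\<And>i. cmod (x i) \<le> cmod (y i)"
  shows "x \<in> l2" "l2_norm x \<le> l2_norm y"
proof -
  have "L2_set (\<lambda>i. cmod (x i)) {..<n} \<le> l2_norm y" for n
    using L2_set_mono[of "{..<n}" "\<lambda>i. cmod (x i)" "\<lambda>i. cmod (y i)"] assms(2)
      L2_set_le_l2_norm[OF assms(1), of n] by simp
  then show "x \<in> l2" "l2_norm x \<le> l2_norm y" by (rule l2I)+
qed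

lemma l2_add:
  assumes "x \<in> l2" "y \<in> l2"
  shows "(\<lambda>i. x i + y i) \<in> l2" "l2_norm (\<lambda>i. x i + y i) \<le> l2_norm x + l2_norm y"
proof -
  have "L2_set (\<lambda>i. cmod (x i + y i)) {..<n} \<le> l2_norm x + l2_norm y" for n
  proof -
    have "L2_set (\<lambda>i. cmod (x i + y i)) {..<n} \<le> L2_set (\<lambda>i. cmod (x i) + cmod (y i)) {..<n}"
      by (intro L2_set_mono norm_triangle_ineq) auto
    also have "\<dots> \<le> L2_set (\<lambda>i. cmod (x i)) {..<n} + L2_set (\<lambda>i. cmod (y i)) {..<n}"
      by (rule L2_set_triangle_ineq)
    finally show ?thesis using L2_set_le_l2_norm assms by (meson add_mono order_trans)
  qed
  then show "(\<lambda>i. x i + y i) \<in> l2" "l2_norm (\<lambda>i. x i + y i) \<le> l2_norm x + l2_norm y"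
    by (rule l2I)+
qed

lemma l2_scale:
  assumes "x \<in> l2"
  shows "(\<lambda>i. c * x i) \<in> l2" "l2_norm (\<lambda>i. c * x i) = cmod c * l2_norm x"
  using assms unfolding l2_def l2_norm_def
  by (auto simp: norm_mult power_mult_distrib summable_mult suminf_mult real_sqrt_mult)

lemma l2_diff:
  assumes "x \<in> l2" "y \<in> l2"
  shows "(\<lambda>i. x i - y i) \<in> l2" "l2_norm (\<lambda>i. x i - y i) \<le> l2_norm x + l2_norm y"
  using l2_add[OF assms(1) l2_scale(1)[OF assms(2), of "-1"]] l2_scale(2)[OF assms(2), of "-1"]
  by simp_all

definition delta :: "nat \<Rightarrow> nat \<Rightarrow> complex" where
  "delta k = (\<lambda>i. if i = k then 1 else 0)"

lemma single_l2: "(\<lambda>i. if i = k then c else 0) \<in> l2" "l2_norm (\<lambda>i. if i = k then c else 0) = cmod c"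
proof -
  have "(\<lambda>i. (cmod (if i = k then c else 0))\<^sup>2) = (\<lambda>i. if i = k then (cmod c)\<^sup>2 else 0)" by auto
  then have "(\<lambda>i. (cmod (if i = k then c else 0))\<^sup>2) sums (cmod c)\<^sup>2"
    using sums_single[of k "\<lambda>_. (cmod c)\<^sup>2"] by simp
  then show "(\<lambda>i. if i = k then c else 0) \<in> l2" "l2_norm (\<lambda>i. if i = k then c else 0) = cmod c"
    by (auto simp: l2_def l2_norm_def sums_iff)
qed

lemma delta_l2: "delta k \<in> l2" "l2_norm (delta k) = 1"
  using single_l2[of k 1] by (simp_all add: delta_def)

lemma zero_l2: "(\<lambda>i. 0) \<in> l2" "l2_norm (\<lambda>i. 0) = 0"
  using single_l2[of 0 0] by simp_all

lemma l2_tail: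
  assumes "x \<in> l2"
  shows "(\<lambda>n. l2_norm (\<lambda>i. if i < n then 0 else x i)) \<longlonglongrightarrow> 0"
proof -
  let ?f = "\<lambda>i. (cmod (x i))\<^sup>2"
  have s: "?f sums suminf ?f" using assms by (simp add: l2_def summable_sums)
  have "l2_norm (\<lambda>i. if i < n then 0 else x i) = sqrt (suminf ?f - sum ?f {..<n})" for n
  proof -
    have "(\<lambda>i. if i \<in> {..<n} then ?f i else 0) sums sum ?f {..<n}" by (rule sums_If_finite_set) simp
    from sums_diff[OF s this] have "(\<lambda>i. (cmod (if i < n then 0 else x i))\<^sup>2) sums (suminf ?f - sum ?f {..<n})"
      by (rule back_subst[of "\<lambda>g. g sums (suminf ?f - sum ?f {..<n})"]) auto
    then show ?thesis by (simp add: l2_norm_def sums_iff)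
  qed
  moreover have "(\<lambda>n. sqrt (suminf ?f - sum ?f {..<n})) \<longlonglongrightarrow> sqrt (suminf ?f - suminf ?f)"
    using s unfolding sums_def by (intro tendsto_intros)
  ultimately show ?thesis by simp
qed

section \<open>Compact operators are norm limits of finite matrices\<close>

locale compact_op =
  fixes T :: l2_op
  assumes compact: "compact_operator T"
begin

lemma T_l2: "x \<in> l2 \<Longrightarrow> T x \<in> l2"
  using compact unfolding compact_operator_def by auto

lemma T_undefined: "x \<notin> l2 \<Longrightarrow> T x = undefined"
  using compact unfolding compact_operator_def by (auto simp: PiE_def extensional_def)

lemma T_add: "\<lbrakk>x \<in> l2; y \<in> l2\<rbrakk> \<Longrightarrow> T (\<lambda>i. x i + y i) = (\<lambda>i. T x i + T y i)"
  using compact unfolding compact_operator_def by blast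

lemma T_scale: "x \<in> l2 \<Longrightarrow> T (\<lambda>i. c * x i) = (\<lambda>i. c * T x i)"
  using compact unfolding compact_operator_def by blast

lemma T_seq:
  assumes "\<And>n :: nat. X n \<in> l2" "\<And>n. l2_norm (X n) \<le> 1"
  shows "\<exists>(r :: nat \<Rightarrow> nat) y. strict_mono r \<and> y \<in> l2 \<and>
    (\<lambda>n. l2_norm (\<lambda>i. T (X (r n)) i - y i)) \<longlonglongrightarrow> 0"
  using compact assms unfolding compact_operator_def by blast

text \<open>Otherwise unit vectors \<open>X n\<close> with \<open>T (X n)\<close> of norm above
  \<open>n\<close> exist, and no subsequence of their images can converge.\<close>

lemma bounded: "\<exists>C\<ge>0. \<forall>x\<in>l2. l2_norm x \<le> 1 \<longrightarrow> l2_norm (T x) \<le> C"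
proof (rule ccontr)
  assume "\<not> ?thesis"
  then have "\<not> (\<forall>x\<in>l2. l2_norm x \<le> 1 \<longrightarrow> l2_norm (T x) \<le> real n)" for n
    using of_nat_0_le_iff by blast
  then have "\<forall>n :: nat. \<exists>x\<in>l2. l2_norm x \<le> 1 \<and> l2_norm (T x) > real n"
    by (simp add: not_le)
  then obtain X where X: "\<And>n. X n \<in> l2" "\<And>n. l2_norm (X n) \<le> 1" "\<And>n. l2_norm (T (X n)) > real n"
    by metis
  obtain r y where r: "strict_mono r" "y \<in> l2" "(\<lambda>n. l2_norm (\<lambda>i. T (X (r n)) i - y i)) \<longlonglongrightarrow> 0"
    using T_seq[where X = X, OF X(1) X(2)] by blast
  have "\<forall>\<^sub>F n in sequentially. l2_norm (\<lambda>i. T (X (r n)) i - y i) < 1"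
    using order_tendstoD(2)[OF r(3)] by simp
  then obtain N where N: "\<And>n. n \<ge> N \<Longrightarrow> l2_norm (\<lambda>i. T (X (r n)) i - y i) < 1"
    unfolding eventually_sequentially by blast
  define n where "n = max N (nat \<lceil>l2_norm y + 1\<rceil>)"
  have n: "l2_norm (\<lambda>i. T (X (r n)) i - y i) < 1" "n \<ge> nat \<lceil>l2_norm y + 1\<rceil>"
    using N by (simp_all add: n_def)
  have "l2_norm (\<lambda>i. (T (X (r n)) i - y i) + y i) \<le> l2_norm (\<lambda>i. T (X (r n)) i - y i) + l2_norm y"
    by (intro l2_add l2_diff T_l2 X r)
  then have "l2_norm (T (X (r n))) \<le> 1 + l2_norm y" using n by simp
  moreover have "real (r n) \<ge> real n" using seq_suble[OF r(1)] by simp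
  moreover have "real n \<ge> l2_norm y + 1" using n(2) by linarith
  ultimately show False using X(3)[of "r n"] by simp
qed

lemma bounded_le: "\<exists>C\<ge>0. \<forall>x\<in>l2. l2_norm (T x) \<le> C * l2_norm x"
proof -
  obtain C where C: "C \<ge> 0" "\<And>x. x \<in> l2 \<Longrightarrow> l2_norm x \<le> 1 \<Longrightarrow> l2_norm (T x) \<le> C" using bounded by blast
  have "l2_norm (T x) \<le> C * l2_norm x" if x: "x \<in> l2" for x
  proof (cases "l2_norm x = 0")
    case True
    then have "x i = 0" for i using cmod_le_l2_norm[OF x, of i] by simp
    then have x0: "x = (\<lambda>i. 0 * x i)" by auto
    have "T x = (\<lambda>i. 0 * T x i)" using T_scale[OF x, of 0] by (subst x0) simp
    then show ?thesis using True zero_l2 by simp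
  next
    case False
    define t where "t = l2_norm x"
    have t: "t > 0" using False l2_norm_nonneg[OF x] by (simp add: t_def)
    have "l2_norm (T (\<lambda>i. complex_of_real (1 / t) * x i)) \<le> C"
      using t l2_scale[OF x, of "complex_of_real (1 / t)"] by (intro C) (simp_all add: norm_divide flip: t_def)
    then show ?thesis
      using t T_scale[OF x, of "complex_of_real (1/t)"] l2_scale(2)[OF T_l2[OF x], of "complex_of_real (1/t)"]
      by (simp add: norm_divide divide_le_eq flip: t_def)
  qed
  then show ?thesis using C by blast
qed

lemma T_cut:
  assumes "x \<in> l2"
  shows "(\<lambda>i. if i < n then x i else 0) \<in> l2"
    and "T (\<lambda>i. if i < n then x i else 0) k = (\<Sum>l<n. T (delta l) k * x l)"
proof -
  show l2: "(\<lambda>i. if i < n then x i else 0) \<in> l2" for n using l2_mono(1)[OF assms] by simp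
  show "T (\<lambda>i. if i < n then x i else 0) k = (\<Sum>l<n. T (delta l) k * x l)"
  proof (induction n)
    case 0
    then show ?case using T_scale[OF zero_l2(1), of 0] by simp
  next
    case (Suc n)
    have "(\<lambda>i. if i < Suc n then x i else 0)
        = (\<lambda>i. (if i < n then x i else 0) + x n * delta n i)" by (rule ext) (auto simp: delta_def less_Suc_eq)
    then show ?case
      using T_add[OF l2 l2_scale(1)[OF delta_l2(1)]] T_scale[OF delta_l2(1)] Suc by simp
  qed
qed

text \<open>Duality without an adjoint: testing \<open>T\<close> on the conjugate of the truncated
  \<open>k\<close>-th row gives \<open>s^2 \<le> C * s\<close>, where \<open>s\<close> is the norm
  of the truncation and \<open>C\<close> bounds \<open>T\<close>.\<close>

lemma rows_l2: "(\<lambda>l. T (delta l) k) \<in> l2"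
proof -
  obtain C where C: "C \<ge> 0" "\<And>x. x \<in> l2 \<Longrightarrow> l2_norm (T x) \<le> C * l2_norm x" using bounded_le by blast
  let ?b = "\<lambda>l. T (delta l) k"
  have "L2_set (\<lambda>l. cmod (?b l)) {..<n} \<le> C" for n
  proof -
    define s where "s = L2_set (\<lambda>l. cmod (?b l)) {..<n}"
    define x where "x l = (if l < n then cnj (?b l) else 0)" for l
    have "L2_set (\<lambda>i. cmod (x i)) {..<m} \<le> s" for m
    proof -
      have "L2_set (\<lambda>i. cmod (x i)) {..<m} = L2_set (\<lambda>l. cmod (?b l)) ({..<m} \<inter> {..<n})"
        unfolding L2_set_def by (intro arg_cong[of _ _ sqrt] sum.mono_neutral_cong_right) (auto simp: x_def)
      also have "\<dots> \<le> s"
        unfolding s_def L2_set_def by (intro real_sqrt_le_mono sum_mono2) auto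
      finally show ?thesis .
    qed
    then have x: "x \<in> l2" "l2_norm x \<le> s" by (rule l2I)+
    have "T x k = (\<Sum>l<n. ?b l * x l)"
      using T_cut(2)[OF x(1), of n k] by (simp add: x_def[abs_def] if_distrib cong: if_cong)
    also have "\<dots> = (\<Sum>l<n. complex_of_real ((cmod (?b l))\<^sup>2))"
      by (intro sum.cong refl) (simp only: x_def complex_norm_square lessThan_iff if_True)
    also have "\<dots> = complex_of_real (s\<^sup>2)" by (simp add: s_def L2_set_def sum_nonneg)
    finally have "s\<^sup>2 = cmod (T x k)" by (simp add: norm_power)
    also have "\<dots> \<le> C * l2_norm x" using cmod_le_l2_norm[OF T_l2[OF x(1)]] C(2)[OF x(1)] order_trans by blast
    also have "\<dots> \<le> C * s" using x(2) C(1) by (rule mult_left_mono)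
    finally have "s * s \<le> C * s" by (simp add: power2_eq_square)
    moreover have "s \<ge> 0" by (simp add: s_def)
    ultimately have "s \<le> C" using C(1) by (cases "s = 0") auto
    then show ?thesis by (simp add: s_def)
  qed
  then show ?thesis by (rule l2I(1))
qed

text \<open>Boundedness of \<open>T\<close> makes the coordinate a limit of finite sums over the
  row. In each of them only row entries from \<open>N\<close> on meet nonzero entries of
  \<open>x\<close>, and Cauchy-Schwarz applies.\<close>

lemma coordinate_tail:
  assumes x: "x \<in> l2" "\<And>l. l < N \<Longrightarrow> x l = 0"
  shows "cmod (T x k) \<le> l2_norm (\<lambda>l. if l < N then 0 else T (delta l) k) * l2_norm x"
proof -
  let ?b = "\<lambda>l. if l < N then 0 else T (delta l) k"
  have b: "?b \<in> l2" using l2_mono(1)[OF rows_l2[of k]] by simp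
  obtain C where C: "C \<ge> 0" "\<And>x. x \<in> l2 \<Longrightarrow> l2_norm (T x) \<le> C * l2_norm x" using bounded_le by blast
  have "cmod (\<Sum>l<n. T (delta l) k * x l) \<le> l2_norm ?b * l2_norm x" for n
  proof -
    have "cmod (\<Sum>l<n. T (delta l) k * x l) \<le> (\<Sum>l<n. cmod (?b l) * cmod (x l))"
      using x(2) by (intro sum_norm_le) (auto simp: norm_mult)
    also have "\<dots> \<le> L2_set (\<lambda>l. cmod (?b l)) {..<n} * L2_set (\<lambda>l. cmod (x l)) {..<n}"
      using L2_set_mult_ineq[of "\<lambda>l. cmod (?b l)" "\<lambda>l. cmod (x l)" "{..<n}"] by simp
    also have "\<dots> \<le> l2_norm ?b * l2_norm x"
      by (intro mult_mono L2_set_le_l2_norm b x l2_norm_nonneg) auto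
    finally show ?thesis .
  qed
  moreover have "(\<lambda>n. \<Sum>l<n. T (delta l) k * x l) \<longlonglongrightarrow> T x k"
  proof (rule Lim_null[THEN iffD2], rule Lim_null_comparison)
    show "(\<lambda>n. C * l2_norm (\<lambda>i. if i < n then 0 else x i)) \<longlonglongrightarrow> 0"
      using tendsto_mult_right_zero[OF l2_tail[OF x(1)]] .
    have "cmod ((\<Sum>l<n. T (delta l) k * x l) - T x k) \<le> C * l2_norm (\<lambda>i. if i < n then 0 else x i)" for n
    proof -
      let ?t = "\<lambda>i. if i < n then 0 else x i"
      have t: "?t \<in> l2" using l2_mono(1)[OF x(1)] by simp
      have "T x = T (\<lambda>i. (if i < n then x i else 0) + ?t i)"
        by (rule arg_cong[of _ _ T]) auto
      then have "T x k = (\<Sum>l<n. T (delta l) k * x l) + T ?t k"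
        using T_add[OF T_cut(1)[OF x(1)] t] T_cut(2)[OF x(1)] by simp
      then have "cmod ((\<Sum>l<n. T (delta l) k * x l) - T x k) = cmod (T ?t k)" by simp
      then show ?thesis using cmod_le_l2_norm[OF T_l2[OF t], of k] C(2)[OF t] by simp
    qed
    then show "\<forall>\<^sub>F n in sequentially. norm ((\<Sum>l<n. T (delta l) k * x l) - T x k)
        \<le> C * l2_norm (\<lambda>i. if i < n then 0 else x i)" by simp
  qed
  ultimately show ?thesis
    using LIMSEQ_le_const2[OF tendsto_norm] by blast
qed

text \<open>This is where compactness enters: the image of the unit ball has uniformly small tails.
  A sequence of counterexamples would have images converging along a subsequence to some
  \<open>y\<close>, whose own tails vanish.\<close>

lemma image_tail:
  assumes e: "\<epsilon> > 0"
  shows "\<exists>N. \<forall>x\<in>l2. l2_norm x \<le> 1 \<longrightarrow> l2_norm (\<lambda>i. if i < N then 0 else T x i) \<le> \<epsilon>"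
proof (rule ccontr)
  assume "\<not> ?thesis"
  then have "\<forall>N. \<exists>x\<in>l2. l2_norm x \<le> 1 \<and> l2_norm (\<lambda>i. if i < N then 0 else T x i) > \<epsilon>"
    by (meson not_le)
  then obtain X where X: "\<And>N. X N \<in> l2" "\<And>N. l2_norm (X N) \<le> 1"
      "\<And>N. l2_norm (\<lambda>i. if i < N then 0 else T (X N) i) > \<epsilon>" by metis
  obtain r y where r: "strict_mono r" "y \<in> l2" "(\<lambda>n. l2_norm (\<lambda>i. T (X (r n)) i - y i)) \<longlonglongrightarrow> 0"
    using T_seq[where X = X, OF X(1) X(2)] by blast
  \<comment> \<open>The tail is cut at \<open>r n\<close>, not at \<open>n\<close>, since
    \<open>X (r n)\<close> was chosen to violate the bound at exactly that position.\<close>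
  let ?g = "\<lambda>n. l2_norm (\<lambda>i. T (X (r n)) i - y i) + l2_norm (\<lambda>i. if i < r n then 0 else y i)"
  have "(\<lambda>n. l2_norm (\<lambda>i. if i < r n then 0 else y i)) \<longlonglongrightarrow> 0"
    using LIMSEQ_subseq_LIMSEQ[OF l2_tail[OF r(2)] r(1)] by (simp add: o_def)
  then have "?g \<longlonglongrightarrow> 0" using tendsto_add[OF r(3)] by fastforce
  then have "\<forall>\<^sub>F n in sequentially. ?g n < \<epsilon>" using order_tendstoD(2) e by blast
  then obtain n where n: "?g n < \<epsilon>" unfolding eventually_sequentially by blast
  let ?d = "\<lambda>i. T (X (r n)) i - y i"
  have d: "?d \<in> l2" by (intro l2_diff T_l2 X r)
  have "l2_norm (\<lambda>i. (if i < r n then 0 else ?d i) + (if i < r n then 0 else y i))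
      \<le> l2_norm (\<lambda>i. if i < r n then 0 else ?d i) + l2_norm (\<lambda>i. if i < r n then 0 else y i)"
    by (intro l2_add l2_mono(1)[OF d] l2_mono(1)[OF r(2)]) auto
  moreover have "l2_norm (\<lambda>i. if i < r n then 0 else ?d i) \<le> l2_norm ?d"
    by (intro l2_mono(2)[OF d]) auto
  moreover have "(\<lambda>i. (if i < r n then 0 else ?d i) + (if i < r n then 0 else y i))
      = (\<lambda>i. if i < r n then 0 else T (X (r n)) i)" by auto
  ultimately show False using n X(3)[of "r n"] by simp
qed

text \<open>Rows are cut first, by uniform smallness of the image tails. Only finitely many rows
  remain, and each is square summable, so one common column cut serves them all.\<close>

lemma finite_matrix_approx:
  assumes e: "\<epsilon> > 0"
  shows "\<exists>N M. \<forall>x\<in>l2. l2_norm x \<le> 1 \<longrightarrow>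
    l2_norm (\<lambda>i. T x i - (if i < N then \<Sum>l<M. T (delta l) i * x l else 0)) \<le> \<epsilon>"
proof -
  obtain N where N: "\<And>x. x \<in> l2 \<Longrightarrow> l2_norm x \<le> 1 \<Longrightarrow> l2_norm (\<lambda>i. if i < N then 0 else T x i) \<le> \<epsilon> / 2"
    using image_tail[OF half_gt_zero[OF e]] by blast
  \<comment> \<open>Half of \<epsilon> is shared among the at most \<open>N\<close> remaining
    coordinates; \<open>Suc N\<close> keeps the share positive when \<open>N = 0\<close>.\<close>
  have e': "\<epsilon> / 2 / real (Suc N) > 0" using e by simp
  have "\<exists>M. \<forall>m\<ge>M. l2_norm (\<lambda>l. if l < m then 0 else T (delta l) k) < \<epsilon> / 2 / real (Suc N)" for k
    using order_tendstoD(2)[OF l2_tail[OF rows_l2[of k]] e'] unfolding eventually_sequentially .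
  then obtain M where M: "\<And>k m. m \<ge> M k \<Longrightarrow> l2_norm (\<lambda>l. if l < m then 0 else T (delta l) k) < \<epsilon> / 2 / real (Suc N)"
    by metis
  define m where "m = Max (M ` {..N})"
  have m: "M k \<le> m" if "k < N" for k using that by (auto simp: m_def intro!: Max_ge)
  have "l2_norm (\<lambda>i. T x i - (if i < N then \<Sum>l<m. T (delta l) i * x l else 0)) \<le> \<epsilon>"
    if x: "x \<in> l2" "l2_norm x \<le> 1" for x
  proof -
    let ?t = "\<lambda>i. if i < m then 0 else x i"
    have c: "cmod (?t i) \<le> cmod (x i)" for i by simp
    have t: "?t \<in> l2" "l2_norm ?t \<le> 1"
      using l2_mono[OF x(1) c] x(2) by (blast intro: order_trans)+
    have "T x = T (\<lambda>i. (if i < m then x i else 0) + ?t i)"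
      by (rule arg_cong[of _ _ T]) auto
    then have Tx: "T x k = (\<Sum>l<m. T (delta l) k * x l) + T ?t k" for k
      using T_add[OF T_cut(1)[OF x(1)] t(1)] T_cut(2)[OF x(1)] by simp
    let ?u = "\<lambda>i. if i < N then T ?t i else 0"
    let ?v = "\<lambda>i. if i < N then 0 else T x i"
    have u: "?u \<in> l2" using l2_mono(1)[OF T_l2[OF t(1)], of ?u] by simp
    have v: "?v \<in> l2" using l2_mono(1)[OF T_l2[OF x(1)], of ?v] by simp
    have uk: "cmod (?u k) \<le> \<epsilon> / 2 / real (Suc N)" for k
    proof (cases "k < N")
      case True
      have "cmod (T ?t k) \<le> l2_norm (\<lambda>l. if l < m then 0 else T (delta l) k) * l2_norm ?t"
        by (rule coordinate_tail) (use t in auto)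
      also have "\<dots> \<le> l2_norm (\<lambda>l. if l < m then 0 else T (delta l) k) * 1"
        using t(2) l2_mono(1)[OF rows_l2[of k]] by (intro mult_left_mono l2_norm_nonneg) auto
      finally show ?thesis using M[OF m[OF True]] True by simp
    qed (use e in simp)
    have "L2_set (\<lambda>i. cmod (?u i)) {..<n} \<le> \<epsilon> / 2" for n
    proof -
      have "L2_set (\<lambda>i. cmod (?u i)) {..<n} \<le> (\<Sum>i<n. cmod (?u i))"
        using L2_set_le_sum_abs[of "\<lambda>i. cmod (?u i)" "{..<n}"] by simp
      also have "\<dots> = (\<Sum>i\<in>{..<n} \<inter> {..<N}. cmod (?u i))"
        by (intro sum.mono_neutral_right) auto
      also have "\<dots> \<le> real (card ({..<n} \<inter> {..<N})) * (\<epsilon> / 2 / real (Suc N))"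
        by (rule sum_bounded_above) (rule uk)
      also have "\<dots> \<le> real (Suc N) * (\<epsilon> / 2 / real (Suc N))"
        using e' card_mono[of "{..<N}" "{..<n} \<inter> {..<N}"] by (intro mult_right_mono) auto
      also have "\<dots> = \<epsilon> / 2" by (simp del: of_nat_Suc)
      finally show ?thesis .
    qed
    then have "l2_norm ?u \<le> \<epsilon> / 2" by (rule l2I)
    moreover have "l2_norm (\<lambda>i. ?u i + ?v i) \<le> l2_norm ?u + l2_norm ?v" by (rule l2_add[OF u v])
    moreover have "(\<lambda>i. T x i - (if i < N then \<Sum>l<m. T (delta l) i * x l else 0)) = (\<lambda>i. ?u i + ?v i)"
      by (auto simp: Tx)
    ultimately show ?thesis using N[OF x] by simp
  qed
  then show ?thesis by blast
qed

end

section \<open>Operations and matrix units in the algebra of compact operators\<close>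

lemma K_simps:
  "T \<in> carrier \<K> \<longleftrightarrow> compact_operator T"
  "S \<otimes>\<^bsub>\<K>\<^esub> T = compose l2 S T"
  "\<zero>\<^bsub>\<K>\<^esub> = (\<lambda>x\<in>l2. \<lambda>i. 0)"
  "S \<oplus>\<^bsub>\<K>\<^esub> T = (\<lambda>x\<in>l2. \<lambda>i. S x i + T x i)"
  "c \<odot>\<^bsub>\<K>\<^esub> T = (\<lambda>x\<in>l2. \<lambda>i. c * T x i)"
  "T\<^sup>\<star>\<^bsub>\<K>\<^esub> = l2_adjoint T"
  "\<parallel>T\<parallel>\<^bsub>\<K>\<^esub> = l2_op_norm T"
  by (simp_all add: compact_operators_def)

lemma compact_operatorI:
  assumes "\<And>x. x \<in> l2 \<Longrightarrow> f x \<in> l2"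
    and "\<And>x y. x \<in> l2 \<Longrightarrow> y \<in> l2 \<Longrightarrow> f (\<lambda>i. x i + y i) = (\<lambda>i. f x i + f y i)"
    and "\<And>c x. x \<in> l2 \<Longrightarrow> f (\<lambda>i. c * x i) = (\<lambda>i. c * f x i)"
    and "\<And>X :: nat \<Rightarrow> nat \<Rightarrow> complex. (\<And>n. X n \<in> l2) \<Longrightarrow> (\<And>n. l2_norm (X n) \<le> 1) \<Longrightarrow>
      \<exists>(r :: nat \<Rightarrow> nat) y. strict_mono r \<and> y \<in> l2 \<and> (\<lambda>n. l2_norm (\<lambda>i. f (X (r n)) i - y i)) \<longlonglongrightarrow> 0"
  shows "compact_operator (restrict f l2)"
proof -
  have "\<exists>(r :: nat \<Rightarrow> nat) y. strict_mono r \<and> y \<in> l2 \<and>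
      (\<lambda>n. l2_norm (\<lambda>i. restrict f l2 (X (r n)) i - y i)) \<longlonglongrightarrow> 0"
    if X: "\<forall>n. X n \<in> l2 \<and> l2_norm (X n) \<le> 1" for X :: "nat \<Rightarrow> nat \<Rightarrow> complex"
    using assms(4)[of X] X by simp
  then show ?thesis
    unfolding compact_operator_def using assms(1-3) by (simp add: l2_add l2_scale)
qed

text \<open>A subsequence for \<open>S\<close> is refined to one for \<open>T\<close>; along the
  refinement both images converge.\<close>

lemma compact_operator_add:
  assumes "compact_operator S" "compact_operator T"
  shows "compact_operator (S \<oplus>\<^bsub>\<K>\<^esub> T)"
  unfolding K_simps
proof (rule compact_operatorI)
  interpret S: compact_op S by unfold_locales fact
  interpret T: compact_op T by unfold_locales fact
  fix X :: "nat \<Rightarrow> nat \<Rightarrow> complex"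
  assume X: "\<And>n. X n \<in> l2" "\<And>n. l2_norm (X n) \<le> 1"
  obtain r y where r: "strict_mono r" "y \<in> l2" "(\<lambda>n. l2_norm (\<lambda>i. S (X (r n)) i - y i)) \<longlonglongrightarrow> 0"
    using S.T_seq[where X = X, OF X(1) X(2)] by blast
  obtain r' y' where r': "strict_mono r'" "y' \<in> l2" "(\<lambda>n. l2_norm (\<lambda>i. T (X (r (r' n))) i - y' i)) \<longlonglongrightarrow> 0"
    using T.T_seq[where X = "\<lambda>n. X (r n)", OF X(1) X(2)] by blast
  have *: "(\<lambda>n. l2_norm (\<lambda>i. S (X (r (r' n))) i - y i)) \<longlonglongrightarrow> 0"
    using LIMSEQ_subseq_LIMSEQ[OF r(3) r'(1)] by (simp add: o_def)
  have "(\<lambda>n. l2_norm (\<lambda>i. (S (X (r (r' n))) i + T (X (r (r' n))) i) - (y i + y' i))) \<longlonglongrightarrow> 0"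
  proof (rule Lim_null_comparison)
    show "(\<lambda>n. l2_norm (\<lambda>i. S (X (r (r' n))) i - y i) + l2_norm (\<lambda>i. T (X (r (r' n))) i - y' i)) \<longlonglongrightarrow> 0"
      using tendsto_add[OF * r'(3)] by simp
    have "norm (l2_norm (\<lambda>i. (S (X (r (r' n))) i + T (X (r (r' n))) i) - (y i + y' i)))
        \<le> l2_norm (\<lambda>i. S (X (r (r' n))) i - y i) + l2_norm (\<lambda>i. T (X (r (r' n))) i - y' i)" for n
    proof -
      have 1: "(\<lambda>i. S (X (r (r' n))) i - y i) \<in> l2" "(\<lambda>i. T (X (r (r' n))) i - y' i) \<in> l2"
        using X r r' by (auto intro!: l2_diff S.T_l2 T.T_l2)
      show ?thesis
        using l2_add[OF 1] l2_norm_nonneg[OF l2_add(1)[OF 1]] by (simp add: algebra_simps)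
    qed
    then show "\<forall>\<^sub>F n in sequentially. norm (l2_norm (\<lambda>i. (S (X (r (r' n))) i + T (X (r (r' n))) i) - (y i + y' i)))
        \<le> l2_norm (\<lambda>i. S (X (r (r' n))) i - y i) + l2_norm (\<lambda>i. T (X (r (r' n))) i - y' i)" by simp
  qed
  then show "\<exists>r z. strict_mono r \<and> z \<in> l2 \<and>
      (\<lambda>n. l2_norm (\<lambda>i. (S (X (r n)) i + T (X (r n)) i) - z i)) \<longlonglongrightarrow> 0"
    using strict_mono_o[OF r(1) r'(1)] l2_add(1)[OF r(2) r'(2)]
    by (intro exI[of _ "r \<circ> r'"] exI[of _ "\<lambda>i. y i + y' i"]) simp
qed (use assms in \<open>simp_all add: compact_op.T_l2 compact_op.T_add compact_op.T_scale l2_add compact_op_def algebra_simps\<close>)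

lemma compact_operator_smult:
  assumes "compact_operator T"
  shows "compact_operator (c \<odot>\<^bsub>\<K>\<^esub> T)"
  unfolding K_simps
proof (rule compact_operatorI)
  interpret T: compact_op T by unfold_locales fact
  fix X :: "nat \<Rightarrow> nat \<Rightarrow> complex"
  assume X: "\<And>n. X n \<in> l2" "\<And>n. l2_norm (X n) \<le> 1"
  obtain r y where r: "strict_mono r" "y \<in> l2" "(\<lambda>n. l2_norm (\<lambda>i. T (X (r n)) i - y i)) \<longlonglongrightarrow> 0"
    using T.T_seq[where X = X, OF X(1) X(2)] by blast
  have "l2_norm (\<lambda>i. c * T (X (r n)) i - c * y i) = cmod c * l2_norm (\<lambda>i. T (X (r n)) i - y i)" for n
    using l2_scale(2)[of "\<lambda>i. T (X (r n)) i - y i" c] X r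
    by (simp add: l2_diff T.T_l2 right_diff_distrib)
  then have "(\<lambda>n. l2_norm (\<lambda>i. c * T (X (r n)) i - c * y i)) \<longlonglongrightarrow> 0"
    using tendsto_mult_right_zero[OF r(3)] by simp
  then show "\<exists>r z. strict_mono r \<and> z \<in> l2 \<and> (\<lambda>n. l2_norm (\<lambda>i. c * T (X (r n)) i - z i)) \<longlonglongrightarrow> 0"
    using r l2_scale(1)[OF r(2)] by blast
qed (use assms in \<open>simp_all add: compact_op.T_l2 compact_op.T_add compact_op.T_scale l2_scale compact_op_def algebra_simps\<close>)

lemma l2_op_norm_le:
  assumes "\<And>x. x \<in> l2 \<Longrightarrow> l2_norm x \<le> 1 \<Longrightarrow> l2_norm (T x) \<le> c"
  shows "l2_op_norm T \<le> c"
  unfolding l2_op_norm_def by (rule cSUP_least) (use assms zero_l2 in auto)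

definition matrix_unit :: "nat \<Rightarrow> nat \<Rightarrow> l2_op" where
  "matrix_unit i j = (\<lambda>x\<in>l2. \<lambda>k. if k = i then x j else 0)"

lemma matrix_unit_apply: "x \<in> l2 \<Longrightarrow> matrix_unit i j x = (\<lambda>k. if k = i then x j else 0)"
  by (simp add: matrix_unit_def)

text \<open>The image is one-dimensional, so compactness is Bolzano-Weierstrass for the bounded
  scalar sequence of \<open>j\<close>-th coordinates.\<close>

lemma matrix_unit_carrier: "matrix_unit i j \<in> carrier \<K>"
  unfolding K_simps matrix_unit_def
proof (rule compact_operatorI)
  fix X :: "nat \<Rightarrow> nat \<Rightarrow> complex"
  assume X: "\<And>n. X n \<in> l2" "\<And>n. l2_norm (X n) \<le> 1"
  have "cmod (X n j) \<le> 1" for n using cmod_le_l2_norm[OF X(1), of n j] X(2)[of n] by simp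
  then have "bounded (range (\<lambda>n. X n j))" by (auto simp: bounded_iff)
  then obtain l r where r: "strict_mono r" "((\<lambda>n. X n j) \<circ> r) \<longlonglongrightarrow> l"
    using bounded_imp_convergent_subsequence by blast
  have "l2_norm (\<lambda>i'. (if i' = i then X (r n) j else 0) - (if i' = i then l else 0)) = cmod (X (r n) j - l)" for n
    using single_l2(2)[of i "X (r n) j - l"] by (simp add: if_distrib cong: if_cong)
  moreover have "(\<lambda>n. cmod (X (r n) j - l)) \<longlonglongrightarrow> 0"
    using r(2) by (simp add: o_def LIM_zero_iff tendsto_norm_zero_iff)
  ultimately have "(\<lambda>n. l2_norm (\<lambda>i'. (if i' = i then X (r n) j else 0) - (if i' = i then l else 0))) \<longlonglongrightarrow> 0"
    by simp
  then show "\<exists>r y. strict_mono r \<and> y \<in> l2 \<and>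
      (\<lambda>n. l2_norm (\<lambda>i'. (if i' = i then X (r n) j else 0) - y i')) \<longlonglongrightarrow> 0"
    using r(1) single_l2(1)[of i l] by blast
qed (auto simp: single_l2)

lemma matrix_unit_mult:
  "matrix_unit i j \<otimes>\<^bsub>\<K>\<^esub> matrix_unit k l = (if j = k then matrix_unit i l else \<zero>\<^bsub>\<K>\<^esub>)"
  unfolding K_simps
  by (rule ext) (auto simp: compose_def matrix_unit_def single_l2 fun_eq_iff restrict_def)

text \<open>The tensor product is known to respect scalar multiples; writing zero as a multiple by 0
  shows that tensoring with it gives zero.\<close>

lemma zero_K_eq_smult: "\<zero>\<^bsub>\<K>\<^esub> = 0 \<odot>\<^bsub>\<K>\<^esub> T"
  unfolding K_simps by (rule ext) (simp add: restrict_def)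

lemma l2_inner_single:
  "l2_inner (\<lambda>k. if k = i then c else 0) y = cnj c * y i"
  "l2_inner y (\<lambda>k. if k = i then c else 0) = cnj (y i) * c"
proof -
  have "(\<lambda>k. cnj (if k = i then c else 0) * y k) = (\<lambda>k. if k = i then cnj c * y k else 0)"
    "(\<lambda>k. cnj (y k) * (if k = i then c else 0)) = (\<lambda>k. if k = i then cnj (y k) * c else 0)" by auto
  then show "l2_inner (\<lambda>k. if k = i then c else 0) y = cnj c * y i"
    "l2_inner y (\<lambda>k. if k = i then c else 0) = cnj (y i) * c"
    using sums_single[of i "\<lambda>k. cnj c * y k"] sums_single[of i "\<lambda>k. cnj (y k) * c"]
    by (auto simp: l2_inner_def sums_iff)
qed

text \<open>The adjoint is a definite description, so uniqueness is part of the claim. Inner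
  products with \<open>delta k\<close> recover every coordinate on \<open>l2\<close>, and
  extensionality settles the remaining arguments.\<close>

lemma matrix_unit_star: "(matrix_unit i j)\<^sup>\<star>\<^bsub>\<K>\<^esub> = matrix_unit j i"
  unfolding K_simps l2_adjoint_def
proof (rule the_equality)
  show 1: "matrix_unit j i \<in> l2 \<rightarrow>\<^sub>E l2 \<and>
      (\<forall>x\<in>l2. \<forall>y\<in>l2. l2_inner (matrix_unit i j x) y = l2_inner x (matrix_unit j i y))"
    by (auto simp: matrix_unit_def single_l2 l2_inner_single)
  fix S assume S: "S \<in> l2 \<rightarrow>\<^sub>E l2 \<and> (\<forall>x\<in>l2. \<forall>y\<in>l2. l2_inner (matrix_unit i j x) y = l2_inner x (S y))"
  show "S = matrix_unit j i"
  proof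
    fix y
    show "S y = matrix_unit j i y"
    proof (cases "y \<in> l2")
      case True
      have "l2_inner (delta k) (S y) = l2_inner (delta k) (matrix_unit j i y)" for k
        using S 1 True delta_l2(1) by metis
      then show ?thesis by (auto simp: delta_def l2_inner_single)
    next
      case False
      then show ?thesis using S by (auto simp: matrix_unit_def PiE_def extensional_def)
    qed
  qed
qed

lemma matrix_unit_norm: "\<parallel>matrix_unit i j\<parallel>\<^bsub>\<K>\<^esub> = 1"
  unfolding K_simps
proof (rule antisym)
  have le: "l2_norm (matrix_unit i j x) \<le> 1" if "x \<in> l2" "l2_norm x \<le> 1" for x
    using cmod_le_l2_norm[OF that(1), of j] that by (simp add: matrix_unit_apply single_l2)
  then show "l2_op_norm (matrix_unit i j) \<le> 1" by (rule l2_op_norm_le)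
  have "l2_norm (matrix_unit i j (delta j)) \<le> l2_op_norm (matrix_unit i j)"
    unfolding l2_op_norm_def
    by (rule cSUP_upper) (use delta_l2 le in \<open>auto intro!: bdd_aboveI[of _ 1]\<close>)
  then show "1 \<le> l2_op_norm (matrix_unit i j)"
    by (simp add: matrix_unit_apply delta_l2) (simp add: delta_def single_l2)
qed

text \<open>\<open>\<Phi>\<close> stands for the operators with a property to be proved; the matrix
  is built up by adding one entry at a time, starting from a zero multiple of a matrix unit.\<close>

lemma finite_matrix_induct:
  fixes I :: "(nat \<times> nat) set"
  assumes I: "finite I" and unit: "\<And>c i j. c \<odot>\<^bsub>\<K>\<^esub> matrix_unit i j \<in> \<Phi>"
    and add: "\<And>S T. S \<in> \<Phi> \<Longrightarrow> T \<in> \<Phi> \<Longrightarrow> S \<oplus>\<^bsub>\<K>\<^esub> T \<in> \<Phi>"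
  shows "(\<lambda>x\<in>l2. \<lambda>i. \<Sum>(k, l)\<in>I. if i = k then m k l * x l else 0) \<in> \<Phi>"
  using I
proof (induction I rule: finite_induct)
  case empty
  then show ?case using unit[of 0 0 0] zero_K_eq_smult[of "matrix_unit 0 0"] by (simp add: K_simps restrict_def)
next
  case (insert p I)
  obtain k l where p: "p = (k, l)" by (cases p)
  have eq: "(\<lambda>x\<in>l2. \<lambda>i. \<Sum>(k, l)\<in>insert p I. if i = k then m k l * x l else 0)
      = m k l \<odot>\<^bsub>\<K>\<^esub> matrix_unit k l \<oplus>\<^bsub>\<K>\<^esub> (\<lambda>x\<in>l2. \<lambda>i. \<Sum>(k, l)\<in>I. if i = k then m k l * x l else 0)"
    unfolding K_simps
    by (rule ext) (use insert in \<open>auto simp: p restrict_def matrix_unit_apply fun_eq_iff\<close>)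
  show ?case unfolding eq by (rule add[OF unit insert.IH])
qed

text \<open>The error appears as a summand \<open>D\<close> instead of inside a difference. This
  avoids subtraction in \<open>\<K>\<close> and lets \<open>tensor_add_right\<close> split an
  elementary tensor.\<close>

lemma compact_approx:
  assumes T: "T \<in> carrier \<K>" and e: "\<epsilon> > 0"
    and unit: "\<And>c i j. c \<odot>\<^bsub>\<K>\<^esub> matrix_unit i j \<in> \<Phi>"
    and add: "\<And>S T. S \<in> \<Phi> \<Longrightarrow> T \<in> \<Phi> \<Longrightarrow> S \<oplus>\<^bsub>\<K>\<^esub> T \<in> \<Phi>"
    and carrier: "\<Phi> \<subseteq> carrier \<K>"
  shows "\<exists>F\<in>\<Phi>. \<exists>D\<in>carrier \<K>. T = F \<oplus>\<^bsub>\<K>\<^esub> D \<and> \<parallel>D\<parallel>\<^bsub>\<K>\<^esub> \<le> \<epsilon>"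
proof -
  interpret T: compact_op T by unfold_locales (use T in \<open>simp add: K_simps\<close>)
  obtain N M where NM: "\<And>x. x \<in> l2 \<Longrightarrow> l2_norm x \<le> 1 \<Longrightarrow>
      l2_norm (\<lambda>i. T x i - (if i < N then \<Sum>l<M. T (delta l) i * x l else 0)) \<le> \<epsilon>"
    using T.finite_matrix_approx[OF e] by blast
  define F where "F = (\<lambda>x\<in>l2. \<lambda>i. \<Sum>(k, l)\<in>{..<N} \<times> {..<M}. if i = k then T (delta l) k * x l else 0)"
  have F: "F \<in> \<Phi>" unfolding F_def by (rule finite_matrix_induct[OF _ unit add]) auto
  have Fx: "F x i = (if i < N then \<Sum>l<M. T (delta l) i * x l else 0)" if "x \<in> l2" for x i
  proof -
    have "F x i = (\<Sum>k<N. \<Sum>l<M. if i = k then T (delta l) k * x l else 0)"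
      using that by (simp add: F_def sum.cartesian_product)
    also have "\<dots> = (\<Sum>k<N. if i = k then \<Sum>l<M. T (delta l) k * x l else 0)"
      by (intro sum.cong) auto
    finally show ?thesis by simp
  qed
  define D where "D = T \<oplus>\<^bsub>\<K>\<^esub> (-1) \<odot>\<^bsub>\<K>\<^esub> F"
  have D: "D \<in> carrier \<K>"
    using F carrier T unfolding D_def K_simps(1)
    by (intro compact_operator_add compact_operator_smult) (auto simp flip: K_simps(1))
  have Dx: "D x = (\<lambda>i. T x i - F x i)" if "x \<in> l2" for x
    using that by (simp add: D_def K_simps)
  have "T = F \<oplus>\<^bsub>\<K>\<^esub> D"
    unfolding K_simps by (rule ext) (auto simp: restrict_def Dx T.T_undefined)
  moreover have "\<parallel>D\<parallel>\<^bsub>\<K>\<^esub> \<le> \<epsilon>"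
    unfolding K_simps by (rule l2_op_norm_le) (use NM in \<open>simp add: Dx Fx\<close>)
  ultimately show ?thesis using F D by blast
qed

section \<open>Cuntz-Krieger families\<close>

locale ck_digraph = cstar_algebra A + wf_digraph G
  for A :: "('a, 'm) cstar_scheme" (structure) and G :: "('v, 'e) pre_digraph" +
  fixes p :: "'v \<Rightarrow> 'a" and s :: "'e \<Rightarrow> 'a"
  assumes ck: "ck_family G A p s"
begin

lemma p_closed [simp]: "v \<in> verts G \<Longrightarrow> p v \<in> carrier A"
  and p_star: "v \<in> verts G \<Longrightarrow> (p v)\<^sup>\<star> = p v"
  and p_idem: "v \<in> verts G \<Longrightarrow> p v \<otimes> p v = p v"
  using ck unfolding ck_family_def projection_def by simp_all

lemma p_orth: "\<lbrakk>v \<in> verts G; w \<in> verts G; v \<noteq> w\<rbrakk> \<Longrightarrow> p v \<otimes> p w = \<zero>"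
  using ck unfolding ck_family_def projection_orth_def by simp

lemma p_mult: "\<lbrakk>v \<in> verts G; w \<in> verts G\<rbrakk> \<Longrightarrow> p v \<otimes> p w = (if v = w then p v else \<zero>)"
  by (simp add: p_orth p_idem)

lemma s_closed [simp]: "e \<in> arcs G \<Longrightarrow> s e \<in> carrier A"
  and s_star_s: "e \<in> arcs G \<Longrightarrow> (s e)\<^sup>\<star> \<otimes> s e = p (head G e)"
  and s_partial: "e \<in> arcs G \<Longrightarrow> s e \<otimes> (s e)\<^sup>\<star> \<otimes> s e = s e"
  and p_tail_range: "e \<in> arcs G \<Longrightarrow> p (tail G e) \<otimes> (s e \<otimes> (s e)\<^sup>\<star>) = s e \<otimes> (s e)\<^sup>\<star>"
  and range_p_tail: "e \<in> arcs G \<Longrightarrow> (s e \<otimes> (s e)\<^sup>\<star>) \<otimes> p (tail G e) = s e \<otimes> (s e)\<^sup>\<star>"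
  using ck unfolding ck_family_def partial_isometry_def projection_le_def by simp_all

lemma s_orth: "\<lbrakk>e \<in> arcs G; f \<in> arcs G; e \<noteq> f\<rbrakk>
    \<Longrightarrow> (s e \<otimes> (s e)\<^sup>\<star>) \<otimes> (s f \<otimes> (s f)\<^sup>\<star>) = \<zero>"
  using ck unfolding ck_family_def projection_orth_def by simp

lemma p_eq_sum: "\<lbrakk>v \<in> verts G; \<not> singular_vertex G v\<rbrakk>
    \<Longrightarrow> p v = (\<Oplus>e\<in>out_arcs G v. s e \<otimes> (s e)\<^sup>\<star>)"
  using ck unfolding ck_family_def by simp

lemma s_head: "e \<in> arcs G \<Longrightarrow> s e \<otimes> p (head G e) = s e"
  using s_partial[of e] s_star_s[of e] by (simp add: mult_assoc)

lemma s_tail: "e \<in> arcs G \<Longrightarrow> p (tail G e) \<otimes> s e = s e"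
proof -
  assume e: "e \<in> arcs G"
  have "p (tail G e) \<otimes> s e = p (tail G e) \<otimes> (s e \<otimes> (s e)\<^sup>\<star> \<otimes> s e)"
    using e by (simp add: s_partial)
  also have "\<dots> = (p (tail G e) \<otimes> (s e \<otimes> (s e)\<^sup>\<star>)) \<otimes> s e"
    using e by (simp add: mult_assoc)
  finally show ?thesis using e by (simp only: p_tail_range s_partial)
qed

lemma p_norm_le: "v \<in> verts G \<Longrightarrow> \<parallel>p v\<parallel> \<le> 1"
proof -
  assume v: "v \<in> verts G"
  have "\<parallel>p v\<parallel> * \<parallel>p v\<parallel> = \<parallel>p v\<parallel>"
    using norm_star_mult[of "p v"] v by (simp add: p_star p_idem power2_eq_square)
  then show ?thesis by (cases "\<parallel>p v\<parallel> = 0") auto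
qed

end

text \<open>The hypothesis \<open>out\<close> says that the image of a vertex emits exactly the
  images of its edges. Hence singularity agrees on both sides and the summation relations are the
  same up to reindexing. It serves both for relabelling a graph and for finding \<open>G\<close>
  inside \<open>head_graph G\<close>.\<close>

lemma ck_family_pullback:
  assumes B: "cstar_algebra B" and G: "wf_digraph G" and H: "wf_digraph H" and ck: "ck_family H B q t"
    and f: "inj_on f (verts G)" "f ` verts G \<subseteq> verts H" and g: "inj_on g (arcs G)" "g ` arcs G \<subseteq> arcs H"
    and ends: "\<And>e. e \<in> arcs G \<Longrightarrow> tail H (g e) = f (tail G e)"
      "\<And>e. e \<in> arcs G \<Longrightarrow> head H (g e) = f (head G e)"
    and out: "\<And>v. v \<in> verts G \<Longrightarrow> out_arcs H (f v) = g ` out_arcs G v"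
  shows "ck_family G B (q \<circ> f) (t \<circ> g)"
proof -
  interpret H: ck_digraph B H q t
    using B H ck by (simp add: ck_digraph_def ck_digraph_axioms_def)
  interpret G: wf_digraph G by (rule G)
  have fv: "f v \<in> verts H" if "v \<in> verts G" for v using that f by auto
  have ge: "g e \<in> arcs H" if "e \<in> arcs G" for e using that g by auto
  have inj: "inj_on g (out_arcs G v)" for v using inj_on_subset[OF g(1)] by (auto simp: out_arcs_def)
  have sing: "singular_vertex H (f v) \<longleftrightarrow> singular_vertex G v" if "v \<in> verts G" for v
    using out[OF that] finite_image_iff[OF inj] by (auto simp: singular_vertex_def)
  have sum: "(q \<circ> f) v = (\<Oplus>\<^bsub>B\<^esub>e\<in>out_arcs G v. (t \<circ> g) e \<otimes>\<^bsub>B\<^esub> ((t \<circ> g) e)\<^sup>\<star>\<^bsub>B\<^esub>)"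
    if v: "v \<in> verts G" "\<not> singular_vertex G v" for v
  proof -
    have "(\<lambda>e. t e \<otimes>\<^bsub>B\<^esub> (t e)\<^sup>\<star>\<^bsub>B\<^esub>) \<in> g ` out_arcs G v \<rightarrow> carrier B"
      using ge by (auto simp: out_arcs_def)
    from H.M.finsum_reindex[OF this inj]
    show ?thesis using H.p_eq_sum[OF fv[OF v(1)]] sing[OF v(1)] v(2) out[OF v(1)] by simp
  qed
  have neq: "g e \<noteq> g e'" if "e \<in> arcs G" "e' \<in> arcs G" "e \<noteq> e'" for e e'
    using that g(1) by (auto dest: inj_onD)
  have neq': "f v \<noteq> f w" if "v \<in> verts G" "w \<in> verts G" "v \<noteq> w" for v w
    using that f(1) by (auto dest: inj_onD)
  have P: "projection B ((q \<circ> f) v)" if "v \<in> verts G" for v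
    using fv[OF that] by (simp add: projection_def H.p_star H.p_idem)
  have I: "partial_isometry B ((t \<circ> g) e)"
      "((t \<circ> g) e)\<^sup>\<star>\<^bsub>B\<^esub> \<otimes>\<^bsub>B\<^esub> (t \<circ> g) e = (q \<circ> f) (head G e)"
      "projection_le B ((t \<circ> g) e \<otimes>\<^bsub>B\<^esub> ((t \<circ> g) e)\<^sup>\<star>\<^bsub>B\<^esub>) ((q \<circ> f) (tail G e))" if "e \<in> arcs G" for e
    using ge[OF that] ends[OF that] H.p_tail_range[of "g e"] H.range_p_tail[of "g e"]
    by (simp_all add: partial_isometry_def H.s_partial H.s_star_s projection_le_def)
  show ?thesis
    unfolding ck_family_def
  proof (intro conjI ballI impI P I sum)
    show "projection_orth B ((q \<circ> f) v) ((q \<circ> f) w)" if "v \<in> verts G" "w \<in> verts G" "v \<noteq> w" for v w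
      using H.p_orth[OF fv fv neq'] that by (simp add: projection_orth_def)
    show "projection_orth B ((t \<circ> g) e \<otimes>\<^bsub>B\<^esub> ((t \<circ> g) e)\<^sup>\<star>\<^bsub>B\<^esub>) ((t \<circ> g) e' \<otimes>\<^bsub>B\<^esub> ((t \<circ> g) e')\<^sup>\<star>\<^bsub>B\<^esub>)"
      if "e \<in> arcs G" "e' \<in> arcs G" "e \<noteq> e'" for e e'
      using H.s_orth[OF ge ge neq] that by (simp add: projection_orth_def)
  qed
qed

text \<open>Families are pulled back in both directions: along the inverse bijections to get an
  \<open>H\<close>-family in \<open>A\<close>, and along \<open>f\<close> and \<open>g\<close> to
  apply universality for \<open>G\<close> to a given \<open>H\<close>-family.\<close>

lemma is_graph_cstar_algebra_iso:
  assumes A: "is_graph_cstar_algebra G A" and G: "wf_digraph G" and H: "wf_digraph H"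
    and f: "bij_betw f (verts G) (verts H)" and g: "bij_betw g (arcs G) (arcs H)"
    and ends: "\<And>e. e \<in> arcs G \<Longrightarrow> tail H (g e) = f (tail G e)"
      "\<And>e. e \<in> arcs G \<Longrightarrow> head H (g e) = f (head G e)"
  shows "is_graph_cstar_algebra H A"
proof -
  interpret G: wf_digraph G by (rule G)
  interpret H: wf_digraph H by (rule H)
  obtain p s where ps: "universal_ck_family G A p s" "cstar_generates A (p ` verts G \<union> s ` arcs G)"
    and cA: "cstar_algebra A"
    using A unfolding is_graph_cstar_algebra_def by blast
  let ?f = "inv_into (verts G) f" and ?g = "inv_into (arcs G) g"
  have f': "bij_betw ?f (verts H) (verts G)" and g': "bij_betw ?g (arcs H) (arcs G)"
    using f g by (simp_all add: bij_betw_inv_into)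
  have ff: "?f (f v) = v" if "v \<in> verts G" for v using f that by (simp add: bij_betw_inv_into_left)
  have ff': "f (?f v) = v" if "v \<in> verts H" for v using f that by (simp add: bij_betw_inv_into_right)
  have gg: "?g (g v) = v" if "v \<in> arcs G" for v using g that by (simp add: bij_betw_inv_into_left)
  have gg': "g (?g v) = v" if "v \<in> arcs H" for v using g that by (simp add: bij_betw_inv_into_right)
  have fv: "f v \<in> verts H" if "v \<in> verts G" for v using f that by (auto simp: bij_betw_def)
  have fv': "?f v \<in> verts G" if "v \<in> verts H" for v using f' that by (auto simp: bij_betw_def)
  have ge: "g v \<in> arcs H" if "v \<in> arcs G" for v using g that by (auto simp: bij_betw_def)
  have ge': "?g v \<in> arcs G" if "v \<in> arcs H" for v using g' that by (auto simp: bij_betw_def)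
  have ends': "tail G (?g e) = ?f (tail H e)" "head G (?g e) = ?f (head H e)" if "e \<in> arcs H" for e
    using ends[OF ge'[OF that]] ff[of "tail G (?g e)"] ff[of "head G (?g e)"] ge'[OF that] gg'[OF that] by auto
  have out: "out_arcs H (f v) = g ` out_arcs G v" if v: "v \<in> verts G" for v
  proof -
    have "e \<in> g ` out_arcs G v" if "e \<in> out_arcs H (f v)" for e
      using that ends'[of e] ff[OF v] gg'[of e] ge'[of e] by (auto simp: out_arcs_def image_iff intro!: bexI[of _ "?g e"])
    then show ?thesis using ends ge by (auto simp: out_arcs_def)
  qed
  have out': "out_arcs G (?f v) = ?g ` out_arcs H v" if v: "v \<in> verts H" for v
  proof -
    have "out_arcs H v = g ` out_arcs G (?f v)" using out[OF fv'[OF v]] ff'[OF v] by simp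
    then have "?g ` out_arcs H v = (\<lambda>e. ?g (g e)) ` out_arcs G (?f v)" by (simp add: image_image)
    also have "\<dots> = out_arcs G (?f v)" using gg by (force simp: out_arcs_def)
    finally show ?thesis by simp
  qed
  have ck: "ck_family H A (p \<circ> ?f) (s \<circ> ?g)"
    using ps(1) f' g' ends' out' cA G H unfolding universal_ck_family_def
    by (intro ck_family_pullback[of A H G p s]) (auto simp: bij_betw_def)
  have "\<exists>h\<in>cstar_hom A B. (\<forall>v\<in>verts H. h ((p \<circ> ?f) v) = q v) \<and> (\<forall>e\<in>arcs H. h ((s \<circ> ?g) e) = t e)"
    if B: "cstar_algebra B" "ck_family H B q t" for B :: "real cstar" and q t
  proof -
    have "ck_family G B (q \<circ> f) (t \<circ> g)"
      using B f g ends out G H by (intro ck_family_pullback[of B G H q t]) (auto simp: bij_betw_def)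
    then obtain h where "h \<in> cstar_hom A B" "\<forall>v\<in>verts G. h (p v) = q (f v)" "\<forall>e\<in>arcs G. h (s e) = t (g e)"
      using ps(1) B(1) unfolding universal_ck_family_def by (metis comp_apply)
    then show ?thesis using fv' ge' ff' gg' by (intro bexI[of _ h]) auto
  qed
  moreover have "(p \<circ> ?f) ` verts H = p ` verts G" "(s \<circ> ?g) ` arcs H = s ` arcs G"
    by (simp_all only: image_comp[symmetric] bij_betw_imp_surj_on[OF f'] bij_betw_imp_surj_on[OF g'])
  ultimately show ?thesis
    unfolding is_graph_cstar_algebra_def universal_ck_family_def using cA ck ps(2) by metis
qed

text \<open>The vertex \<open>v\<close> becomes \<open>(v, 0)\<close> and receives an infinite path \<open>\<dots> \<rightarrow> (v, 2) \<rightarrow> (v, 1) \<rightarrow> (v, 0)\<close>.\<close>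

definition head_graph :: "('v, 'e) pre_digraph \<Rightarrow> ('v \<times> nat, 'e + 'v \<times> nat) pre_digraph" where
  "head_graph G = \<lparr>verts = verts G \<times> UNIV,
     arcs = Inl ` arcs G \<union> Inr ` (verts G \<times> UNIV),
     tail = case_sum (\<lambda>e. (tail G e, 0)) (\<lambda>(v, i). (v, Suc i)),
     head = case_sum (\<lambda>e. (head G e, 0)) (\<lambda>(v, i). (v, i))\<rparr>"

lemma head_graph_simps [simp]:
  "verts (head_graph G) = verts G \<times> UNIV"
  "arcs (head_graph G) = Inl ` arcs G \<union> Inr ` (verts G \<times> UNIV)"
  "tail (head_graph G) (Inl e) = (tail G e, 0)" "tail (head_graph G) (Inr (v, i)) = (v, Suc i)"
  "head (head_graph G) (Inl e) = (head G e, 0)" "head (head_graph G) (Inr (v, i)) = (v, i)"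
  by (simp_all add: head_graph_def)

lemma wf_head_graph: "wf_digraph G \<Longrightarrow> wf_digraph (head_graph G)"
  by (auto simp: wf_digraph_def)

text \<open>Level 0 keeps the edges of \<open>G\<close> and thus its singular vertices. A vertex on
  an attached path emits one edge, so it is never singular and its summation relation has a single
  term.\<close>

lemma out_arcs_head_graph:
  "out_arcs (head_graph G) (v, 0) = Inl ` out_arcs G v"
  "v \<in> verts G \<Longrightarrow> out_arcs (head_graph G) (v, Suc i) = {Inr (v, i)}"
  by (auto simp: out_arcs_def)

section \<open>The stabilization as a graph algebra\<close>

lemma (in cstar_algebra) norm_finsum_le:
  assumes "finite I" "f \<in> I \<rightarrow> carrier A" "\<And>i. i \<in> I \<Longrightarrow> \<parallel>f i\<parallel> \<le> c"
  shows "\<parallel>\<Oplus>i\<in>I. f i\<parallel> \<le> real (card I) * c"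
  using assms
proof (induction I rule: finite_induct)
  case (insert i I)
  then have "\<parallel>f i \<oplus> (\<Oplus>i\<in>I. f i)\<parallel> \<le> c + real (card I) * c"
    using norm_add[of "f i" "\<Oplus>i\<in>I. f i"] insert.prems(2)[of i] by (fastforce simp: Pi_iff)
  then show ?case using insert by (simp add: algebra_simps)
qed (simp add: norm_zero)

section \<open>The Cuntz-Krieger family in the stabilization\<close>

locale stabilized_ck = A: ck_digraph A G p s + cstar_tensor_product A \<K> B \<tau>
  for A :: "('a, 'm) cstar_scheme" and G :: "('v, 'e) pre_digraph" and p s
    and B :: "('b, 'k) cstar_scheme" and \<tau>
begin

definition mu :: "'a \<Rightarrow> nat \<Rightarrow> nat \<Rightarrow> 'b" where
  "mu a i j = \<tau> a (matrix_unit i j)"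

lemma mu_closed [simp]: "a \<in> carrier A \<Longrightarrow> mu a i j \<in> carrier B"
  by (simp add: mu_def tensor_closed matrix_unit_carrier)

lemma mu_smult: "a \<in> carrier A \<Longrightarrow> mu (c \<odot>\<^bsub>A\<^esub> a) i j = c \<odot>\<^bsub>B\<^esub> mu a i j"
  by (simp add: mu_def tensor_smult_left matrix_unit_carrier)

lemma mu_add: "\<lbrakk>a \<in> carrier A; b \<in> carrier A\<rbrakk> \<Longrightarrow> mu (a \<oplus>\<^bsub>A\<^esub> b) i j = mu a i j \<oplus>\<^bsub>B\<^esub> mu b i j"
  by (simp add: mu_def tensor_add_left matrix_unit_carrier)

lemma mu_zero: "mu \<zero>\<^bsub>A\<^esub> i j = \<zero>\<^bsub>B\<^esub>"
  using mu_smult[of "\<zero>\<^bsub>A\<^esub>" 0 i j] by (simp add: A.zero_simps B.zero_simps)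

lemma mu_star: "a \<in> carrier A \<Longrightarrow> (mu a i j)\<^sup>\<star>\<^bsub>B\<^esub> = mu (a\<^sup>\<star>\<^bsub>A\<^esub>) j i"
  by (simp add: mu_def tensor_star matrix_unit_carrier matrix_unit_star)

lemma mu_norm: "a \<in> carrier A \<Longrightarrow> \<parallel>mu a i j\<parallel>\<^bsub>B\<^esub> = \<parallel>a\<parallel>\<^bsub>A\<^esub>"
  by (simp add: mu_def tensor_norm matrix_unit_carrier matrix_unit_norm)

lemma mu_diff: "\<lbrakk>a \<in> carrier A; b \<in> carrier A\<rbrakk> \<Longrightarrow> mu (a \<ominus>\<^bsub>A\<^esub> b) i j = mu a i j \<ominus>\<^bsub>B\<^esub> mu b i j"
  using mu_smult[of b "-1" i j] by (simp add: A.M.minus_eq B.M.minus_eq A.smult_minus_one B.smult_minus_one mu_add)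

lemma mu_mult:
  assumes "a \<in> carrier A" "b \<in> carrier A"
  shows "mu a i j \<otimes>\<^bsub>B\<^esub> mu b k l = (if j = k then mu (a \<otimes>\<^bsub>A\<^esub> b) i l else \<zero>\<^bsub>B\<^esub>)"
proof -
  have "\<tau> x \<zero>\<^bsub>\<K>\<^esub> = \<zero>\<^bsub>B\<^esub>" if "x \<in> carrier A" for x
    using that tensor_smult_right[OF that matrix_unit_carrier, of 0 0 0]
    by (simp add: B.zero_simps tensor_closed matrix_unit_carrier flip: zero_K_eq_smult)
  then show ?thesis
    using assms by (simp add: mu_def tensor_mult matrix_unit_carrier matrix_unit_mult)
qed

lemma mu_finsum:
  assumes "finite I" "f \<in> I \<rightarrow> carrier A"
  shows "mu (\<Oplus>\<^bsub>A\<^esub>x\<in>I. f x) i j = (\<Oplus>\<^bsub>B\<^esub>x\<in>I. mu (f x) i j)"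
  using assms
proof (induction I rule: finite_induct)
  case (insert x I)
  then have f: "f \<in> I \<rightarrow> carrier A" "f x \<in> carrier A" "\<And>y. y \<in> I \<Longrightarrow> f y \<in> carrier A" by auto
  then show ?case
    using insert by (subst A.M.finsum_insert B.M.finsum_insert; (subst B.M.finsum_insert)?)
      (use f in \<open>auto simp: mu_add A.M.finsum_closed\<close>)
qed (simp add: mu_zero)

definition vp :: "'v \<times> nat \<Rightarrow> 'b" where
  "vp = (\<lambda>(v, i). mu (p v) i i)"

definition ep :: "'e + 'v \<times> nat \<Rightarrow> 'b" where
  "ep = case_sum (\<lambda>e. mu (s e) 0 0) (\<lambda>(v, i). mu (p v) (Suc i) i)"

lemma vp_simps [simp]: "vp (v, i) = mu (p v) i i"
  and ep_simps [simp]: "ep (Inl e) = mu (s e) 0 0" "ep (Inr (v, i)) = mu (p v) (Suc i) i"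
  by (simp_all add: vp_def ep_def)

lemma ep_range:
  "e \<in> arcs G \<Longrightarrow> ep (Inl e) \<otimes>\<^bsub>B\<^esub> (ep (Inl e))\<^sup>\<star>\<^bsub>B\<^esub> = mu (s e \<otimes>\<^bsub>A\<^esub> (s e)\<^sup>\<star>\<^bsub>A\<^esub>) 0 0"
  "v \<in> verts G \<Longrightarrow> ep (Inr (v, i)) \<otimes>\<^bsub>B\<^esub> (ep (Inr (v, i)))\<^sup>\<star>\<^bsub>B\<^esub> = mu (p v) (Suc i) (Suc i)"
  by (simp_all add: mu_star mu_mult A.p_star A.p_idem)

lemma ck_family_head_graph: "ck_family (head_graph G) B vp ep"
  unfolding ck_family_def
proof (intro conjI ballI impI)
  fix x assume "x \<in> verts (head_graph G)"
  then show "projection B (vp x)"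
    by (auto simp: projection_def mu_star mu_mult A.p_star A.p_idem)
next
  fix x y assume "x \<in> verts (head_graph G)" "y \<in> verts (head_graph G)" "x \<noteq> y"
  then show "projection_orth B (vp x) (vp y)"
    by (auto simp: projection_orth_def mu_mult mu_zero A.p_mult split: if_splits)
next
  fix x assume x: "x \<in> arcs (head_graph G)"
  then show "partial_isometry B (ep x)"
    by (auto simp: partial_isometry_def mu_star mu_mult A.s_partial A.p_star A.p_idem)
  show "(ep x)\<^sup>\<star>\<^bsub>B\<^esub> \<otimes>\<^bsub>B\<^esub> ep x = vp (head (head_graph G) x)"
    using x by (auto simp: mu_star mu_mult A.s_star_s A.p_star A.p_idem)
  show "projection_le B (ep x \<otimes>\<^bsub>B\<^esub> (ep x)\<^sup>\<star>\<^bsub>B\<^esub>) (vp (tail (head_graph G) x))"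
    using x by (auto simp: projection_le_def ep_range mu_mult A.p_tail_range A.range_p_tail A.p_idem simp del: ep_simps)
next
  fix x y assume xy: "x \<in> arcs (head_graph G)" "y \<in> arcs (head_graph G)" "x \<noteq> y"
  have "(ep x \<otimes>\<^bsub>B\<^esub> (ep x)\<^sup>\<star>\<^bsub>B\<^esub>) \<otimes>\<^bsub>B\<^esub> (ep y \<otimes>\<^bsub>B\<^esub> (ep y)\<^sup>\<star>\<^bsub>B\<^esub>) = \<zero>\<^bsub>B\<^esub>"
  proof (cases x)
    case x: (Inl e)
    then show ?thesis
    proof (cases y)
      case (Inl f)
      then have "e \<in> arcs G" "f \<in> arcs G" "e \<noteq> f" using x xy by auto
      then show ?thesis unfolding x Inl by (simp only: ep_range) (simp add: mu_mult A.s_orth mu_zero)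
    next
      case (Inr q)
      obtain w j where "q = (w, j)" by (cases q)
      then show ?thesis using x xy Inr by (auto simp: ep_range mu_mult simp del: ep_simps)
    qed
  next
    case x: (Inr q)
    obtain v i where q: "q = (v, i)" "v \<in> verts G" using x xy(1) by auto
    then show ?thesis
    proof (cases y)
      case (Inl f)
      then show ?thesis using x xy q by (auto simp: ep_range mu_mult simp del: ep_simps)
    next
      case (Inr q')
      then obtain w j where q': "q' = (w, j)" "w \<in> verts G" using xy(2) by auto
      \<comment> \<open>On different levels the matrix units already annihilate each other; on the
        same level the vertices must differ, and orthogonality of the \<open>p v\<close> takes
        over.\<close>
      have "v \<noteq> w" if "i = j" using that xy(3) x Inr q q' by simp
      then show ?thesis
        unfolding x Inr q q' ep_range(2)[OF q(2)] ep_range(2)[OF q'(2)]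
        using q q' by (simp add: mu_mult A.p_orth mu_zero)
    qed
  qed
  then show "projection_orth B (ep x \<otimes>\<^bsub>B\<^esub> (ep x)\<^sup>\<star>\<^bsub>B\<^esub>) (ep y \<otimes>\<^bsub>B\<^esub> (ep y)\<^sup>\<star>\<^bsub>B\<^esub>)"
    by (simp add: projection_orth_def)
next
  fix x assume x: "x \<in> verts (head_graph G)" "\<not> singular_vertex (head_graph G) x"
  obtain v i where vi: "x = (v, i)" "v \<in> verts G" using x(1) by auto
  show "vp x = (\<Oplus>\<^bsub>B\<^esub>e\<in>out_arcs (head_graph G) x. ep e \<otimes>\<^bsub>B\<^esub> (ep e)\<^sup>\<star>\<^bsub>B\<^esub>)"
  \<comment> \<open>At level 0 the relation is that of \<open>G\<close>, moved entrywise by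
    \<open>mu\<close>; at a higher level the sum has one term, equal to the vertex
    projection.\<close>
  proof (cases i)
    case 0
    have fin: "finite (out_arcs G v)" and reg: "\<not> singular_vertex G v"
      using x(2) by (auto simp: vi 0 singular_vertex_def out_arcs_head_graph finite_image_iff)
    have "(\<lambda>e. ep e \<otimes>\<^bsub>B\<^esub> (ep e)\<^sup>\<star>\<^bsub>B\<^esub>) \<in> Inl ` out_arcs G v \<rightarrow> carrier B"
      by (auto simp: ep_range simp del: ep_simps)
    then have "(\<Oplus>\<^bsub>B\<^esub>e\<in>out_arcs (head_graph G) x. ep e \<otimes>\<^bsub>B\<^esub> (ep e)\<^sup>\<star>\<^bsub>B\<^esub>)
        = (\<Oplus>\<^bsub>B\<^esub>e\<in>out_arcs G v. ep (Inl e) \<otimes>\<^bsub>B\<^esub> (ep (Inl e))\<^sup>\<star>\<^bsub>B\<^esub>)"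
      by (simp add: vi 0 out_arcs_head_graph B.M.finsum_reindex)
    also have "\<dots> = (\<Oplus>\<^bsub>B\<^esub>e\<in>out_arcs G v. mu (s e \<otimes>\<^bsub>A\<^esub> (s e)\<^sup>\<star>\<^bsub>A\<^esub>) 0 0)"
      by (rule B.M.finsum_cong') (auto simp: ep_range simp del: ep_simps)
    also have "\<dots> = mu (p v) 0 0"
      using mu_finsum[OF fin, of "\<lambda>e. s e \<otimes>\<^bsub>A\<^esub> (s e)\<^sup>\<star>\<^bsub>A\<^esub>"] A.p_eq_sum[OF vi(2) reg] by (simp add: Pi_iff)
    finally show ?thesis by (simp add: vi 0)
  next
    case (Suc i')
    then show ?thesis
      using vi by (simp add: out_arcs_head_graph mu_star mu_mult A.p_star A.p_idem)
  qed
qed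

text \<open>Multiplying along the attached paths and taking adjoints produces \<open>p v\<close> and
  \<open>s e\<close> at every matrix position. From there all of \<open>A\<close> is reached at
  every position, then elementary tensors by approximating the compact factor, and finally
  everything by \<open>tensor_dense\<close>.\<close>

lemma generates_head_graph:
  assumes gen: "cstar_generates A (p ` verts G \<union> s ` arcs G)"
  shows "cstar_generates B (vp ` verts (head_graph G) \<union> ep ` arcs (head_graph G))" (is "cstar_generates B ?X")
  unfolding cstar_generates_def
proof (intro conjI allI impI)
  show "?X \<subseteq> carrier B" by auto
  fix S assume cl: "closed_star_subalgebra B S \<and> ?X \<subseteq> S"
  then have S: "S \<subseteq> carrier B" "\<zero>\<^bsub>B\<^esub> \<in> S"
    and S_add: "\<And>x y. x \<in> S \<Longrightarrow> y \<in> S \<Longrightarrow> x \<oplus>\<^bsub>B\<^esub> y \<in> S"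
    and S_mult: "\<And>x y. x \<in> S \<Longrightarrow> y \<in> S \<Longrightarrow> x \<otimes>\<^bsub>B\<^esub> y \<in> S"
    and S_smult: "\<And>c x. x \<in> S \<Longrightarrow> c \<odot>\<^bsub>B\<^esub> x \<in> S"
    and S_star: "\<And>x. x \<in> S \<Longrightarrow> x\<^sup>\<star>\<^bsub>B\<^esub> \<in> S"
    unfolding closed_star_subalgebra_def by simp_all
  have lim: "\<forall>f l. (\<forall>n. f n \<in> S) \<and> l \<in> carrier B \<and> cstar_tendsto B f l \<longrightarrow> l \<in> S"
    using cl unfolding closed_star_subalgebra_def by (elim conjE)
  have X: "?X \<subseteq> S" using cl by (rule conjunct2)
  have S_lim: "l \<in> S" if "\<And>n. f n \<in> S" "l \<in> carrier B" "cstar_tendsto B f l" for f l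
    using lim[rule_format, of f l] that by simp
  have S_close: "l \<in> S" if l: "l \<in> carrier B" and c: "\<And>\<epsilon>. \<epsilon> > 0 \<Longrightarrow> \<exists>x\<in>S. \<parallel>x \<ominus>\<^bsub>B\<^esub> l\<parallel>\<^bsub>B\<^esub> < \<epsilon>" for l
    by (rule B.norm_close_seq[OF S(1) l c]) (use S_lim l in auto)
  have diag: "mu (p v) i i \<in> S" if "v \<in> verts G" for v i
  proof -
    have "vp (v, i) \<in> S" using X that by (auto simp del: vp_simps)
    then show ?thesis by simp
  qed
  have step: "mu (p v) (Suc i) i \<in> S" if "v \<in> verts G" for v i
  proof -
    have "ep (Inr (v, i)) \<in> S" using X that by (auto simp del: ep_simps)
    then show ?thesis by simp
  qed
  have edge: "mu (s e) 0 0 \<in> S" if "e \<in> arcs G" for e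
  proof -
    have "ep (Inl e) \<in> S" using X that by (auto simp del: ep_simps)
    then show ?thesis by simp
  qed
  have col: "mu (p v) i 0 \<in> S" if v: "v \<in> verts G" for v i
  proof (induction i)
    case (Suc i)
    then show ?case
      using S_mult[OF step[OF v, of i] Suc] v by (simp add: mu_mult A.p_idem)
  qed (use diag v in simp)
  have row: "mu (p v) 0 i \<in> S" if v: "v \<in> verts G" for v i
    using S_star[OF col[OF v, of i]] v by (simp add: mu_star A.p_star)
  \<comment> \<open>All positions are demanded at once: the product at position
    \<open>(i, j)\<close> is assembled from \<open>x\<close> at \<open>(i, 0)\<close> and
    \<open>y\<close> at \<open>(0, j)\<close>.\<close>
  define A' where "A' = {a \<in> carrier A. \<forall>i j. mu a i j \<in> S}"
  have "closed_star_subalgebra A A'"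
    unfolding closed_star_subalgebra_def
  proof (intro conjI ballI allI impI)
    show "x \<otimes>\<^bsub>A\<^esub> y \<in> A'" if xy: "x \<in> A'" "y \<in> A'" for x y
    proof -
      have "mu (x \<otimes>\<^bsub>A\<^esub> y) i j \<in> S" for i j
        using S_mult[of "mu x i 0" "mu y 0 j"] xy by (simp add: A'_def mu_mult)
      then show ?thesis using xy by (simp add: A'_def)
    qed
    show "l \<in> A'" if "(\<forall>n. f n \<in> A') \<and> l \<in> carrier A \<and> cstar_tendsto A f l" for f l
    proof -
      have "mu l i j \<in> S" for i j
      proof (rule S_lim)
        show "cstar_tendsto B (\<lambda>n. mu (f n) i j) (mu l i j)"
          using that by (simp add: cstar_tendsto_def A'_def mu_norm flip: mu_diff)
      qed (use that in \<open>auto simp: A'_def\<close>)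
      then show ?thesis using that by (simp add: A'_def)
    qed
  qed (use S S_add S_smult S_star in \<open>auto simp: A'_def mu_zero mu_add mu_smult simp flip: mu_star\<close>)
  moreover have "p ` verts G \<union> s ` arcs G \<subseteq> A'"
  proof -
    have "mu (p v) i j \<in> S" if v: "v \<in> verts G" for v i j
      using S_mult[OF col[OF v, of i] row[OF v, of j]] v by (simp add: mu_mult A.p_idem)
    moreover have "mu (s e) i j \<in> S" if e: "e \<in> arcs G" for e i j
      using S_mult[OF S_mult[OF col[OF A.tail_in_verts[OF e], of i] edge[OF e]] row[OF A.head_in_verts[OF e], of j]] e
      by (simp add: mu_mult A.s_tail A.s_head)
    ultimately show ?thesis by (auto simp: A'_def)
  qed
  ultimately have A': "A' = carrier A" using gen unfolding cstar_generates_def by simp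
  have mu_S: "mu a i j \<in> S" if "a \<in> carrier A" for a i j
  proof -
    have "a \<in> A'" using that A' by simp
    then show ?thesis by (simp add: A'_def)
  qed
  have tau_S: "\<tau> a c \<in> S" if a: "a \<in> carrier A" and c: "c \<in> carrier \<K>" for a c
  proof (rule S_close)
    fix \<epsilon> :: real assume e: "\<epsilon> > 0"
    have na: "0 \<le> \<parallel>a\<parallel>\<^bsub>A\<^esub>" using A.norm_nonneg[OF a] .
    \<comment> \<open>The added 1 avoids a zero denominator for \<open>a = 0\<close> and makes the
      norm of \<open>a\<close> times \<delta> strictly less than \<epsilon>.\<close>
    define \<delta> where "\<delta> = \<epsilon> / (\<parallel>a\<parallel>\<^bsub>A\<^esub> + 1)"
    have d: "\<delta> > 0" unfolding \<delta>_def using na e by (intro divide_pos_pos) linarith+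
    define \<Phi> where "\<Phi> = {d \<in> carrier \<K>. \<tau> a d \<in> S}"
    have "\<exists>F\<in>\<Phi>. \<exists>D\<in>carrier \<K>. c = F \<oplus>\<^bsub>\<K>\<^esub> D \<and> \<parallel>D\<parallel>\<^bsub>\<K>\<^esub> \<le> \<delta>"
    proof (rule compact_approx[OF c d])
      show "k \<odot>\<^bsub>\<K>\<^esub> matrix_unit i j \<in> \<Phi>" for k i j
        using S_smult[OF mu_S[OF a, of i j], of k] a matrix_unit_carrier[of i j] compact_operator_smult
        by (simp add: \<Phi>_def mu_def tensor_smult_right K_simps(1))
      show "T \<oplus>\<^bsub>\<K>\<^esub> U \<in> \<Phi>" if "T \<in> \<Phi>" "U \<in> \<Phi>" for T U
        using that S_add a compact_operator_add by (simp add: \<Phi>_def tensor_add_right K_simps(1))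
    qed (auto simp: \<Phi>_def)
    then obtain F D where FD: "F \<in> \<Phi>" "D \<in> carrier \<K>" "c = F \<oplus>\<^bsub>\<K>\<^esub> D" "\<parallel>D\<parallel>\<^bsub>\<K>\<^esub> \<le> \<delta>" by blast
    have F: "F \<in> carrier \<K>" "\<tau> a F \<in> S" using FD(1) by (simp_all add: \<Phi>_def)
    have "\<tau> a c = \<tau> a D \<oplus>\<^bsub>B\<^esub> \<tau> a F"
      using FD F a by (simp add: tensor_add_right tensor_closed B.M.a_comm)
    then have "\<tau> a D = \<tau> a c \<ominus>\<^bsub>B\<^esub> \<tau> a F"
      using FD F a by (intro B.add_diff_cancel') (auto simp: tensor_closed)
    moreover have "\<parallel>\<tau> a F \<ominus>\<^bsub>B\<^esub> \<tau> a c\<parallel>\<^bsub>B\<^esub> = \<parallel>\<tau> a c \<ominus>\<^bsub>B\<^esub> \<tau> a F\<parallel>\<^bsub>B\<^esub>"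
      by (rule B.norm_diff_commute) (use F a c tensor_closed in auto)
    ultimately have "\<parallel>\<tau> a F \<ominus>\<^bsub>B\<^esub> \<tau> a c\<parallel>\<^bsub>B\<^esub> = \<parallel>\<tau> a D\<parallel>\<^bsub>B\<^esub>" by simp
    also have "\<dots> \<le> \<parallel>a\<parallel>\<^bsub>A\<^esub> * \<delta>"
      using FD a na by (simp add: tensor_norm mult_left_mono)
    also have "\<dots> < \<epsilon>" using e na by (simp add: \<delta>_def divide_simps)
    finally show "\<exists>x\<in>S. \<parallel>x \<ominus>\<^bsub>B\<^esub> \<tau> a c\<parallel>\<^bsub>B\<^esub> < \<epsilon>" using F by blast
  qed (use a c tensor_closed in auto)
  have sum_S: "(\<Oplus>\<^bsub>B\<^esub>i\<in>{..<n::nat}. \<tau> (f i) (g i)) \<in> S"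
    if "f \<in> {..<n} \<rightarrow> carrier A" "g \<in> {..<n} \<rightarrow> carrier \<K>" for f g n
    using that
  proof (induction n)
    case (Suc n)
    then have fg: "\<tau> (f i) (g i) \<in> S" if "i < Suc n" for i using tau_S that by (simp add: Pi_iff)
    have "(\<Oplus>\<^bsub>B\<^esub>i\<in>insert n {..<n}. \<tau> (f i) (g i)) = \<tau> (f n) (g n) \<oplus>\<^bsub>B\<^esub> (\<Oplus>\<^bsub>B\<^esub>i\<in>{..<n}. \<tau> (f i) (g i))"
      using fg S(1) by (intro B.M.finsum_insert) (auto simp: subset_iff)
    then show ?case using S_add[OF fg[of n]] Suc by (simp add: lessThan_Suc Pi_iff)
  qed (use S in simp)
  have "l \<in> S" if l: "l \<in> carrier B" for l
  proof (rule S_close[OF l])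
    fix \<epsilon> :: real assume "\<epsilon> > 0"
    then obtain n :: nat and f g where fg: "f \<in> {..<n} \<rightarrow> carrier A" "g \<in> {..<n} \<rightarrow> carrier \<K>"
      "\<parallel>l \<ominus>\<^bsub>B\<^esub> (\<Oplus>\<^bsub>B\<^esub>i\<in>{..<n}. \<tau> (f i) (g i))\<parallel>\<^bsub>B\<^esub> < \<epsilon>"
      using tensor_dense[OF l] by blast
    then show "\<exists>x\<in>S. \<parallel>x \<ominus>\<^bsub>B\<^esub> l\<parallel>\<^bsub>B\<^esub> < \<epsilon>"
      using sum_S[OF fg(1,2)] S(1) l B.norm_diff_commute[of l] by (intro bexI[OF _ sum_S[OF fg(1,2)]]) (auto simp: subset_iff)
  qed
  then show "S = carrier B" using S(1) by blast
qed

end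

section \<open>Partial isometries along the attached paths of a given family\<close>

locale head_graph_rep = stabilized_ck A G p s B \<tau> + D: ck_digraph D "head_graph G" Q T
  for A :: "('a, 'm) cstar_scheme" and G :: "('v, 'e) pre_digraph" and p s
    and B :: "('b, 'k) cstar_scheme" and \<tau> and D :: "('d, 'l) cstar_scheme" and Q T +
  fixes \<pi> :: "'a \<Rightarrow> 'd"
  assumes \<pi>_hom: "\<pi> \<in> cstar_hom A D"
    and \<pi>_p: "v \<in> verts G \<Longrightarrow> \<pi> (p v) = Q (v, 0)"
    and \<pi>_s: "e \<in> arcs G \<Longrightarrow> \<pi> (s e) = T (Inl e)"
begin

lemmas \<pi>_simps = cstar_hom_simps[OF A.cstar_algebra_axioms D.cstar_algebra_axioms \<pi>_hom]
lemmas \<pi>_zero = cstar_hom_zero[OF A.cstar_algebra_axioms D.cstar_algebra_axioms \<pi>_hom]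
lemmas \<pi>_norm_le = cstar_hom_norm_le[OF A.cstar_algebra_axioms D.cstar_algebra_axioms \<pi>_hom]

declare \<pi>_simps(1) [simp]

primrec W :: "'v \<Rightarrow> nat \<Rightarrow> 'd" where
  "W v 0 = Q (v, 0)"
| "W v (Suc i) = T (Inr (v, i)) \<otimes>\<^bsub>D\<^esub> W v i"

lemma Q_closed [simp]: "v \<in> verts G \<Longrightarrow> Q (v, i) \<in> carrier D"
  and T_Inl_closed [simp]: "e \<in> arcs G \<Longrightarrow> T (Inl e) \<in> carrier D"
  and T_Inr_closed [simp]: "v \<in> verts G \<Longrightarrow> T (Inr (v, i)) \<in> carrier D"
  by simp_all

lemma W_closed [simp]: "v \<in> verts G \<Longrightarrow> W v i \<in> carrier D"
  by (induction i) simp_all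

lemma W_initial: "v \<in> verts G \<Longrightarrow> W v i \<otimes>\<^bsub>D\<^esub> Q (v, 0) = W v i"
  by (induction i) (simp_all add: D.p_idem D.mult_assoc)

lemma W_final: "v \<in> verts G \<Longrightarrow> Q (v, i) \<otimes>\<^bsub>D\<^esub> W v i = W v i"
proof (cases i)
  case (Suc k)
  assume v: "v \<in> verts G"
  then show ?thesis
    using D.s_tail[of "Inr (v, k)"] Suc by (simp flip: D.mult_assoc)
qed (simp add: D.p_idem)

text \<open>The product telescopes: the innermost factor is the projection at \<open>(v, i)\<close>,
  which \<open>W v i\<close> absorbs on the left.\<close>

lemma W_star_W: "v \<in> verts G \<Longrightarrow> (W v i)\<^sup>\<star>\<^bsub>D\<^esub> \<otimes>\<^bsub>D\<^esub> W v i = Q (v, 0)"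
proof (induction i)
  case (Suc i)
  have "(W v (Suc i))\<^sup>\<star>\<^bsub>D\<^esub> \<otimes>\<^bsub>D\<^esub> W v (Suc i)
      = (W v i)\<^sup>\<star>\<^bsub>D\<^esub> \<otimes>\<^bsub>D\<^esub> (((T (Inr (v, i)))\<^sup>\<star>\<^bsub>D\<^esub> \<otimes>\<^bsub>D\<^esub> T (Inr (v, i))) \<otimes>\<^bsub>D\<^esub> W v i)"
    using Suc.prems by (simp add: D.star_mult D.mult_assoc)
  also have "\<dots> = (W v i)\<^sup>\<star>\<^bsub>D\<^esub> \<otimes>\<^bsub>D\<^esub> W v i"
    using Suc.prems D.s_star_s[of "Inr (v, i)"] by (simp add: W_final)
  finally show ?case using Suc by simp
qed (simp add: D.p_star D.p_idem)

lemma W_orth: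
  assumes "v \<in> verts G" "w \<in> verts G" "(v, i) \<noteq> (w, j)"
  shows "(W v i)\<^sup>\<star>\<^bsub>D\<^esub> \<otimes>\<^bsub>D\<^esub> W w j = \<zero>\<^bsub>D\<^esub>"
proof -
  have "(W v i)\<^sup>\<star>\<^bsub>D\<^esub> = (W v i)\<^sup>\<star>\<^bsub>D\<^esub> \<otimes>\<^bsub>D\<^esub> Q (v, i)"
    using arg_cong[OF W_final[OF assms(1), of i], of "star D"] assms by (simp add: D.star_mult D.p_star)
  then have "(W v i)\<^sup>\<star>\<^bsub>D\<^esub> \<otimes>\<^bsub>D\<^esub> W w j
      = ((W v i)\<^sup>\<star>\<^bsub>D\<^esub> \<otimes>\<^bsub>D\<^esub> Q (v, i)) \<otimes>\<^bsub>D\<^esub> (Q (w, j) \<otimes>\<^bsub>D\<^esub> W w j)"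
    using W_final[OF assms(2), of j] by simp
  also have "\<dots> = (W v i)\<^sup>\<star>\<^bsub>D\<^esub> \<otimes>\<^bsub>D\<^esub> ((Q (v, i) \<otimes>\<^bsub>D\<^esub> Q (w, j)) \<otimes>\<^bsub>D\<^esub> W w j)"
    using assms by (simp add: D.mult_assoc)
  also have "Q (v, i) \<otimes>\<^bsub>D\<^esub> Q (w, j) = \<zero>\<^bsub>D\<^esub>"
    using D.p_orth[of "(v, i)" "(w, j)"] assms by auto
  finally show ?thesis using assms by (simp add: D.zero_simps)
qed

text \<open>The vertex \<open>(v, Suc i)\<close> emits one edge, so the summation relation gives
  equality where in general only an inequality of projections holds. This makes the range projection
  of \<open>W v i\<close> all of \<open>Q (v, i)\<close>.\<close>

lemma T_range: "v \<in> verts G \<Longrightarrow> T (Inr (v, i)) \<otimes>\<^bsub>D\<^esub> (T (Inr (v, i)))\<^sup>\<star>\<^bsub>D\<^esub> = Q (v, Suc i)"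
  using D.p_eq_sum[of "(v, Suc i)"] by (simp add: out_arcs_head_graph singular_vertex_def)

lemma W_W_star: "v \<in> verts G \<Longrightarrow> W v i \<otimes>\<^bsub>D\<^esub> (W v i)\<^sup>\<star>\<^bsub>D\<^esub> = Q (v, i)"
proof (induction i)
  case (Suc i)
  have "W v (Suc i) \<otimes>\<^bsub>D\<^esub> (W v (Suc i))\<^sup>\<star>\<^bsub>D\<^esub>
      = T (Inr (v, i)) \<otimes>\<^bsub>D\<^esub> (W v i \<otimes>\<^bsub>D\<^esub> (W v i)\<^sup>\<star>\<^bsub>D\<^esub>) \<otimes>\<^bsub>D\<^esub> (T (Inr (v, i)))\<^sup>\<star>\<^bsub>D\<^esub>"
    using Suc.prems by (simp add: D.star_mult D.mult_assoc)
  also have "\<dots> = T (Inr (v, i)) \<otimes>\<^bsub>D\<^esub> (T (Inr (v, i)))\<^sup>\<star>\<^bsub>D\<^esub>"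
    using Suc D.s_head[of "Inr (v, i)"] by simp
  finally show ?case using T_range Suc.prems by simp
qed (simp add: D.p_star D.p_idem)

lemma W_norm_le: "v \<in> verts G \<Longrightarrow> \<parallel>W v i\<parallel>\<^bsub>D\<^esub> \<le> 1"
proof -
  assume v: "v \<in> verts G"
  have "\<parallel>W v i\<parallel>\<^bsub>D\<^esub>\<^sup>2 \<le> 1"
    using D.norm_star_mult[of "W v i"] D.p_norm_le[of "(v, 0)"] v by (simp add: W_star_W)
  then show ?thesis using power2_le_imp_le[of "\<parallel>W v i\<parallel>\<^bsub>D\<^esub>" 1] by simp
qed

text \<open>Corner elements have a definite start and end vertex, which selects the partial
  isometries on either side of \<open>\<pi> a\<close>. They also absorb the projection left between
  two factors of a product.\<close>

definition corner :: "'v \<Rightarrow> 'v \<Rightarrow> 'a set" where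
  "corner v w = {a \<in> carrier A. p v \<otimes>\<^bsub>A\<^esub> a = a \<and> a \<otimes>\<^bsub>A\<^esub> p w = a}"

lemma corner_closed: "a \<in> corner v w \<Longrightarrow> a \<in> carrier A"
  by (simp add: corner_def)

lemma corner_zero: "\<lbrakk>v \<in> verts G; w \<in> verts G\<rbrakk> \<Longrightarrow> \<zero>\<^bsub>A\<^esub> \<in> corner v w"
  by (simp add: corner_def A.zero_simps)

lemma corner_mult:
  assumes "v \<in> verts G" "w \<in> verts G" "a \<in> corner v u" "b \<in> corner u' w"
  shows "a \<otimes>\<^bsub>A\<^esub> b \<in> corner v w"
  using assms A.mult_assoc[of "p v" a b] A.mult_assoc[of a b "p w"] by (simp add: corner_def)

lemma corner_mult_orth:
  assumes "u \<in> verts G" "u' \<in> verts G" "u \<noteq> u'" "a \<in> corner v u" "b \<in> corner u' w"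
  shows "a \<otimes>\<^bsub>A\<^esub> b = \<zero>\<^bsub>A\<^esub>"
proof -
  note ab = corner_closed[OF assms(4)] corner_closed[OF assms(5)]
  have "a \<otimes>\<^bsub>A\<^esub> b = (a \<otimes>\<^bsub>A\<^esub> p u) \<otimes>\<^bsub>A\<^esub> (p u' \<otimes>\<^bsub>A\<^esub> b)"
    using assms by (simp add: corner_def)
  also have "\<dots> = a \<otimes>\<^bsub>A\<^esub> ((p u \<otimes>\<^bsub>A\<^esub> p u') \<otimes>\<^bsub>A\<^esub> b)"
    using assms ab by (simp add: A.mult_assoc)
  finally show ?thesis using assms ab by (simp add: A.p_orth A.zero_simps)
qed

lemma corner_smult: "\<lbrakk>v \<in> verts G; w \<in> verts G; a \<in> corner v w\<rbrakk> \<Longrightarrow> c \<odot>\<^bsub>A\<^esub> a \<in> corner v w"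
  by (simp add: corner_def A.mult_smult_left A.mult_smult_right)

lemma corner_star:
  assumes "v \<in> verts G" "w \<in> verts G" "a \<in> corner v w"
  shows "a\<^sup>\<star>\<^bsub>A\<^esub> \<in> corner w v"
  using assms A.star_mult[of "p v" a] A.star_mult[of a "p w"] by (simp add: corner_def A.p_star)

definition nu :: "'v \<times> nat \<Rightarrow> 'v \<times> nat \<Rightarrow> 'a \<Rightarrow> 'd" where
  "nu = (\<lambda>(v, i) (w, j) a. W v i \<otimes>\<^bsub>D\<^esub> \<pi> a \<otimes>\<^bsub>D\<^esub> (W w j)\<^sup>\<star>\<^bsub>D\<^esub>)"

lemma nu_simp [simp]: "nu (v, i) (w, j) a = W v i \<otimes>\<^bsub>D\<^esub> \<pi> a \<otimes>\<^bsub>D\<^esub> (W w j)\<^sup>\<star>\<^bsub>D\<^esub>"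
  by (simp add: nu_def)

lemma nu_closed: "\<lbrakk>v \<in> verts G; w \<in> verts G; a \<in> carrier A\<rbrakk> \<Longrightarrow> nu (v, i) (w, j) a \<in> carrier D"
  by simp

text \<open>The inner factor is \<open>Q (w, 0)\<close> if the inner indices agree, and
  \<open>\<pi> a\<close> absorbs it because \<open>a\<close> ends in \<open>w\<close>; otherwise the
  two partial isometries have orthogonal ranges.\<close>

lemma nu_mult:
  assumes c: "v \<in> verts G" "w \<in> verts G" "v' \<in> verts G" "w' \<in> verts G" "a \<in> corner v w" "b \<in> corner v' w'"
  shows "nu (v, i) (w, j) a \<otimes>\<^bsub>D\<^esub> nu (v', i') (w', j') b
    = (if (w, j) = (v', i') then nu (v, i) (w', j') (a \<otimes>\<^bsub>A\<^esub> b) else \<zero>\<^bsub>D\<^esub>)"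
proof -
  note ab = corner_closed[OF c(5)] corner_closed[OF c(6)]
  have *: "nu (v, i) (w, j) a \<otimes>\<^bsub>D\<^esub> nu (v', i') (w', j') b
      = W v i \<otimes>\<^bsub>D\<^esub> (\<pi> a \<otimes>\<^bsub>D\<^esub> (((W w j)\<^sup>\<star>\<^bsub>D\<^esub> \<otimes>\<^bsub>D\<^esub> W v' i') \<otimes>\<^bsub>D\<^esub> (\<pi> b \<otimes>\<^bsub>D\<^esub> (W w' j')\<^sup>\<star>\<^bsub>D\<^esub>)))"
    using c ab by (simp add: D.mult_assoc)
  show ?thesis
  proof (cases "(w, j) = (v', i')")
    case True
    have "\<pi> a \<otimes>\<^bsub>D\<^esub> Q (w, 0) = \<pi> a"
      using c ab \<pi>_simps(3)[of a "p w"] by (simp add: \<pi>_p corner_def)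
    then have "\<pi> a \<otimes>\<^bsub>D\<^esub> (Q (w, 0) \<otimes>\<^bsub>D\<^esub> (\<pi> b \<otimes>\<^bsub>D\<^esub> (W w' j')\<^sup>\<star>\<^bsub>D\<^esub>)) = \<pi> a \<otimes>\<^bsub>D\<^esub> (\<pi> b \<otimes>\<^bsub>D\<^esub> (W w' j')\<^sup>\<star>\<^bsub>D\<^esub>)"
      using c ab D.mult_assoc[of "\<pi> a" "Q (w, 0)" "\<pi> b \<otimes>\<^bsub>D\<^esub> (W w' j')\<^sup>\<star>\<^bsub>D\<^esub>"] by simp
    moreover have "(W w j)\<^sup>\<star>\<^bsub>D\<^esub> \<otimes>\<^bsub>D\<^esub> W v' i' = Q (w, 0)" using True c ab by (simp add: W_star_W)
    ultimately show ?thesis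
      unfolding * using True c ab by (simp add: D.mult_assoc \<pi>_simps(3))
  next
    case False
    have "(W w j)\<^sup>\<star>\<^bsub>D\<^esub> \<otimes>\<^bsub>D\<^esub> W v' i' = \<zero>\<^bsub>D\<^esub>" using W_orth[OF c(2,3) False] .
    then show ?thesis unfolding * if_not_P[OF False] using c ab by (simp add: D.zero_simps)
  qed
qed

lemma nu_zero: "\<lbrakk>v \<in> verts G; w \<in> verts G\<rbrakk> \<Longrightarrow> nu (v, i) (w, j) \<zero>\<^bsub>A\<^esub> = \<zero>\<^bsub>D\<^esub>"
  by (simp add: \<pi>_zero D.zero_simps)

lemma nu_smult:
  "\<lbrakk>v \<in> verts G; w \<in> verts G; a \<in> carrier A\<rbrakk> \<Longrightarrow> nu (v, i) (w, j) (c \<odot>\<^bsub>A\<^esub> a) = c \<odot>\<^bsub>D\<^esub> nu (v, i) (w, j) a"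
  by (simp add: \<pi>_simps(4) D.mult_smult_left D.mult_smult_right)

lemma nu_add:
  "\<lbrakk>v \<in> verts G; w \<in> verts G; a \<in> carrier A; b \<in> carrier A\<rbrakk>
    \<Longrightarrow> nu (v, i) (w, j) (a \<oplus>\<^bsub>A\<^esub> b) = nu (v, i) (w, j) a \<oplus>\<^bsub>D\<^esub> nu (v, i) (w, j) b"
  by (simp add: \<pi>_simps(2) D.mult_add_left D.mult_add_right)

lemma nu_star:
  "\<lbrakk>v \<in> verts G; w \<in> verts G; a \<in> carrier A\<rbrakk>
    \<Longrightarrow> (nu (v, i) (w, j) a)\<^sup>\<star>\<^bsub>D\<^esub> = nu (w, j) (v, i) (a\<^sup>\<star>\<^bsub>A\<^esub>)"
  by (simp add: \<pi>_simps(5) D.star_mult D.star_star D.mult_assoc)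

lemma nu_norm_le:
  assumes "v \<in> verts G" "w \<in> verts G" "a \<in> carrier A"
  shows "\<parallel>nu (v, i) (w, j) a\<parallel>\<^bsub>D\<^esub> \<le> \<parallel>a\<parallel>\<^bsub>A\<^esub>"
proof -
  have 0: "0 \<le> \<parallel>\<pi> a\<parallel>\<^bsub>D\<^esub>" "0 \<le> \<parallel>W v i\<parallel>\<^bsub>D\<^esub>" "0 \<le> \<parallel>W w j\<parallel>\<^bsub>D\<^esub>" using assms by (simp_all add: D.norm_nonneg)
  have "\<parallel>nu (v, i) (w, j) a\<parallel>\<^bsub>D\<^esub> \<le> \<parallel>W v i \<otimes>\<^bsub>D\<^esub> \<pi> a\<parallel>\<^bsub>D\<^esub> * \<parallel>W w j\<parallel>\<^bsub>D\<^esub>"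
    using D.norm_mult[of "W v i \<otimes>\<^bsub>D\<^esub> \<pi> a" "(W w j)\<^sup>\<star>\<^bsub>D\<^esub>"] assms by (simp add: D.norm_star)
  also have "\<dots> \<le> \<parallel>W v i \<otimes>\<^bsub>D\<^esub> \<pi> a\<parallel>\<^bsub>D\<^esub>"
    using W_norm_le[OF assms(2), of j] D.norm_nonneg[of "W v i \<otimes>\<^bsub>D\<^esub> \<pi> a"] assms by (intro mult_right_le_one_le) (auto simp: 0)
  also have "\<dots> \<le> \<parallel>W v i\<parallel>\<^bsub>D\<^esub> * \<parallel>\<pi> a\<parallel>\<^bsub>D\<^esub>" using assms by (intro D.norm_mult) auto
  also have "\<dots> \<le> \<parallel>\<pi> a\<parallel>\<^bsub>D\<^esub>" using W_norm_le[OF assms(1), of i] 0 by (intro mult_left_le_one_le) auto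
  finally show ?thesis using \<pi>_norm_le[OF assms(3)] by simp
qed

text \<open>The parameter \<open>K\<close> confines vertices and levels to an index set that
  products and adjoints do not leave. For finite \<open>K\<close> this will give a norm bound
  depending only on \<open>K\<close>.\<close>

definition gens :: "('v \<times> nat) set \<Rightarrow> ('b \<times> 'd) set" where
  "gens K = {(mu a i j, nu (v, i) (w, j) a) |v i w j a. (v, i) \<in> K \<and> (w, j) \<in> K \<and> a \<in> corner v w}"

lemma gensI: "\<lbrakk>(v, i) \<in> K; (w, j) \<in> K; a \<in> corner v w\<rbrakk> \<Longrightarrow> (mu a i j, nu (v, i) (w, j) a) \<in> gens K"
  unfolding gens_def
  by (rule CollectI, rule exI[of _ v], rule exI[of _ i], rule exI[of _ w], rule exI[of _ j],
      rule exI[of _ a]) simp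

lemma gensE:
  assumes "z \<in> gens K"
  obtains v i w j a where "(v, i) \<in> K" "(w, j) \<in> K" "a \<in> corner v w" "z = (mu a i j, nu (v, i) (w, j) a)"
  using assms unfolding gens_def by (elim CollectE exE conjE) (rule that)

lemma star_relation_generators_gens:
  assumes K: "K \<subseteq> verts G \<times> UNIV"
  shows "star_relation_generators B D (gens K)"
proof -
  have V: "v \<in> verts G" if "(v, i) \<in> K" for v i using K that by auto
  show ?thesis
  proof (unfold_locales, goal_cases)
    case (1 x y)
    then show ?case by (elim gensE) (auto simp: V nu_closed corner_closed simp del: nu_simp)
  next
    case (2 x y x' y')
    obtain v i w j a where 1: "(v, i) \<in> K" "(w, j) \<in> K" "a \<in> corner v w" "(x, y) = (mu a i j, nu (v, i) (w, j) a)"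
      using 2(1) by (rule gensE)
    obtain v' i' w' j' a' where 2: "(v', i') \<in> K" "(w', j') \<in> K" "a' \<in> corner v' w'"
        "(x', y') = (mu a' i' j', nu (v', i') (w', j') a')"
      using 2(2) by (rule gensE)
    have xx: "x \<otimes>\<^bsub>B\<^esub> x' = (if j = i' then mu (a \<otimes>\<^bsub>A\<^esub> a') i j' else \<zero>\<^bsub>B\<^esub>)"
      using 1 2 corner_closed[OF 1(3)] corner_closed[OF 2(3)] by (simp add: mu_mult)
    have yy: "y \<otimes>\<^bsub>D\<^esub> y' = (if (w, j) = (v', i') then nu (v, i) (w', j') (a \<otimes>\<^bsub>A\<^esub> a') else \<zero>\<^bsub>D\<^esub>)"
      using 1 2 nu_mult[of v w v' w' a a' i j i' j'] V by (simp del: nu_simp)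
    show ?case
    proof (cases "(w, j) = (v', i')")
      case True
      have "a \<otimes>\<^bsub>A\<^esub> a' \<in> corner v w'" using 1 2 V by (intro corner_mult) auto
      then show ?thesis using gensI[OF 1(1) 2(2)] True by (simp add: xx yy del: nu_simp)
    next
      \<comment> \<open>Either the matrix positions do not match, or they do and the vertices
        differ, in which case the corners are orthogonal. Both components vanish, and the pair of
        zeros is the generator with coefficient zero.\<close>
      case False
      have "a \<otimes>\<^bsub>A\<^esub> a' = \<zero>\<^bsub>A\<^esub>" if "j = i'"
        using corner_mult_orth[of w v' a v a' w'] 1 2 V False that by auto
      then have "x \<otimes>\<^bsub>B\<^esub> x' = mu \<zero>\<^bsub>A\<^esub> i j'" by (simp add: xx mu_zero)
      moreover have "y \<otimes>\<^bsub>D\<^esub> y' = nu (v, i) (w', j') \<zero>\<^bsub>A\<^esub>"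
        using V[OF 1(1)] V[OF 2(2)] False unfolding yy by (simp only: nu_zero if_False)
      ultimately show ?thesis
        using gensI[OF 1(1) 2(2) corner_zero] V 1 2 by (simp del: nu_simp)
    qed
  next
    case (3 x y c)
    obtain v i w j a where 1: "(v, i) \<in> K" "(w, j) \<in> K" "a \<in> corner v w" "(x, y) = (mu a i j, nu (v, i) (w, j) a)"
      using 3 by (rule gensE)
    show ?case
      using gensI[OF 1(1,2) corner_smult[OF V[OF 1(1)] V[OF 1(2)] 1(3)], of c] 1 V
      corner_closed[OF 1(3)] by (simp add: mu_smult nu_smult del: nu_simp)
  next
    case (4 x y)
    obtain v i w j a where 1: "(v, i) \<in> K" "(w, j) \<in> K" "a \<in> corner v w" "(x, y) = (mu a i j, nu (v, i) (w, j) a)"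
      using 4 by (rule gensE)
    show ?case
      using gensI[OF 1(2,1) corner_star[OF V[OF 1(1)] V[OF 1(2)] 1(3)]] 1 V
      corner_closed[OF 1(3)] by (simp add: mu_star nu_star del: nu_simp)
  qed
qed

section \<open>Norm bounds for the span of the generating pairs\<close>

definition rel :: "('v \<times> nat) set \<Rightarrow> ('b \<times> 'd) set" where
  "rel K = star_relation_generators.span B D (gens K)"

lemma rel_star_relation: "K \<subseteq> verts G \<times> UNIV \<Longrightarrow> star_relation B D (rel K)"
  unfolding rel_def
  using star_relation_generators.star_relation_span[OF star_relation_generators_gens] .

lemma rel_zero: "K \<subseteq> verts G \<times> UNIV \<Longrightarrow> (\<zero>\<^bsub>B\<^esub>, \<zero>\<^bsub>D\<^esub>) \<in> rel K"
  unfolding rel_def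
  using star_relation_generators.span.span_zero[OF star_relation_generators_gens] .

lemma rel_step:
  "\<lbrakk>K \<subseteq> verts G \<times> UNIV; (x, y) \<in> rel K; (x', y') \<in> gens K\<rbrakk>
    \<Longrightarrow> (x \<oplus>\<^bsub>B\<^esub> x', y \<oplus>\<^bsub>D\<^esub> y') \<in> rel K"
  unfolding rel_def
  using star_relation_generators.span.span_step[OF star_relation_generators_gens] .

lemma rel_gens: "\<lbrakk>K \<subseteq> verts G \<times> UNIV; (x, y) \<in> gens K\<rbrakk> \<Longrightarrow> (x, y) \<in> rel K"
  unfolding rel_def
  using star_relation_generators.span_base[OF star_relation_generators_gens] .

lemma rel_induct [consumes 2, case_names zero step]:
  assumes "(x, y) \<in> rel K" "K \<subseteq> verts G \<times> UNIV" "P \<zero>\<^bsub>B\<^esub> \<zero>\<^bsub>D\<^esub>"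
    and "\<And>x y x' y'. (x, y) \<in> rel K \<Longrightarrow> P x y \<Longrightarrow> (x', y') \<in> gens K \<Longrightarrow> P (x \<oplus>\<^bsub>B\<^esub> x') (y \<oplus>\<^bsub>D\<^esub> y')"
  shows "P x y"
  using star_relation_generators.span.induct[OF star_relation_generators_gens[OF assms(2)], of x y P] assms
  unfolding rel_def by blast

text \<open>A finite sum involves finitely many generators, each with two indices. Enlarging the
  index set keeps the pairs already collected.\<close>

lemma rel_finite_support:
  assumes "(x, y) \<in> rel (verts G \<times> UNIV)"
  shows "\<exists>K. finite K \<and> K \<subseteq> verts G \<times> UNIV \<and> (x, y) \<in> rel K"
  using assms subset_refl
proof (induction rule: rel_induct)
  case zero
  show ?case using rel_zero[of "{}"] by blast
next
  case (step x y x' y')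
  obtain K where K: "finite K" "K \<subseteq> verts G \<times> UNIV" "(x, y) \<in> rel K" using step.IH by blast
  obtain v i w j a where 1: "(v, i) \<in> verts G \<times> UNIV" "(w, j) \<in> verts G \<times> UNIV" "a \<in> corner v w"
      "(x', y') = (mu a i j, nu (v, i) (w, j) a)"
    using step.hyps(2) by (rule gensE)
  let ?K = "insert (v, i) (insert (w, j) K)"
  have K': "?K \<subseteq> verts G \<times> UNIV" using K 1 by auto
  have mono: "(x, y) \<in> rel ?K"
    using K(3,2)
  proof (induction rule: rel_induct)
    case zero
    show ?case using rel_zero[OF K'] .
  next
    case (step x y x' y')
    have "(x', y') \<in> gens ?K" using step.hyps(2) unfolding gens_def by blast
    then show ?case using rel_step[OF K' step.IH] by blast
  qed
  have "(x', y') \<in> gens ?K" unfolding 1(4) by (rule gensI) (use 1 in auto)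
  from rel_step[OF K' mono this] show ?case
    using K(1) K' by (intro exI[of _ ?K]) simp
qed

text \<open>
  The coefficients of \<open>y\<close> are recovered from \<open>x\<close> by compressing with the projections
  \<open>p v \<otimes> e\<^bsub>ii\<^esub>\<close>, which bounds \<open>y\<close> by a multiple of \<open>x\<close> depending on the number of indices.
\<close>

lemma rel_coefficients:
  assumes xy: "(x, y) \<in> rel K" and K: "K \<subseteq> verts G \<times> UNIV" and fin: "finite K"
  shows "\<exists>a. (\<forall>k\<in>K. \<forall>l\<in>K. a (k, l) \<in> carrier A
      \<and> mu (p (fst k)) (snd k) (snd k) \<otimes>\<^bsub>B\<^esub> x \<otimes>\<^bsub>B\<^esub> mu (p (fst l)) (snd l) (snd l) = mu (a (k, l)) (snd k) (snd l))
    \<and> y = (\<Oplus>\<^bsub>D\<^esub>z\<in>K \<times> K. nu (fst z) (snd z) (a z))"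
  using xy K
proof (induction rule: rel_induct)
  case zero
  have V: "v \<in> verts G" if "(v, i) \<in> K" for v i using K that by auto
  have "(\<Oplus>\<^bsub>D\<^esub>z\<in>K \<times> K. nu (fst z) (snd z) \<zero>\<^bsub>A\<^esub>) = (\<Oplus>\<^bsub>D\<^esub>z\<in>K \<times> K. \<zero>\<^bsub>D\<^esub>)"
    by (intro D.M.finsum_cong') (auto simp: nu_zero V simp del: nu_simp)
  then show ?case
    by (intro exI[of _ "\<lambda>_. \<zero>\<^bsub>A\<^esub>"]) (auto simp: mu_zero B.zero_simps V)
next
  case (step x y x' y')
  obtain a where a: "\<And>k l. k \<in> K \<Longrightarrow> l \<in> K \<Longrightarrow> a (k, l) \<in> carrier A"
    and xa: "\<And>k l. k \<in> K \<Longrightarrow> l \<in> K \<Longrightarrow>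
      mu (p (fst k)) (snd k) (snd k) \<otimes>\<^bsub>B\<^esub> x \<otimes>\<^bsub>B\<^esub> mu (p (fst l)) (snd l) (snd l) = mu (a (k, l)) (snd k) (snd l)"
    and ya: "y = (\<Oplus>\<^bsub>D\<^esub>z\<in>K \<times> K. nu (fst z) (snd z) (a z))"
    using step.IH by blast
  obtain v0 i0 w0 j0 b where b: "(v0, i0) \<in> K" "(w0, j0) \<in> K" "b \<in> corner v0 w0"
      "(x', y') = (mu b i0 j0, nu (v0, i0) (w0, j0) b)"
    using step.hyps(2) by (rule gensE)
  have bc: "b \<in> carrier A" using corner_closed[OF b(3)] .
  have V: "fst k \<in> verts G" if "k \<in> K" for k using K that by auto
  have V0: "v0 \<in> verts G" "w0 \<in> verts G" using V[OF b(1)] V[OF b(2)] by simp_all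
  have xc: "x \<in> carrier B" using star_relation.R_closed(1)[OF rel_star_relation[OF K] step.hyps(1)] .
  have x'c: "x' \<in> carrier B" using b(4) bc by simp
  let ?z0 = "((v0, i0), (w0, j0))"
  \<comment> \<open>The contribution of the new generator to the coefficient family:
    \<open>b\<close> at its own index pair, zero everywhere else.\<close>
  define d where "d z = (if ?z0 = z then b else \<zero>\<^bsub>A\<^esub>)" for z
  have dc: "d z \<in> carrier A" for z using bc by (simp add: d_def)
  have nuc: "nu (fst z) (snd z) c \<in> carrier D" if "z \<in> K \<times> K" "c \<in> carrier A" for z c
    using that V nu_closed[of "fst (fst z)" "fst (snd z)" c "snd (fst z)" "snd (snd z)"] by auto
  have "mu (p v) i i \<otimes>\<^bsub>B\<^esub> (x \<oplus>\<^bsub>B\<^esub> x') \<otimes>\<^bsub>B\<^esub> mu (p w) j j = mu (a ((v, i), (w, j)) \<oplus>\<^bsub>A\<^esub> d ((v, i), (w, j))) i j"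
    if kl: "(v, i) \<in> K" "(w, j) \<in> K" for v i w j
  proof -
    have vw: "v \<in> verts G" "w \<in> verts G" using V[OF kl(1)] V[OF kl(2)] by simp_all
    have "mu (p v) i i \<otimes>\<^bsub>B\<^esub> x' \<otimes>\<^bsub>B\<^esub> mu (p w) j j = mu (d ((v, i), (w, j))) i j"
    proof (cases "((v, i), (w, j)) = ?z0")
      case True
      then show ?thesis using b(3,4) vw bc by (simp add: d_def mu_mult corner_def)
    next
      case False
      \<comment> \<open>Away from the position of the generator, compression gives zero: by the
        matrix units if a level differs, and by orthogonality of vertex projections if only a vertex
        differs.\<close>
      have "p v \<otimes>\<^bsub>A\<^esub> b \<otimes>\<^bsub>A\<^esub> p w = \<zero>\<^bsub>A\<^esub>" if "i = i0" "j = j0"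
      proof -
        have "p v \<otimes>\<^bsub>A\<^esub> b \<otimes>\<^bsub>A\<^esub> p w = (p v \<otimes>\<^bsub>A\<^esub> p v0) \<otimes>\<^bsub>A\<^esub> b \<otimes>\<^bsub>A\<^esub> (p w0 \<otimes>\<^bsub>A\<^esub> p w)"
        proof -
          have "b = p v0 \<otimes>\<^bsub>A\<^esub> b \<otimes>\<^bsub>A\<^esub> p w0" using b(3) by (simp add: corner_def)
          then have "p v \<otimes>\<^bsub>A\<^esub> b \<otimes>\<^bsub>A\<^esub> p w = p v \<otimes>\<^bsub>A\<^esub> (p v0 \<otimes>\<^bsub>A\<^esub> b \<otimes>\<^bsub>A\<^esub> p w0) \<otimes>\<^bsub>A\<^esub> p w" by simp
          then show ?thesis using vw V0 bc by (simp add: A.mult_assoc)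
        qed
        moreover have "v \<noteq> v0 \<or> w \<noteq> w0" using False that by auto
        ultimately show ?thesis using vw V0 bc by (auto simp: A.p_orth A.zero_simps)
      qed
      moreover have "d ((v, i), (w, j)) = \<zero>\<^bsub>A\<^esub>" unfolding d_def using False by (intro if_not_P) auto
      moreover have "x' = mu b i0 j0" using b(4) by simp
      ultimately show ?thesis using vw bc by (simp add: mu_mult mu_zero B.zero_simps)
    qed
    then show ?thesis
      using xa[OF kl] vw xc x'c a[OF kl] dc
      by (simp add: B.mult_add_left B.mult_add_right mu_add)
  qed
  moreover have "y \<oplus>\<^bsub>D\<^esub> y' = (\<Oplus>\<^bsub>D\<^esub>z\<in>K \<times> K. nu (fst z) (snd z) (a z \<oplus>\<^bsub>A\<^esub> d z))"
  proof -
    have "(\<Oplus>\<^bsub>D\<^esub>z\<in>K \<times> K. if ?z0 = z then nu (fst z) (snd z) b else \<zero>\<^bsub>D\<^esub>) = nu (v0, i0) (w0, j0) b"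
      using D.M.finsum_singleton[of ?z0 "K \<times> K" "\<lambda>z. nu (fst z) (snd z) b"] b(1,2) fin nuc bc
      by (simp del: nu_simp)
    then have "y \<oplus>\<^bsub>D\<^esub> y' = (\<Oplus>\<^bsub>D\<^esub>z\<in>K \<times> K. nu (fst z) (snd z) (a z))
        \<oplus>\<^bsub>D\<^esub> (\<Oplus>\<^bsub>D\<^esub>z\<in>K \<times> K. if ?z0 = z then nu (fst z) (snd z) b else \<zero>\<^bsub>D\<^esub>)"
      using ya b(4) by (simp del: nu_simp)
    also have "\<dots> = (\<Oplus>\<^bsub>D\<^esub>z\<in>K \<times> K. nu (fst z) (snd z) (a z)
        \<oplus>\<^bsub>D\<^esub> (if ?z0 = z then nu (fst z) (snd z) b else \<zero>\<^bsub>D\<^esub>))"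
      using nuc a bc by (intro D.M.finsum_addf[symmetric]) (auto simp del: nu_simp)
    also have "\<dots> = (\<Oplus>\<^bsub>D\<^esub>z\<in>K \<times> K. nu (fst z) (snd z) (a z \<oplus>\<^bsub>A\<^esub> d z))"
    proof (rule D.M.finsum_cong')
      fix z assume z: "z \<in> K \<times> K"
      obtain v i w j where z': "z = ((v, i), (w, j))" by (metis surj_pair)
      have vw: "v \<in> verts G" "w \<in> verts G" using z V by (auto simp: z')
      show "nu (fst z) (snd z) (a z) \<oplus>\<^bsub>D\<^esub> (if ?z0 = z then nu (fst z) (snd z) b else \<zero>\<^bsub>D\<^esub>)
          = nu (fst z) (snd z) (a z \<oplus>\<^bsub>A\<^esub> d z)"
      proof (cases "?z0 = z")
        case True
        then show ?thesis
          using nu_add[OF vw a[of "(v, i)" "(w, j)"] bc, of i j] z by (simp add: d_def z' del: nu_simp)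
      next
        case False
        have "d z = \<zero>\<^bsub>A\<^esub>" using False by (simp add: d_def)
        moreover have "a z \<in> carrier A" using a z by auto
        ultimately show ?thesis using nuc[OF z, of "a z"] by (simp add: if_not_P[OF False] del: nu_simp)
      qed
    qed (use nuc a dc in \<open>auto simp del: nu_simp\<close>)
    finally show ?thesis .
  qed
  ultimately show ?case
    using a dc by (intro exI[of _ "\<lambda>z. a z \<oplus>\<^bsub>A\<^esub> d z"]) (auto simp del: nu_simp)
qed

text \<open>Improving the bound to 1 needs one constant for all powers of a pair. Fixing a finite
  \<open>K\<close> first provides it, as \<open>rel K\<close> is closed under products and adjoints
  and therefore contains those powers.\<close>

lemma rel_contractive:
  assumes xy: "(x, y) \<in> rel (verts G \<times> UNIV)"
  shows "\<parallel>y\<parallel>\<^bsub>D\<^esub> \<le> \<parallel>x\<parallel>\<^bsub>B\<^esub>"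
proof -
  obtain K where K: "finite K" "K \<subseteq> verts G \<times> UNIV" "(x, y) \<in> rel K"
    using rel_finite_support[OF xy] by blast
  interpret R: star_relation B D "rel K" using rel_star_relation[OF K(2)] .
  show ?thesis
  proof (rule R.bounded_imp_contractive[OF _ K(3)])
    fix x y assume xy: "(x, y) \<in> rel K"
    have x: "x \<in> carrier B" using R.R_closed(1)[OF xy] .
    obtain a where a: "\<And>k l. k \<in> K \<Longrightarrow> l \<in> K \<Longrightarrow> a (k, l) \<in> carrier A"
      and xa: "\<And>k l. k \<in> K \<Longrightarrow> l \<in> K \<Longrightarrow>
        mu (p (fst k)) (snd k) (snd k) \<otimes>\<^bsub>B\<^esub> x \<otimes>\<^bsub>B\<^esub> mu (p (fst l)) (snd l) (snd l) = mu (a (k, l)) (snd k) (snd l)"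
      and ya: "y = (\<Oplus>\<^bsub>D\<^esub>z\<in>K \<times> K. nu (fst z) (snd z) (a z))"
      using rel_coefficients[OF xy K(2,1)] by blast
    have V: "fst k \<in> verts G" if "k \<in> K" for k using K that by auto
    have an: "\<parallel>a (k, l)\<parallel>\<^bsub>A\<^esub> \<le> \<parallel>x\<parallel>\<^bsub>B\<^esub>" if kl: "k \<in> K" "l \<in> K" for k l
    proof -
      let ?p = "mu (p (fst k)) (snd k) (snd k)" and ?q = "mu (p (fst l)) (snd l) (snd l)"
      have c: "?p \<in> carrier B" "?q \<in> carrier B" using V kl by auto
      have n: "\<parallel>?p\<parallel>\<^bsub>B\<^esub> \<le> 1" "\<parallel>?q\<parallel>\<^bsub>B\<^esub> \<le> 1" using V kl A.p_norm_le by (auto simp: mu_norm)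
      have "\<parallel>a (k, l)\<parallel>\<^bsub>A\<^esub> = \<parallel>?p \<otimes>\<^bsub>B\<^esub> x \<otimes>\<^bsub>B\<^esub> ?q\<parallel>\<^bsub>B\<^esub>" using xa[OF kl] a[OF kl] by (simp add: mu_norm)
      also have "\<dots> \<le> \<parallel>?p \<otimes>\<^bsub>B\<^esub> x\<parallel>\<^bsub>B\<^esub> * \<parallel>?q\<parallel>\<^bsub>B\<^esub>" using c x by (intro B.norm_mult) auto
      also have "\<dots> \<le> \<parallel>?p \<otimes>\<^bsub>B\<^esub> x\<parallel>\<^bsub>B\<^esub>" using n c x by (intro mult_right_le_one_le B.norm_nonneg) auto
      also have "\<dots> \<le> \<parallel>?p\<parallel>\<^bsub>B\<^esub> * \<parallel>x\<parallel>\<^bsub>B\<^esub>" using c x by (intro B.norm_mult) auto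
      also have "\<dots> \<le> \<parallel>x\<parallel>\<^bsub>B\<^esub>" using n c x by (intro mult_left_le_one_le B.norm_nonneg) auto
      finally show ?thesis .
    qed
    \<comment> \<open>One summand for each pair of indices, each bounded by its coefficient and
      hence by the norm of \<open>x\<close>.\<close>
    show "\<parallel>y\<parallel>\<^bsub>D\<^esub> \<le> real (card (K \<times> K)) * \<parallel>x\<parallel>\<^bsub>B\<^esub>"
      unfolding ya
    proof (rule D.norm_finsum_le)
      show "(\<lambda>z. nu (fst z) (snd z) (a z)) \<in> K \<times> K \<rightarrow> carrier D"
        using a V nu_closed by (force simp del: nu_simp)
      fix z assume z: "z \<in> K \<times> K"
      obtain v i w j where z': "z = ((v, i), (w, j))" by (metis surj_pair)
      have "\<parallel>nu (v, i) (w, j) (a z)\<parallel>\<^bsub>D\<^esub> \<le> \<parallel>a z\<parallel>\<^bsub>A\<^esub>"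
        using z V a by (intro nu_norm_le) (auto simp: z')
      then show "\<parallel>nu (fst z) (snd z) (a z)\<parallel>\<^bsub>D\<^esub> \<le> \<parallel>x\<parallel>\<^bsub>B\<^esub>"
        using an[of "(v, i)" "(w, j)"] z by (simp add: z' del: nu_simp)
    qed (use K in simp)
  qed
qed

text \<open>Once the relation pairs each generator of the stabilization with its prescribed image,
  contractivity and density supply the homomorphism.\<close>

lemma hom_exists:
  assumes gen: "cstar_generates A (p ` verts G \<union> s ` arcs G)"
  shows "\<exists>h\<in>cstar_hom B D. (\<forall>v\<in>verts (head_graph G). h (vp v) = Q v) \<and> (\<forall>e\<in>arcs (head_graph G). h (ep e) = T e)"
proof -
  let ?R = "rel (verts G \<times> UNIV)"
  interpret R: star_relation B D ?R using rel_star_relation by simp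
  have RI: "(mu a i j, nu (v, i) (w, j) a) \<in> ?R" if "v \<in> verts G" "w \<in> verts G" "a \<in> corner v w" for v i w j a
    using that by (intro rel_gens gensI) auto
  have pc: "p v \<in> corner v v" if "v \<in> verts G" for v using that by (simp add: corner_def A.p_idem)
  \<comment> \<open>The coefficient is \<open>p v\<close>, which \<pi> sends to the initial
    projection of \<open>W v i\<close>; what remains is the range projection, equal to
    \<open>Q (v, i)\<close>.\<close>
  have vp: "(vp (v, i), Q (v, i)) \<in> ?R" if v: "v \<in> verts G" for v i
    using RI[OF v v pc[OF v], of i i] v by (simp add: \<pi>_p W_initial W_W_star)
  have ep1: "(ep (Inl e), T (Inl e)) \<in> ?R" if e: "e \<in> arcs G" for e
  proof -
    have "s e \<in> corner (tail G e) (head G e)" using e by (simp add: corner_def A.s_head A.s_tail)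
    then have "(mu (s e) 0 0, nu (tail G e, 0) (head G e, 0) (s e)) \<in> ?R" using e by (intro RI) auto
    moreover have "nu (tail G e, 0) (head G e, 0) (s e) = T (Inl e)"
      using e D.s_head[of "Inl e"] D.s_tail[of "Inl e"] D.p_star[of "(head G e, 0)"] by (simp add: \<pi>_s)
    ultimately show ?thesis by (simp del: nu_simp)
  qed
  have ep2: "(ep (Inr (v, i)), T (Inr (v, i))) \<in> ?R" if v: "v \<in> verts G" for v i
  proof -
    have "nu (v, Suc i) (v, i) (p v) = T (Inr (v, i)) \<otimes>\<^bsub>D\<^esub> ((W v i \<otimes>\<^bsub>D\<^esub> Q (v, 0)) \<otimes>\<^bsub>D\<^esub> (W v i)\<^sup>\<star>\<^bsub>D\<^esub>)"
      using v by (simp add: \<pi>_p D.mult_assoc)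
    also have "\<dots> = T (Inr (v, i))"
      using v D.s_head[of "Inr (v, i)"] by (simp add: W_initial W_W_star)
    finally show ?thesis using RI[OF v v pc[OF v], of "Suc i" i] by (simp del: nu_simp)
  qed
  have vpR: "(vp x, Q x) \<in> ?R" if x: "x \<in> verts (head_graph G)" for x
  proof -
    obtain v i where "x = (v, i)" "v \<in> verts G" using x by auto
    then show ?thesis using vp[of v i] by simp
  qed
  have epR: "(ep x, T x) \<in> ?R" if x: "x \<in> arcs (head_graph G)" for x
  proof (cases x)
    case (Inl e)
    then have "e \<in> arcs G" using x by auto
    then show ?thesis unfolding Inl by (rule ep1)
  next
    case (Inr q)
    then obtain v i where q: "q = (v, i)" "v \<in> verts G" using x by auto
    show ?thesis unfolding Inr q(1) by (rule ep2[OF q(2)])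
  qed
  have dense: "\<exists>(x', y') \<in> ?R. \<parallel>x' \<ominus>\<^bsub>B\<^esub> x\<parallel>\<^bsub>B\<^esub> < \<epsilon>" if "x \<in> carrier B" "\<epsilon> > 0" for x \<epsilon>
  proof (rule R.dense_if_generates[OF generates_head_graph[OF gen] _ _ that])
    show "vp ` verts (head_graph G) \<union> ep ` arcs (head_graph G) \<subseteq> fst ` ?R"
    proof (intro Un_least image_subsetI)
      show "vp x \<in> fst ` ?R" if "x \<in> verts (head_graph G)" for x
        using that vpR[of x] by (intro image_eqI[of _ fst "(vp x, Q x)"]) simp_all
      show "ep x \<in> fst ` ?R" if "x \<in> arcs (head_graph G)" for x
        using that epR[of x] by (intro image_eqI[of _ fst "(ep x, T x)"]) simp_all
    qed
    show "(\<zero>\<^bsub>B\<^esub>, \<zero>\<^bsub>D\<^esub>) \<in> ?R" by (rule rel_zero) simp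
  qed
  have "\<exists>h\<in>cstar_hom B D. \<forall>(x, y)\<in>?R. h x = y"
    by (rule R.extends_to_hom[OF rel_contractive dense])
  then obtain h where h: "h \<in> cstar_hom B D" "\<forall>(x, y)\<in>?R. h x = y" by blast
  have "h (vp v) = Q v" if "v \<in> verts (head_graph G)" for v
    using bspec[OF h(2) vpR[OF that]] by (simp only: prod.case)
  moreover have "h (ep e) = T e" if "e \<in> arcs (head_graph G)" for e
    using bspec[OF h(2) epR[OF that]] by (simp only: prod.case)
  ultimately show ?thesis using h(1) by blast
qed

end

text \<open>Existence of the family and its generation property hold inside the stabilization;
  universality is tested against one given family at a time.\<close>

theorem is_graph_cstar_algebra_stabilization:
  assumes G: "wf_digraph G" and A: "is_graph_cstar_algebra G A"
    and B: "is_stabilization A B"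
  shows "is_graph_cstar_algebra (head_graph G) B"
proof -
  obtain p s where ps: "universal_ck_family G A p s" and gen: "cstar_generates A (p ` verts G \<union> s ` arcs G)"
    and cA: "cstar_algebra A"
    using A unfolding is_graph_cstar_algebra_def by blast
  obtain \<tau> where "cstar_tensor_product A \<K> B \<tau>" using B unfolding is_stabilization_def by blast
  then interpret stabilized_ck A G p s B \<tau>
    using cA G ps
    by (simp add: stabilized_ck_def ck_digraph_def ck_digraph_axioms_def universal_ck_family_def)
  have "\<exists>h\<in>cstar_hom B D. (\<forall>v\<in>verts (head_graph G). h (vp v) = Q v) \<and> (\<forall>e\<in>arcs (head_graph G). h (ep e) = T e)"
    if D: "cstar_algebra D" and ck: "ck_family (head_graph G) D Q T" for D :: "real cstar" and Q T
  proof -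
    \<comment> \<open>Level 0 of a family for the larger graph is a family for \<open>G\<close>,
      since no edges leaving level 0 were added. Universality of \<open>A\<close> then yields
      \<pi>.\<close>
    have "ck_family G D (Q \<circ> (\<lambda>v. (v, 0))) (T \<circ> Inl)"
      by (rule ck_family_pullback[OF D G wf_head_graph[OF G] ck])
        (auto simp: inj_on_def out_arcs_head_graph)
    then have "\<exists>h\<in>cstar_hom A D. (\<forall>v\<in>verts G. h (p v) = Q (v, 0)) \<and> (\<forall>e\<in>arcs G. h (s e) = T (Inl e))"
      using conjunct2[OF ps[unfolded universal_ck_family_def], rule_format, of D "Q \<circ> (\<lambda>v. (v, 0))" "T \<circ> Inl"] D
      by simp
    then obtain \<pi> where \<pi>: "\<pi> \<in> cstar_hom A D" "\<forall>v\<in>verts G. \<pi> (p v) = Q (v, 0)"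
      "\<forall>e\<in>arcs G. \<pi> (s e) = T (Inl e)"
      by blast
    interpret head_graph_rep A G p s B \<tau> D Q T \<pi>
      using D wf_head_graph[OF G] ck \<pi> stabilized_ck_axioms
      by (simp add: head_graph_rep_def head_graph_rep_axioms_def ck_digraph_def ck_digraph_axioms_def)
    show ?thesis using hom_exists[OF gen] .
  qed
  then have "universal_ck_family (head_graph G) B vp ep"
    unfolding universal_ck_family_def using ck_family_head_graph by simp
  then show ?thesis
    unfolding is_graph_cstar_algebra_def
    using generates_head_graph[OF gen] B.cstar_algebra_axioms by (intro conjI exI)
qed

text \<open>Enumerating vertices and edges moves the graph to the type of natural numbers; endpoints
  are read off through the inverse enumeration of edges.\<close>

lemma countable_digraph_nat_iso:
  assumes "countable_digraph H"
  obtains F :: "(nat, nat) pre_digraph" and f g where "countable_digraph F"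
    "bij_betw f (verts H) (verts F)" "bij_betw g (arcs H) (arcs F)"
    "\<And>e. e \<in> arcs H \<Longrightarrow> tail F (g e) = f (tail H e)"
    "\<And>e. e \<in> arcs H \<Longrightarrow> head F (g e) = f (head H e)"
proof -
  interpret wf_digraph H using assms by (simp add: countable_digraph_def)
  define f where "f = to_nat_on (verts H)"
  define g where "g = to_nat_on (arcs H)"
  have inj: "inj_on f (verts H)" "inj_on g (arcs H)"
    using assms by (simp_all add: countable_digraph_def f_def g_def inj_on_to_nat_on)
  define F where "F = \<lparr>verts = f ` verts H, arcs = g ` arcs H,
    tail = \<lambda>n. f (tail H (inv_into (arcs H) g n)), head = \<lambda>n. f (head H (inv_into (arcs H) g n))\<rparr>"
  have "tail F (g e) = f (tail H e)" "head F (g e) = f (head H e)" if "e \<in> arcs H" for e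
    using that inj by (simp_all add: F_def inv_into_f_f)
  moreover from this have "countable_digraph F"
    unfolding countable_digraph_def wf_digraph_def by (auto simp: F_def)
  moreover have "bij_betw f (verts H) (verts F)" "bij_betw g (arcs H) (arcs F)"
    using inj by (simp_all add: F_def bij_betw_def)
  ultimately show ?thesis using that by blast
qed

theorem corollary4p3:
  fixes G :: "('v, 'e) pre_digraph"
  assumes "countable_digraph G"
  shows "\<exists>F :: (nat, nat) pre_digraph. countable_digraph F \<and>
    (\<forall>(A :: 'a cstar) (AK :: 'b cstar).
       is_graph_cstar_algebra G A \<and> is_stabilization A AK \<longrightarrow>
       (\<exists>C :: 'b cstar. is_graph_cstar_algebra F C \<and> AK \<cong>\<^sub>C C))"
proof -
  have wf: "wf_digraph G" and H: "countable_digraph (head_graph G)"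
    using assms by (auto simp: countable_digraph_def wf_head_graph)
  obtain F :: "(nat, nat) pre_digraph" and f g where F: "countable_digraph F"
    "bij_betw f (verts (head_graph G)) (verts F)" "bij_betw g (arcs (head_graph G)) (arcs F)"
    "\<And>e. e \<in> arcs (head_graph G) \<Longrightarrow> tail F (g e) = f (tail (head_graph G) e)"
    "\<And>e. e \<in> arcs (head_graph G) \<Longrightarrow> head F (g e) = f (head (head_graph G) e)"
    using countable_digraph_nat_iso[OF H] by metis
  \<comment> \<open>The stabilization itself serves as the algebra of \<open>F\<close>, with the
    identity as isomorphism. The graph was fixed before \<open>A\<close> and \<open>AK\<close>, so
    it depends on \<open>G\<close> alone.\<close>
  have "is_graph_cstar_algebra F AK \<and> AK \<cong>\<^sub>C AK"
    if "is_graph_cstar_algebra G A" "is_stabilization A AK" for A :: "'a cstar" and AK :: "'b cstar"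
  proof
    have "is_graph_cstar_algebra (head_graph G) AK"
      using is_graph_cstar_algebra_stabilization[OF wf that] .
    then show "is_graph_cstar_algebra F AK"
      by (rule is_graph_cstar_algebra_iso[OF _ _ _ F(2-5)])
        (use H F(1) in \<open>auto simp: countable_digraph_def\<close>)
    have "(\<lambda>x. x) \<in> cstar_hom AK AK" "bij_betw (\<lambda>x. x) (carrier AK) (carrier AK)"
      by (auto simp: cstar_hom_def bij_betw_def)
    then show "AK \<cong>\<^sub>C AK" unfolding cstar_isomorphic_def by blast
  qed
  then show ?thesis using F(1) by blast
qed

end
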